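(* Let $N,k,d,m,n\ge 1$ be integers, let $\Omega\subset\mathbb{R}^N$ be an open set, put $X:=\mathbb{R}^{k\times N}\times\mathbb{R}^{d\times N}\times\mathbb{R}^m$, and let $1\le p<\infty$. Let $$F:\ \mathbb{R}^{(kN+dN+m)\times N^n}\times\ldots\times\mathbb{R}^{(kN+dN+m)\times N}\times X\ \to\ \mathbb{R}$$ be a nonnegative continuous function. Let $v=(\nabla u,h,\psi)\in\mathcal{B}(\Omega)\cap BV(\Omega,X)\cap L^\infty(\Omega,X)$ satisfy $$F\big(0,\ldots,0,v(x)\big)=0\quad\text{for a.e. } x\in\Omega .$$ Then for every family $\{v_\varepsilon\}_{\varepsilon>0}\subset\mathcal{B}(\Omega)\cap W^{n,1}_{loc}(\Omega,X)$ such that $v_\varepsilon\to v$ in $L^p$ as $\varepsilon\to0^+$, we have $$\liminf_{\varepsilon\to0^+}\int_\Omega\frac1\varepsilon F\big(\varepsilon^n\nabla^n v_\varepsilon(x),\ldots,\varepsilon\nabla v_\varepsilon(x),v_\varepsilon(x)\big)\,dx\ \ge\ K^*(v),$$ where $$K^*(v):=\int_{\Omega\cap J_v}E_{abst}\big(v^+(x),v^-(x),\vec\nu_v(x)\big)\,d\mathcal{H}^{N-1}(x)$$ and $E_{abst}$ is taken with respect to the $L^p$ topology.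
   Context: For an open set $U\subset\mathbb{R}^N$, $\mathcal{B}(U)$ denotes the set of all $v\in L^1_{loc}(U,X)$ of the form $v=(\nabla u,h,\psi)$ with $u\in W^{1,1}_{loc}(U,\mathbb{R}^k)$, $h\in L^1_{loc}(U,\mathbb{R}^{d\times N})$ with $\mathrm{div}\,h\equiv0$ (row-wise, in the sense of distributions), and $\psi\in L^1_{loc}(U,\mathbb{R}^m)$. For $v\in BV$, $J_v$ is the (approximate) jump set of $v$, $\vec\nu_v(x)\in S^{N-1}$ is the jump vector (normal) at $x\in J_v$, and $v^+(x),v^-(x)$ are the one-sided approximate limits of $v$ at $x$, on the sides $(y-x)\cdot\vec\nu_v(x)>0$ and $(y-x)\cdot\vec\nu_v(x)<0$ respectively. For $\vec\nu\in S^{N-1}$ let $Q(\vec\nu):=\{y\in\mathbb{R}^N:\ -1/2<y\cdot\vec\nu_j<1/2\ \ \forall j=1,\ldots,N\}$, where $\{\vec\nu_1,\ldots,\vec\nu_N\}$ is an orthonormal basis of $\mathbb{R}^N$ with $\vec\nu_1=\vec\nu$. For $v^+,v^-\in X$ let $\eta(v^+,v^-,\vec\nu)(y):=v^+$ if $\vec\nu\cdot y>0$ and $:=v^-$ if $\vec\nu\cdot y<0$. Then $E_{abst}(v^+,v^-,\vec\nu)$ is the $\Gamma$-$\liminf$ in $L^p$ of the functionals $\int_{Q(\vec\nu)}\frac1\varepsilon F(\varepsilon^n\nabla^n\zeta,\ldots,\varepsilon\nabla\zeta,\zeta)\,dy$, evaluated at $\eta(v^+,v^-,\vec\nu)$,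 i.e. $$E_{abst}(v^+,v^-,\vec\nu):=\inf\Big\{\liminf_{\varepsilon\to0^+}\int_{Q(\vec\nu)}\frac1\varepsilon F\big(\varepsilon^n\nabla^n\zeta_\varepsilon,\ldots,\varepsilon\nabla\zeta_\varepsilon,\zeta_\varepsilon\big)dy\Big\},$$ the infimum being over all families $\{\zeta_\varepsilon\}_{\varepsilon>0}\subset\mathcal{B}(Q(\vec\nu))\cap W^{n,1}_{loc}(Q(\vec\nu),X)$ with $\zeta_\varepsilon\to\eta(v^+,v^-,\vec\nu)$ in $L^p(Q(\vec\nu),X)$ as $\varepsilon\to0^+$. *)

theory Defs
  imports "HOL-Analysis.Analysis"
begin

section \<open>Test functions and weak derivatives\<close>

text \<open>Iterated partial derivatives; a multi-index of order \<open>j\<close> is a list of \<open>j\<close> coordinate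
  directions, so that the components of \<open>\<nabla>\<^sup>j\<close> are indexed by the lists of length \<open>j\<close>.\<close>

fun pderivs :: "'N list \<Rightarrow> (real^'N \<Rightarrow> 'b::real_normed_vector) \<Rightarrow> real^'N \<Rightarrow> 'b" where
  "pderivs [] f = f"
| "pderivs (i # I) f = (\<lambda>x. frechet_derivative (pderivs I f) (at x) (axis i 1))"

definition smooth :: "(real^'N \<Rightarrow> 'b::real_normed_vector) \<Rightarrow> bool" where
  "smooth f \<longleftrightarrow> (\<forall>I x. pderivs I f differentiable (at x))"

definition test_function :: "(real^'N) set \<Rightarrow> (real^'N \<Rightarrow> 'b::real_normed_vector) \<Rightarrow> bool" where
  "test_function U \<phi> \<longleftrightarrow> smooth \<phi> \<and> compact (closure {x. \<phi> x \<noteq> 0}) \<and> closure {x. \<phi> x \<noteq> 0} \<subseteq> U"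

definition L1loc :: "(real^'N) set \<Rightarrow> (real^'N \<Rightarrow> 'b::euclidean_space) \<Rightarrow> bool" where
  "L1loc U w \<longleftrightarrow> (\<forall>K. compact K \<and> K \<subseteq> U \<longrightarrow> set_integrable lebesgue K w)"

definition has_weak_partial ::
  "(real^'N) set \<Rightarrow> 'N list \<Rightarrow> (real^'N \<Rightarrow> 'b::euclidean_space) \<Rightarrow> (real^'N \<Rightarrow> 'b) \<Rightarrow> bool" where
  "has_weak_partial U I w g \<longleftrightarrow> L1loc U w \<and> L1loc U g \<and>
     (\<forall>\<phi> :: real^'N \<Rightarrow> real. test_function U \<phi> \<longrightarrow>
        (LINT x:U|lebesgue. pderivs I \<phi> x *\<^sub>R w x)
          = (-1) ^ length I *\<^sub>R (LINT x:U|lebesgue. \<phi> x *\<^sub>R g x))"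

text \<open>Weak derivatives are unique only up to null sets; \<open>weak_partial\<close> picks a representative.\<close>

definition weak_partial ::
  "(real^'N) set \<Rightarrow> 'N list \<Rightarrow> (real^'N \<Rightarrow> 'b::euclidean_space) \<Rightarrow> real^'N \<Rightarrow> 'b" where
  "weak_partial U I w = (SOME g. has_weak_partial U I w g)"

definition W1loc :: "nat \<Rightarrow> (real^'N) set \<Rightarrow> (real^'N \<Rightarrow> 'b::euclidean_space) \<Rightarrow> bool" where
  "W1loc n U w \<longleftrightarrow> L1loc U w \<and> (\<forall>I. length I \<le> n \<longrightarrow> (\<exists>g. has_weak_partial U I w g))"


section \<open>The function classes\<close>

type_synonym ('N, 'k, 'd, 'm) state =
  "((real, 'N) vec, 'k) vec \<times> ((real, 'N) vec, 'd) vec \<times> (real, 'm) vec"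

definition is_weak_gradient ::
  "(real^'N) set \<Rightarrow> (real^'N \<Rightarrow> real^'k) \<Rightarrow> (real^'N \<Rightarrow> real^'N^'k) \<Rightarrow> bool" where
  "is_weak_gradient U u G \<longleftrightarrow> (\<forall>j. has_weak_partial U [j] u (\<lambda>x. column j (G x)))"

definition div_free :: "(real^'N) set \<Rightarrow> (real^'N \<Rightarrow> real^'N^'d) \<Rightarrow> bool" where
  "div_free U h \<longleftrightarrow> (\<forall>\<phi> :: real^'N \<Rightarrow> real. test_function U \<phi> \<longrightarrow>
     (\<forall>i. (LINT x:U|lebesgue. (\<Sum>j\<in>UNIV. h x $ i $ j * pderivs [j] \<phi> x)) = 0))"

definition class_B ::
  "(real^'N) set \<Rightarrow> (real^'N \<Rightarrow> ('N::finite, 'k::finite, 'd::finite, 'm::finite) state) \<Rightarrow> bool" where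
  "class_B U v \<longleftrightarrow> L1loc U v \<and>
     (\<exists>u G h \<psi>. W1loc 1 U u \<and> is_weak_gradient U u G \<and>
                L1loc U h \<and> div_free U h \<and> L1loc U \<psi> \<and>
                (\<forall>x\<in>U. v x = (G x, h x, \<psi> x)))"

text \<open>\<open>BV(U)\<close>: integrable functions whose total variation
  \<open>sup {\<integral>\<^sub>U v \<cdot> div \<Phi> | \<Phi> \<in> C\<^sub>c\<^sup>\<infinity>(U), \<bar>\<Phi>\<bar> \<le> 1}\<close> is finite; the \<open>j\<close>-th column of \<open>\<Phi>\<close> is
  \<open>\<Phi> x $ j\<close>, and \<open>div\<close> sums the \<open>j\<close>-th partial derivatives of the columns.\<close>

definition BV :: "(real^'N) set \<Rightarrow> (real^'N \<Rightarrow> 'b::euclidean_space) \<Rightarrow> bool" where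
  "BV U v \<longleftrightarrow> set_integrable lebesgue U v \<and>
     (\<exists>C. \<forall>\<Phi> :: real^'N \<Rightarrow> 'b^'N. test_function U \<Phi> \<and> (\<forall>x. norm (\<Phi> x) \<le> 1) \<longrightarrow>
        (LINT x:U|lebesgue. v x \<bullet> (\<Sum>j\<in>UNIV. pderivs [j] \<Phi> x $ j)) \<le> C)"

definition Linfty :: "(real^'N) set \<Rightarrow> (real^'N \<Rightarrow> 'b::euclidean_space) \<Rightarrow> bool" where
  "Linfty U v \<longleftrightarrow> v \<in> borel_measurable (lebesgue_on U) \<and>
     (\<exists>C. AE x in lebesgue_on U. norm (v x) \<le> C)"

text \<open>\<open>w \<epsilon> \<rightarrow> v\<close> in \<open>L\<^sup>p(U)\<close> as \<open>\<epsilon> \<rightarrow> 0\<^sup>+\<close>; if \<open>v\<close> is in \<open>L\<^sup>p(U)\<close>,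
  this makes \<open>w \<epsilon>\<close> an element of \<open>L\<^sup>p(U)\<close> for all small \<open>\<epsilon>\<close>, but not for large ones.\<close>

definition Lp_tendsto ::
  "real \<Rightarrow> (real^'N) set \<Rightarrow> (real \<Rightarrow> real^'N \<Rightarrow> 'b::euclidean_space) \<Rightarrow> (real^'N \<Rightarrow> 'b) \<Rightarrow> bool" where
  "Lp_tendsto p U w v \<longleftrightarrow>
     ((\<lambda>\<epsilon>. \<integral>\<^sup>+x\<in>U. ennreal (norm (w \<epsilon> x - v x) powr p) \<partial>lebesgue) \<longlongrightarrow> 0) (at_right 0)"


section \<open>Approximate jump points\<close>

definition half_ball :: "'a::euclidean_space \<Rightarrow> 'a \<Rightarrow> real \<Rightarrow> 'a set" where
  "half_ball x \<nu> r = {y \<in> ball x r. (y - x) \<bullet> \<nu> > 0}"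

definition one_sided_approx_limit ::
  "(real^'N \<Rightarrow> 'b::euclidean_space) \<Rightarrow> real^'N \<Rightarrow> real^'N \<Rightarrow> 'b \<Rightarrow> bool" where
  "one_sided_approx_limit v x \<nu> a \<longleftrightarrow>
     ((\<lambda>r. (\<integral>\<^sup>+y\<in>half_ball x \<nu> r. ennreal (norm (v y - a)) \<partial>lebesgue)
             / emeasure lebesgue (half_ball x \<nu> r)) \<longlongrightarrow> 0) (at_right 0)"

definition jump_triple ::
  "(real^'N \<Rightarrow> 'b::euclidean_space) \<Rightarrow> real^'N \<Rightarrow> 'b \<Rightarrow> 'b \<Rightarrow> real^'N \<Rightarrow> bool" where
  "jump_triple v x a b \<nu> \<longleftrightarrow> norm \<nu> = 1 \<and> a \<noteq> b \<and>
     one_sided_approx_limit v x \<nu> a \<and> one_sided_approx_limit v x (- \<nu>) b"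

definition jump_set :: "(real^'N) set \<Rightarrow> (real^'N \<Rightarrow> 'b::euclidean_space) \<Rightarrow> (real^'N) set" where
  "jump_set U v = {x \<in> U. \<exists>a b \<nu>. jump_triple v x a b \<nu>}"


section \<open>Hausdorff measure\<close>

text \<open>The case distinction makes the empty set weightless also for \<open>s = 0\<close>, where every
  nonempty set has weight one.\<close>

definition hausdorff_weight :: "nat \<Rightarrow> 'a::metric_space set \<Rightarrow> ennreal" where
  "hausdorff_weight s C =
     (if C = {} then 0 else ennreal (unit_ball_vol (real s) * (diameter C / 2) ^ s))"

text \<open>Covering sets are required to be bounded since \<open>diameter\<close> is meaningless otherwise.\<close>

definition hausdorff_pre :: "nat \<Rightarrow> real \<Rightarrow> 'a::metric_space set \<Rightarrow> ennreal" where
  "hausdorff_pre s \<delta> A =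
     (INF C\<in>{C :: nat \<Rightarrow> 'a set. A \<subseteq> (\<Union>i. C i) \<and> (\<forall>i. bounded (C i) \<and> diameter (C i) \<le> \<delta>)}.
        \<Sum>i. hausdorff_weight s (C i))"

definition hausdorff_outer :: "nat \<Rightarrow> 'a::metric_space set \<Rightarrow> ennreal" where
  "hausdorff_outer s A = (SUP \<delta>\<in>{0<..}. hausdorff_pre s \<delta> A)"

definition hausdorff_measure :: "nat \<Rightarrow> 'a::metric_space measure" where
  "hausdorff_measure s =
     measure_of UNIV (lambda_system UNIV UNIV (hausdorff_outer s)) (hausdorff_outer s)"

lemma hausdorff_pre_empty: "0 < \<delta> \<Longrightarrow> hausdorff_pre s \<delta> {} = 0"
  unfolding hausdorff_pre_def
  by (intro antisym INF_lower2[of "\<lambda>_. {}"]) (auto simp: hausdorff_weight_def)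

lemma hausdorff_pre_mono: "A \<subseteq> B \<Longrightarrow> hausdorff_pre s \<delta> A \<le> hausdorff_pre s \<delta> B"
  unfolding hausdorff_pre_def by (rule INF_superset_mono) auto

lemma hausdorff_pre_UN: "hausdorff_pre s \<delta> (\<Union>i. A i) \<le> (\<Sum>i. hausdorff_pre s \<delta> (A i))"
  for A :: "nat \<Rightarrow> 'a::metric_space set"
proof (rule ennreal_le_epsilon)
  fix e :: real assume e: "0 < e" "(\<Sum>n. hausdorff_pre s \<delta> (A n)) < top"
  then have less: "hausdorff_pre s \<delta> (A n) < hausdorff_pre s \<delta> (A n) + e * (1/2) ^ Suc n" for n
    by (auto simp add: less_top dest!: ennreal_suminf_lessD)
  have "\<exists>C :: nat \<Rightarrow> 'a set. A n \<subseteq> (\<Union>i. C i) \<and> (\<forall>i. bounded (C i) \<and> diameter (C i) \<le> \<delta>) \<and>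
      (\<Sum>i. hausdorff_weight s (C i)) \<le> hausdorff_pre s \<delta> (A n) + e * (1/2) ^ Suc n" for n
    using less[of n] unfolding hausdorff_pre_def[of s \<delta> "A n"] INF_less_iff
    by (auto intro: less_imp_le)
  then obtain B :: "nat \<Rightarrow> nat \<Rightarrow> 'a set" where
    B: "\<And>n. A n \<subseteq> (\<Union>i. B n i)" "\<And>n i. bounded (B n i)" "\<And>n i. diameter (B n i) \<le> \<delta>"
    and le: "\<And>n. (\<Sum>i. hausdorff_weight s (B n i)) \<le> hausdorff_pre s \<delta> (A n) + e * (1/2) ^ Suc n"
    by metis
  define C where "C = case_prod B \<circ> prod_decode"
  have "(\<Union>i. A i) \<subseteq> (\<Union>i. C i)"
    using B(1) by (auto simp add: C_def subset_eq) (metis prod.case prod_encode_inverse)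
  moreover have "bounded (C i)" "diameter (C i) \<le> \<delta>" for i
    using B by (auto simp: C_def split: prod.split)
  ultimately have "hausdorff_pre s \<delta> (\<Union>i. A i) \<le> (\<Sum>i. hausdorff_weight s (C i))"
    unfolding hausdorff_pre_def by (intro INF_lower) auto
  also have "\<dots> = (\<Sum>n. \<Sum>i. hausdorff_weight s (B n i))"
    unfolding C_def comp_def
    using suminf_ennreal_2dimen[of "\<lambda>n. \<Sum>i. hausdorff_weight s (B n i)"
        "\<lambda>x. hausdorff_weight s (case_prod B x)"] by simp
  also have "\<dots> \<le> (\<Sum>n. hausdorff_pre s \<delta> (A n) + e * (1/2) ^ Suc n)"
    by (intro suminf_le le summableI)
  also have "\<dots> = (\<Sum>n. hausdorff_pre s \<delta> (A n)) + (\<Sum>n. ennreal e * ennreal ((1/2) ^ Suc n))"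
    using e by (subst suminf_add[symmetric])
               (auto simp del: ennreal_suminf_cmult simp add: ennreal_mult[symmetric])
  also have "\<dots> = (\<Sum>n. hausdorff_pre s \<delta> (A n)) + e"
    unfolding ennreal_suminf_cmult
    by (subst suminf_ennreal_eq[OF zero_le_power power_half_series]) auto
  finally show "hausdorff_pre s \<delta> (\<Union>i. A i) \<le> (\<Sum>n. hausdorff_pre s \<delta> (A n)) + e" .
qed

lemma outer_measure_space_hausdorff:
  "outer_measure_space UNIV (hausdorff_outer s :: 'a::metric_space set \<Rightarrow> ennreal)"
  unfolding outer_measure_space_def
proof (intro conjI)
  show "positive UNIV (hausdorff_outer s :: 'a set \<Rightarrow> ennreal)"
    by (auto simp: positive_def hausdorff_outer_def hausdorff_pre_empty intro!: antisym SUP_least)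
  show "increasing UNIV (hausdorff_outer s :: 'a set \<Rightarrow> ennreal)"
    by (auto simp: increasing_def hausdorff_outer_def intro!: SUP_mono' hausdorff_pre_mono)
  show "countably_subadditive UNIV (hausdorff_outer s :: 'a set \<Rightarrow> ennreal)"
    unfolding countably_subadditive_def
  proof (intro allI impI)
    fix A :: "nat \<Rightarrow> 'a set"
    show "hausdorff_outer s (\<Union>i. A i) \<le> (\<Sum>i. hausdorff_outer s (A i))"
      unfolding hausdorff_outer_def[of s "\<Union>i. A i"]
    proof (rule SUP_least)
      fix \<delta> :: real assume "\<delta> \<in> {0<..}"
      then have "(\<Sum>i. hausdorff_pre s \<delta> (A i)) \<le> (\<Sum>i. hausdorff_outer s (A i))"
        by (intro suminf_le summableI) (auto simp: hausdorff_outer_def intro: SUP_upper)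
      then show "hausdorff_pre s \<delta> (\<Union>i. A i) \<le> (\<Sum>i. hausdorff_outer s (A i))"
        using hausdorff_pre_UN order_trans by blast
    qed
  qed
qed

lemma measure_space_hausdorff:
  "measure_space UNIV (lambda_system UNIV UNIV (hausdorff_outer s)) (hausdorff_outer s)"
  using sigma_algebra.caratheodory_lemma[OF sigma_algebra_Pow[of UNIV]]
    outer_measure_space_hausdorff by auto

lemma sets_hausdorff_measure:
  "sets (hausdorff_measure s) = lambda_system UNIV UNIV (hausdorff_outer s)"
  unfolding hausdorff_measure_def
  by (rule sigma_algebra.sets_measure_of_eq)
     (use measure_space_hausdorff in \<open>auto simp: measure_space_def\<close>)

lemma emeasure_hausdorff_measure:
  "A \<in> sets (hausdorff_measure s) \<Longrightarrow> emeasure (hausdorff_measure s) A = hausdorff_outer s A"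
  using measure_space_hausdorff[of s]
  by (intro emeasure_measure_of[OF hausdorff_measure_def])
     (auto simp: measure_space_def sets_hausdorff_measure)


section \<open>The energies\<close>

text \<open>The domain of \<open>F\<close>, a product of the component spaces of \<open>\<nabla>\<^sup>n, \<dots>, \<nabla>\<^sup>1, \<nabla>\<^sup>0\<close>, is rendered as the
  finite-dimensional space of \<open>X\<close>-valued functions of multi-indices that vanish at orders
  beyond \<open>n\<close>; the slot of the function value itself is the empty multi-index. The topology is
  that of pointwise convergence.\<close>

definition jets :: "nat \<Rightarrow> ('N list \<Rightarrow> 'b::zero) set" where
  "jets n = {z. \<forall>I. length I > n \<longrightarrow> z I = 0}"

definition constant_jet :: "'b::zero \<Rightarrow> 'N list \<Rightarrow> 'b" where
  "constant_jet a = (\<lambda>I. if I = [] then a else 0)"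

definition scaled_jet ::
  "nat \<Rightarrow> (real^'N) set \<Rightarrow> real \<Rightarrow> (real^'N \<Rightarrow> 'b::euclidean_space) \<Rightarrow> real^'N \<Rightarrow> 'N list \<Rightarrow> 'b" where
  "scaled_jet n U \<epsilon> w x = (\<lambda>I.
     if I = [] then w x
     else if length I \<le> n then \<epsilon> ^ length I *\<^sub>R weak_partial U I w x
     else 0)"

definition energy ::
  "nat \<Rightarrow> (('N list \<Rightarrow> 'b) \<Rightarrow> real) \<Rightarrow> (real^'N) set \<Rightarrow> real \<Rightarrow> (real^'N \<Rightarrow> 'b::euclidean_space) \<Rightarrow> ennreal" where
  "energy n F U \<epsilon> w = (\<integral>\<^sup>+x\<in>U. ennreal (1 / \<epsilon> * F (scaled_jet n U \<epsilon> w x)) \<partial>lebesgue)"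

definition orthonormal_basis_through :: "'a::euclidean_space \<Rightarrow> 'a set \<Rightarrow> bool" where
  "orthonormal_basis_through \<nu> S \<longleftrightarrow>
     \<nu> \<in> S \<and> pairwise orthogonal S \<and> (\<forall>b\<in>S. norm b = 1) \<and> span S = UNIV"

definition unit_cube :: "'a::euclidean_space set \<Rightarrow> 'a set" where
  "unit_cube S = {y. \<forall>b\<in>S. - 1/2 < y \<bullet> b \<and> y \<bullet> b < 1/2}"

text \<open>The value on the null set \<open>\<nu> \<bullet> y = 0\<close> is immaterial.\<close>

definition jump_profile :: "'b \<Rightarrow> 'b \<Rightarrow> 'a::euclidean_space \<Rightarrow> 'a \<Rightarrow> 'b" where
  "jump_profile a b \<nu> = (\<lambda>y. if \<nu> \<bullet> y > 0 then a else b)"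

text \<open>\<open>E_abst n F p S a b \<nu>\<close> is computed on the cube determined by the orthonormal basis \<open>S\<close>,
  which is meant to contain \<open>\<nu>\<close>; the infimum over the empty set is \<open>\<infinity>\<close>.\<close>

definition E_abst ::
  "nat \<Rightarrow> (('N list \<Rightarrow> ('N::finite, 'k::finite, 'd::finite, 'm::finite) state) \<Rightarrow> real) \<Rightarrow> real \<Rightarrow>
   (real^'N) set \<Rightarrow> ('N, 'k, 'd, 'm) state \<Rightarrow> ('N, 'k, 'd, 'm) state \<Rightarrow> real^'N \<Rightarrow> ennreal" where
  "E_abst n F p S a b \<nu> =
     (INF \<zeta>\<in>{\<zeta>. (\<forall>\<epsilon>>0. class_B (unit_cube S) (\<zeta> \<epsilon>) \<and> W1loc n (unit_cube S) (\<zeta> \<epsilon>)) \<and>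
                 Lp_tendsto p (unit_cube S) \<zeta> (jump_profile a b \<nu>)}.
        Liminf (at_right 0) (\<lambda>\<epsilon>. energy n F (unit_cube S) \<epsilon> (\<zeta> \<epsilon>)))"

text \<open>\<open>frame \<nu>\<close> is the orthonormal basis chosen for \<open>Q(\<nu>)\<close>, and \<open>vp x, vm x, nu x\<close> are
  the traces and the normal at a jump point \<open>x\<close>.\<close>

definition K_star ::
  "nat \<Rightarrow> (('N list \<Rightarrow> ('N::finite, 'k::finite, 'd::finite, 'm::finite) state) \<Rightarrow> real) \<Rightarrow> real \<Rightarrow>
   (real^'N \<Rightarrow> (real^'N) set) \<Rightarrow> (real^'N) set \<Rightarrow> (real^'N \<Rightarrow> ('N, 'k, 'd, 'm) state) \<Rightarrow>
   (real^'N \<Rightarrow> ('N, 'k, 'd, 'm) state) \<Rightarrow> (real^'N \<Rightarrow> ('N, 'k, 'd, 'm) state) \<Rightarrow>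
   (real^'N \<Rightarrow> real^'N) \<Rightarrow> ennreal" where
  "K_star n F p frame \<Omega> v vp vm nu =
     (\<integral>\<^sup>+x\<in>jump_set \<Omega> v. E_abst n F p (frame (nu x)) (vp x) (vm x) (nu x)
        \<partial>hausdorff_measure (CARD('N) - 1))"

end

theory Submission
  imports Defs
begin

text \<open>The proof is a blow-up argument followed by a covering argument. All the facts about the jump set
are derived directly from the definition of a jump point.

\<^bold>\<open>Blow-up.\<close> Let \<open>x\<close> be a jump point with normal \<open>\<nu>\<close>, let \<open>Q\<close> be the unit cube adapted to \<open>\<nu>\<close>, and
let \<open>c\<close> be less than the value of \<open>E_abst\<close> at \<open>x\<close>. For every small \<open>r\<close>, the energy of \<open>w \<epsilon>\<close> on the
cube \<open>x + r Q\<close> is at least \<open>c r\<^sup>N\<^sup>-\<^sup>1\<close> for all small \<open>\<epsilon>\<close> (\<open>eventually_energy_ge_E_abst\<close>).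
Otherwise there are \<open>r\<^sub>k \<rightarrow> 0\<close> and \<open>\<epsilon>\<^sub>k\<close> with \<open>\<epsilon>\<^sub>k / r\<^sub>k \<rightarrow> 0\<close> for which the functions
\<open>y \<mapsto> w \<epsilon>\<^sub>k (x + r\<^sub>k y)\<close> converge to the jump profile in \<open>L\<^sup>p(Q)\<close>, while their energies with
parameter \<open>\<epsilon>\<^sub>k / r\<^sub>k\<close> are at most \<open>c\<close>; they would compete in the infimum that defines \<open>E_abst\<close>.
Rescaling multiplies the weak derivative of order \<open>j\<close> by \<open>r\<^sup>j\<close>, so the argument of \<open>F\<close> does not
change when \<open>\<epsilon>\<close> is replaced by \<open>\<epsilon> / r\<close>, and the energy picks up at most the factor \<open>r\<^sup>1\<^sup>-\<^sup>N\<close>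
(\<open>energy_scaled_le\<close>). As \<open>weak_partial\<close> is an arbitrary representative, this presupposes that weak
derivatives are unique almost everywhere (\<open>weak_partial_unique\<close>).

\<^bold>\<open>Geometry of the jump set.\<close> For every \<open>\<delta> > 0\<close>, countably many compact sets \<open>P\<^sub>i\<close> cover the jump
set, and each \<open>P\<^sub>i\<close> has a direction \<open>\<theta>\<^sub>i\<close> such that \<open>\<bar>(y - x) \<bullet> \<theta>\<^sub>i\<bar> \<le> \<delta> \<bar>y - x\<bar>\<close> for
\<open>x, y \<in> P\<^sub>i\<close>, and the normals at the jump points in \<open>P\<^sub>i\<close> make an angle with \<open>\<plusminus>\<theta>\<^sub>i\<close> whose sine is
at most \<open>\<delta>\<close> (\<open>jump_set_covered_by_flat_compacts\<close>). The reason is that a function which is close in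
the mean to \<open>a\<close> on a part of the upper half-ball about \<open>x\<close> and close to \<open>b \<noteq> a\<close> on a part of the
lower half-ball about \<open>y\<close> forces these parts to be almost disjoint, and they overlap as soon as
\<open>y\<close> lies well above \<open>x\<close>.

\<^bold>\<open>Covering by cubes.\<close> Such a flat compact set \<open>K\<close> is a Lipschitz graph over its projection along
\<open>\<theta>\<^sub>i\<close>, and \<open>\<H>\<^sup>N\<^sup>-\<^sup>1(K)\<close> is at most the Lebesgue measure of the projection, up to a factor near one
(\<open>hausdorff_outer_le_measure_projection\<close>). The projection of a cube centred at a point of \<open>K\<close> and
adapted to the normal there has nearly the measure \<open>r\<^sup>N\<^sup>-\<^sup>1\<close> of a face (\<open>cube_shadow\<close>). The Vitali
covering theorem, for sets of bounded eccentricity as the cubes may be rotated arbitrarily about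
their normals, gives finitely many arbitrarily small cubes with disjoint projections for which
\<open>\<Sum> r\<^sup>N\<^sup>-\<^sup>1\<close> is at least almost \<open>\<H>\<^sup>N\<^sup>-\<^sup>1(K)\<close> (\<open>cubes_fill_flat_compact\<close>).

\<^bold>\<open>Conclusion.\<close> The integral over the jump set is the supremum of the integrals of simple functions
below the integrand. Their level sets, intersected with the disjointed sets \<open>P\<^sub>i\<close>, are
approximated from inside by compact sets, as Hausdorff measure is a metric outer measure whose
restriction to a set of finite measure is inner regular (\<open>hausdorff_inner_compact\<close>). Finitely many
disjoint compact sets have positive distance, so the cubes chosen for them are disjoint
altogether, and the local estimates add up (\<open>energy_ge_finite_sum\<close>).

The integrands \<open>F (scaled_jet \<dots>)\<close> and \<open>E_abst\<close> may fail to be measurable, and their integrals are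
suprema over simple functions. These lower integrals are monotone, superadditive over disjoint
sets, and transform by the right inequality under scaling; the proof asks no more of them.\<close>

section \<open>Smooth cut-off functions and uniqueness of weak derivatives\<close>

text \<open>The function \<open>exp (- 1/t)\<close>, extended by zero to \<open>t \<le> 0\<close>, is \<open>flat 0\<close>; the powers of \<open>1/t\<close> arise in
its derivatives, and the span of all \<open>flat k\<close> is closed under differentiation.\<close>

definition flat :: "nat \<Rightarrow> real \<Rightarrow> real" where
  "flat k t = (if 0 < t then (1 / t) ^ k * exp (- (1 / t)) else 0)"

lemma flat_nonneg: "0 \<le> flat k t"
  by (simp add: flat_def)

lemma flat_le_1: "flat 0 t \<le> 1"
  by (simp add: flat_def)

lemma flat_tendsto_0: "(flat k \<longlongrightarrow> 0) (at 0)"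
proof -
  have "((\<lambda>x::real. x ^ k / exp x) \<longlongrightarrow> 0) at_top"
    by (rule tendsto_power_div_exp_0)
  then have "((\<lambda>t. inverse t ^ k / exp (inverse t)) \<longlongrightarrow> (0::real)) (at_right 0)"
    by (rule filterlim_compose[OF _ filterlim_inverse_at_top_right])
  then have "(flat k \<longlongrightarrow> 0) (at_right 0)"
    by (rule Lim_transform_eventually)
       (auto simp: flat_def exp_minus field_simps eventually_at_right_less intro!: eventually_mono[OF eventually_at_right_less])
  moreover have "(flat k \<longlongrightarrow> 0) (at_left 0)"
    by (rule tendsto_eventually)
       (auto simp: flat_def eventually_at_left_field intro: exI[of _ "-1"])
  ultimately show ?thesis
    by (simp add: filterlim_at_split)
qed

lemma flat_has_derivative:
  "(flat k has_real_derivative (flat (k + 2) t - real k * flat (k + 1) t)) (at t)"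
proof -
  consider "t > 0" | "t < 0" | "t = 0" by linarith
  then show ?thesis
  proof cases
    case 1
    have "((\<lambda>t. (1 / t) ^ k * exp (- (1 / t))) has_real_derivative (flat (k + 2) t - real k * flat (k + 1) t)) (at t)"
      using 1
      apply (auto intro!: derivative_eq_intros simp: flat_def field_simps power2_eq_square)
      apply (cases k; simp add: field_simps)
      done
    then show ?thesis
      by (rule has_field_derivative_transform_within_open[where S="{0<..}"]) (use 1 in \<open>auto simp: flat_def\<close>)
  next
    case 2
    have "((\<lambda>t. 0) has_real_derivative (flat (k + 2) t - real k * flat (k + 1) t)) (at t)"
      using 2 by (auto simp: flat_def)
    then show ?thesis
      by (rule has_field_derivative_transform_within_open[where S="{..<0}"]) (use 2 in \<open>auto simp: flat_def\<close>)
  next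
    case 3
    \<comment> \<open>the difference quotient at \<open>0\<close> belongs to the same family, and so tends to \<open>0\<close>\<close>
    have "flat k (0 + h) / h = flat (Suc k) h" for h
      by (auto simp: flat_def field_simps)
    then have "((\<lambda>h. (flat k (0 + h) - flat k 0) / h) \<longlongrightarrow> 0) (at 0)"
      using flat_tendsto_0[of "Suc k"] by (simp add: flat_def[of _ 0])
    then show ?thesis
      using 3 by (simp add: DERIV_def flat_def[of _ 0])
  qed
qed

text \<open>An algebra of functions that contains the cut-offs and is closed under partial derivatives, which
makes smoothness a matter of induction on the multi-index, without formulas for the derivatives.\<close>

inductive_set bumps :: "(real^'N \<Rightarrow> real) set" where
  base: "(\<lambda>x. flat k (s * x $ i - c)) \<in> bumps"
| add: "f \<in> bumps \<Longrightarrow> g \<in> bumps \<Longrightarrow> (\<lambda>x. f x + g x) \<in> bumps"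
| mult: "f \<in> bumps \<Longrightarrow> g \<in> bumps \<Longrightarrow> (\<lambda>x. f x * g x) \<in> bumps"
| cmult: "f \<in> bumps \<Longrightarrow> (\<lambda>x. c * f x) \<in> bumps"

lemma bumps_derivative:
  fixes f :: "real^'N \<Rightarrow> real"
  assumes "f \<in> bumps"
  shows "(\<forall>x. f differentiable (at x)) \<and> (\<forall>i. (\<lambda>x. frechet_derivative f (at x) (axis i 1)) \<in> bumps)"
  using assms
proof induction
  case (base k s j c)
  let ?f = "\<lambda>x::real^'N. flat k (s * x $ j - c)"
  let ?d = "\<lambda>x::real^'N. flat (k + 2) (s * x $ j - c) - real k * flat (k + 1) (s * x $ j - c)"
  have d: "(?f has_derivative (\<lambda>h. ?d x * (s * h $ j))) (at x)" for x
  proof -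
    have "((\<lambda>x::real^'N. s * x $ j - c) has_derivative (\<lambda>h. s * h $ j)) (at x)"
      by (auto intro!: derivative_eq_intros bounded_linear.has_derivative[OF bounded_linear_vec_nth])
    from DERIV_compose_FDERIV[OF flat_has_derivative this] show ?thesis
      by (simp add: algebra_simps)
  qed
  have "(\<lambda>x. frechet_derivative ?f (at x) (axis i 1)) \<in> bumps" for i
  proof -
    have "(\<lambda>x. frechet_derivative ?f (at x) (axis i 1)) =
      (\<lambda>x. (if j = i then s else 0) * (flat (k + 2) (s * x $ j - c) + (- real k) * flat (k + 1) (s * x $ j - c)))"
      by (auto simp: frechet_derivative_at[OF d, symmetric] axis_def)
    also have "\<dots> \<in> bumps"
      by (intro bumps.intros)
    finally show ?thesis .
  qed
  then show ?case using d unfolding differentiable_def by blast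
next
  case (add f g)
  then have "(\<lambda>x. frechet_derivative (\<lambda>x. f x + g x) (at x) (axis i 1)) =
     (\<lambda>x. frechet_derivative f (at x) (axis i 1) + frechet_derivative g (at x) (axis i 1))" for i
    by (intro ext frechet_derivative_at[OF has_derivative_add, symmetric, THEN fun_cong])
       (auto simp: frechet_derivative_works[symmetric])
  with add show ?case by (auto intro!: bumps.intros)
next
  case (mult f g)
  have "(\<lambda>x. frechet_derivative (\<lambda>x. f x * g x) (at x) (axis i 1)) =
     (\<lambda>x. f x * frechet_derivative g (at x) (axis i 1) + frechet_derivative f (at x) (axis i 1) * g x)" for i
  proof
    fix x
    have "((\<lambda>x. f x * g x) has_derivative
        (\<lambda>h. f x * frechet_derivative g (at x) h + frechet_derivative f (at x) h * g x)) (at x)"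
      using mult by (intro has_derivative_mult) (auto simp: frechet_derivative_works[symmetric])
    from frechet_derivative_at[OF this]
    show "frechet_derivative (\<lambda>x. f x * g x) (at x) (axis i 1) = f x * frechet_derivative g (at x) (axis i 1) + frechet_derivative f (at x) (axis i 1) * g x"
      by metis
  qed
  with mult show ?case by (auto intro!: bumps.intros)
next
  case (cmult f c)
  have "(\<lambda>x. frechet_derivative (\<lambda>x. c * f x) (at x) (axis i 1)) =
     (\<lambda>x. c * frechet_derivative f (at x) (axis i 1))" for i
  proof
    fix x
    have "((\<lambda>x. c * f x) has_derivative (\<lambda>h. c * frechet_derivative f (at x) h)) (at x)"
      using cmult by (intro has_derivative_mult_right) (auto simp: frechet_derivative_works[symmetric])
    from frechet_derivative_at[OF this]
    show "frechet_derivative (\<lambda>x. c * f x) (at x) (axis i 1) = c * frechet_derivative f (at x) (axis i 1)"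
      by metis
  qed
  with cmult show ?case by (auto intro!: bumps.intros)
qed

lemma smooth_bumps:
  fixes f :: "real^'N \<Rightarrow> real"
  assumes "f \<in> bumps"
  shows "smooth f"
proof -
  have "pderivs I f \<in> bumps" for I
    by (induction I) (use assms bumps_derivative in auto)
  then show ?thesis
    using bumps_derivative unfolding smooth_def by blast
qed

lemma bumps_prod:
  assumes "finite I" "I \<noteq> {}" "\<And>i. i \<in> I \<Longrightarrow> f i \<in> bumps"
  shows "(\<lambda>x. \<Prod>i\<in>I. f i x) \<in> bumps"
  using assms by (induction I rule: finite_ne_induct) (auto intro: bumps.mult)

text \<open>For \<open>k \<rightarrow> \<infinity>\<close> this increases to the indicator of the open box.\<close>

definition box_cutoff :: "real^'N \<Rightarrow> real^'N \<Rightarrow> nat \<Rightarrow> real^'N \<Rightarrow> real" where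
  "box_cutoff a b k x =
     (\<Prod>i\<in>UNIV. flat 0 (real k * x $ i - real k * a $ i) * flat 0 (- real k * x $ i - (- real k * b $ i)))"

lemma box_cutoff_bounds: "0 \<le> box_cutoff a b k x" "box_cutoff a b k x \<le> 1"
  unfolding box_cutoff_def
  by (auto intro!: prod_nonneg prod_le_1 mult_le_one mult_nonneg_nonneg flat_nonneg flat_le_1)

lemma box_cutoff_outside:
  assumes "x \<notin> box a b" shows "box_cutoff a b k x = 0"
proof -
  obtain i where "x $ i \<le> a $ i \<or> b $ i \<le> x $ i"
    using assms by (auto simp: mem_box_cart not_less)
  then have "real k * x $ i \<le> real k * a $ i \<or> real k * b $ i \<le> real k * x $ i"
    by (auto intro: mult_left_mono)
  then have "flat 0 (real k * x $ i - real k * a $ i) * flat 0 (- real k * x $ i - (- real k * b $ i)) = 0"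
    by (auto simp: flat_def)
  then show ?thesis
    unfolding box_cutoff_def by (intro prod_zero) auto
qed

lemma box_cutoff_tendsto: "(\<lambda>k. box_cutoff a b k x) \<longlonglongrightarrow> indicat_real (box a b) x"
proof (cases "x \<in> box a b")
  case False
  then show ?thesis by (simp add: box_cutoff_outside)
next
  case True
  have f: "(\<lambda>k. flat 0 (real k * t)) \<longlonglongrightarrow> 1" if "t > 0" for t :: real
  proof -
    have "(\<lambda>k. exp (- (1 / (real k * t)))) \<longlonglongrightarrow> exp (- 0)"
      using that by (intro tendsto_intros real_tendsto_divide_at_top[OF tendsto_const]
          filterlim_at_top_mult_tendsto_pos[OF tendsto_const _ filterlim_real_sequentially, THEN filterlim_cong[THEN iffD1, rotated -1]])
          (auto simp: mult.commute)
    moreover have "eventually (\<lambda>k. exp (- (1 / (real k * t))) = flat 0 (real k * t)) sequentially"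
      using eventually_gt_at_top[of 0] by eventually_elim (use that in \<open>auto simp: flat_def\<close>)
    ultimately show ?thesis by (auto intro: Lim_transform_eventually)
  qed
  have "(\<lambda>k. box_cutoff a b k x) \<longlonglongrightarrow> (\<Prod>i\<in>(UNIV::'a set). 1 * 1)"
    unfolding box_cutoff_def
  proof (intro tendsto_prod tendsto_mult)
    fix i
    show "(\<lambda>k. flat 0 (real k * x $ i - real k * a $ i)) \<longlonglongrightarrow> 1"
      using f[of "x $ i - a $ i"] True by (simp add: mem_box_cart right_diff_distrib)
    show "(\<lambda>k. flat 0 (- real k * x $ i - - real k * b $ i)) \<longlonglongrightarrow> 1"
      using f[of "b $ i - x $ i"] True by (simp add: mem_box_cart right_diff_distrib)
  qed
  then show ?thesis using True by simp
qed

lemma test_function_box_cutoff: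
  assumes "cbox a b \<subseteq> U"
  shows "test_function U (box_cutoff a b k)"
proof -
  have "box_cutoff a b k \<in> bumps"
    unfolding box_cutoff_def[abs_def] by (intro bumps_prod bumps.mult bumps.base) auto
  moreover have "closure {x. box_cutoff a b k x \<noteq> 0} \<subseteq> cbox a b"
    using box_cutoff_outside[of _ a b k] box_subset_cbox[of a b] by (intro closure_minimal closed_cbox) blast
  ultimately show ?thesis
    using assms unfolding test_function_def
    by (auto simp: smooth_bumps compact_eq_bounded_closed intro: bounded_subset[OF bounded_cbox])
qed

lemma sigma_finite_lebesgue: "sigma_finite_measure (lebesgue :: 'a::euclidean_space measure)"
proof -
  obtain A :: "'a set set" where "countable A" "A \<subseteq> sets lborel" "\<Union>A = space lborel"
      "\<forall>a\<in>A. emeasure lborel a \<noteq> \<infinity>"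
    using sigma_finite_measure.sigma_finite_countable[OF sigma_finite_lborel] by auto
  then show ?thesis
    by (intro sigma_finite_measure.intro exI[of _ A]) (auto simp: emeasure_completion main_part_sets)
qed

text \<open>By dominated convergence along the cut-offs, the integral of \<open>g\<close> over every box inside \<open>U\<close>
vanishes. The boxes form an intersection-stable generator of the Borel sets, so the same holds for
the integrals of \<open>g\<close> over all measurable subsets of a fixed box, and \<open>g\<close> vanishes almost
everywhere there.\<close>

lemma null_on_box_if_test_integrals_vanish:
  fixes g :: "real^'N \<Rightarrow> 'b::euclidean_space"
  assumes g: "L1loc U g" and ab: "cbox a b \<subseteq> U" and U: "U \<in> sets lebesgue"
    and test: "\<And>\<phi>::real^'N \<Rightarrow> real. test_function U \<phi> \<Longrightarrow> (LINT x:U|lebesgue. \<phi> x *\<^sub>R g x) = 0"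
  shows "AE x in lebesgue. x \<in> box a b \<longrightarrow> g x = 0"
proof -
  define f where "f = (\<lambda>x. indicat_real (box a b) x *\<^sub>R g x)"
  have int: "integrable lebesgue (\<lambda>x. indicat_real (cbox c d) x *\<^sub>R g x)" if "cbox c d \<subseteq> U" for c d
    using g that compact_cbox[of c d] unfolding L1loc_def set_integrable_def by simp
  have intb: "integrable lebesgue (\<lambda>x. indicat_real (box a b) x *\<^sub>R g x)"
    using set_integrable_subset[of lebesgue "cbox a b" g "box a b"] int[OF ab] box_subset_cbox[of a b]
    by (simp add: set_integrable_def)
  have f: "integrable lebesgue f" using intb by (simp add: f_def)
  have box0: "integral\<^sup>L lebesgue (\<lambda>x. indicat_real (box c d) x *\<^sub>R g x) = 0" if cd: "cbox c d \<subseteq> U" for c d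
  proof -
    have "(\<lambda>k. LINT x|lebesgue. box_cutoff c d k x *\<^sub>R (indicat_real (cbox c d) x *\<^sub>R g x))
       \<longlonglongrightarrow> (LINT x|lebesgue. indicat_real (box c d) x *\<^sub>R (indicat_real (cbox c d) x *\<^sub>R g x))"
    proof (rule integral_dominated_convergence[where w="\<lambda>x. norm (indicat_real (cbox c d) x *\<^sub>R g x)"])
      have "box_cutoff c d k \<in> borel_measurable borel" for k
      proof -
        have "smooth (box_cutoff c d k)"
          using test_function_box_cutoff[OF cd] by (simp add: test_function_def)
        then have "continuous_on UNIV (box_cutoff c d k)"
          unfolding smooth_def using spec[of _ "[]"]
          by (metis continuous_at_imp_continuous_on differentiable_imp_continuous_within pderivs.simps(1))
        then show ?thesis by (rule borel_measurable_continuous_onI)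
      qed
      then have m: "box_cutoff c d k \<in> borel_measurable lebesgue" for k
        by (intro measurable_completion) simp
      show "(\<lambda>x. box_cutoff c d k x *\<^sub>R (indicat_real (cbox c d) x *\<^sub>R g x)) \<in> borel_measurable lebesgue" for k
        by (rule borel_measurable_scaleR[OF m borel_measurable_integrable[OF int[OF cd]]])
      show "(\<lambda>x. indicat_real (box c d) x *\<^sub>R (indicat_real (cbox c d) x *\<^sub>R g x)) \<in> borel_measurable lebesgue"
        by (rule borel_measurable_scaleR[OF _ borel_measurable_integrable[OF int[OF cd]]])
           (simp add: borel_measurable_indicator)
      show "integrable lebesgue (\<lambda>x. norm (indicat_real (cbox c d) x *\<^sub>R g x))"
        using int[OF cd] by (rule integrable_norm)
      show "AE x in lebesgue. (\<lambda>k. box_cutoff c d k x *\<^sub>R indicat_real (cbox c d) x *\<^sub>R g x)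
         \<longlonglongrightarrow> indicat_real (box c d) x *\<^sub>R indicat_real (cbox c d) x *\<^sub>R g x"
        by (intro AE_I2 tendsto_scaleR box_cutoff_tendsto tendsto_const)
      show "AE x in lebesgue. norm (box_cutoff c d k x *\<^sub>R indicat_real (cbox c d) x *\<^sub>R g x)
         \<le> norm (indicat_real (cbox c d) x *\<^sub>R g x)" for k
        using box_cutoff_bounds[of c d k] by (intro AE_I2) (auto simp: abs_mult intro: mult_left_le_one_le split: split_indicator)
    qed
    moreover have "(LINT x|lebesgue. box_cutoff c d k x *\<^sub>R (indicat_real (cbox c d) x *\<^sub>R g x)) = 0" for k
    proof -
      have "box_cutoff c d k x *\<^sub>R (indicat_real (cbox c d) x *\<^sub>R g x) = indicat_real U x *\<^sub>R (box_cutoff c d k x *\<^sub>R g x)" for x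
        using box_cutoff_outside[of x c d k] box_subset_cbox[of c d] cd
        by (cases "x \<in> box c d") (auto simp: indicator_def)
      then show ?thesis
        using test[OF test_function_box_cutoff[OF cd]] unfolding set_lebesgue_integral_def
        by (simp only:)
    qed
    moreover have "indicat_real (box c d) x *\<^sub>R (indicat_real (cbox c d) x *\<^sub>R g x) = indicat_real (box c d) x *\<^sub>R g x" for x
      using box_subset_cbox[of c d] by (auto simp: indicator_def)
    ultimately have "(\<lambda>k::nat. 0) \<longlonglongrightarrow> (LINT x|lebesgue. indicat_real (box c d) x *\<^sub>R g x)"
      by (simp only:)
    from LIMSEQ_unique[OF tendsto_const this] show ?thesis by simp
  qed
  have total: "integral\<^sup>L lebesgue f = 0"
    using box0[OF ab] by (simp add: f_def)
  have sig: "sigma_sets UNIV (range (\<lambda>(a, b). box a b :: (real^'N) set)) = sets borel"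
    by (subst borel_eq_box) simp
  have borel0: "(LINT x:A|lebesgue. f x) = 0" if "A \<in> sets borel" for A
  proof -
    have "Int_stable (range (\<lambda>(a, b). box a b :: (real^'N) set))"
      by (auto simp: Int_stable_def Int_interval_mixed_eq_empty box_Int_box)
    moreover have "range (\<lambda>(a, b). box a b :: (real^'N) set) \<subseteq> Pow UNIV" by simp
    moreover have "A \<in> sigma_sets UNIV (range (\<lambda>(a, b). box a b))"
      using that sig by simp
    ultimately show ?thesis
    proof (induction rule: sigma_sets_induct_disjoint)
      fix A :: "(real^'N) set" assume "A \<in> range (\<lambda>(a, b). box a b)"
      then obtain c d where A: "A = box c d" by auto
      obtain p q where pq: "box a b \<inter> box c d = box p q" using box_Int_box[of a b c d] by blast
      show "(LINT x:A|lebesgue. f x) = 0"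
      proof (cases "box p q = {}")
        case True
        then have "(\<lambda>x. indicat_real A x *\<^sub>R f x) = (\<lambda>x. 0)"
          using pq A by (force simp: f_def indicator_def)
        then show ?thesis unfolding set_lebesgue_integral_def by (simp only: Bochner_Integration.integral_zero)
      next
        case False
        have "cbox p q = closure (box p q)" using False by (rule closure_box[symmetric])
        also have "\<dots> \<subseteq> closure (box a b)" using pq by (intro closure_mono) auto
        also have "\<dots> \<subseteq> cbox a b" by (meson box_subset_cbox closed_cbox closure_minimal)
        finally have "cbox p q \<subseteq> U" using ab by auto
        from box0[OF this] show ?thesis
          using pq A by (simp add: set_lebesgue_integral_def f_def indicator_inter_arith[symmetric] Int_commute)
      qed
    next
      show "(LINT x:{}|lebesgue. f x) = 0" by (simp add: set_lebesgue_integral_def)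
    next
      fix A :: "(real^'N) set" assume A: "A \<in> sigma_sets UNIV (range (\<lambda>(a, b). box a b))" "(LINT x:A|lebesgue. f x) = 0"
      have "A \<in> sets lebesgue" using A(1) unfolding sig by simp
      then have "(LINT x:UNIV - A|lebesgue. f x) = integral\<^sup>L lebesgue f - (LINT x:A|lebesgue. f x)"
        unfolding set_lebesgue_integral_def
        by (subst Bochner_Integration.integral_diff[symmetric, OF f integrable_mult_indicator[OF _ f]])
           (auto intro!: Bochner_Integration.integral_cong simp: indicator_def)
      then show "(LINT x:UNIV - A|lebesgue. f x) = 0" using total A(2) by simp
    next
      fix A :: "nat \<Rightarrow> (real^'N) set"
      assume A: "disjoint_family A" "range A \<subseteq> sigma_sets UNIV (range (\<lambda>(a, b). box a b))" "\<And>i. (LINT x:A i|lebesgue. f x) = 0"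
      have m: "A i \<in> sets lebesgue" for i
        using A(2) unfolding sig by auto
      have "set_integrable lebesgue (\<Union>i. A i) f"
        unfolding set_integrable_def using m f by (intro integrable_mult_indicator) auto
      then have "(LINT x:(\<Union>i. A i)|lebesgue. f x) = (\<Sum>i. LINT x:A i|lebesgue. f x)"
        using A(1) m by (intro lebesgue_integral_countable_add) (auto simp: disjoint_family_on_def)
      then show "(LINT x:(\<Union>i. A i)|lebesgue. f x) = 0" using A(3) by simp
    qed
  qed
  have all0: "(LINT x:A|lebesgue. f x) = 0" if A: "A \<in> sets lebesgue" for A
  proof -
    obtain S N N' where "A = S \<union> N" "N \<subseteq> N'" "N' \<in> null_sets lborel" "S \<in> sets borel"
      by (rule sets_completionE[OF A]) auto
    then have "AE x in lebesgue. x \<in> A \<longleftrightarrow> x \<in> S"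
      by (intro AE_I'[of N']) (auto intro: null_sets_completionI)
    then have "(LINT x:A|lebesgue. f x) = (LINT x:S|lebesgue. f x)"
      unfolding set_lebesgue_integral_def
      using integrable_mult_indicator[OF that f] integrable_mult_indicator[OF _ f, of S] \<open>S \<in> sets borel\<close>
      by (intro integral_cong_AE) (auto simp: indicator_def[abs_def] elim!: AE_mp)
    with borel0[OF \<open>S \<in> sets borel\<close>] show ?thesis by simp
  qed
  have "AE x in lebesgue. f x = 0"
    using f all0 sigma_finite_lebesgue by (intro sigma_finite_measure.density_zero) auto
  then show ?thesis
    by eventually_elim (auto simp: f_def)
qed

lemma AE_zero_if_test_integrals_vanish:
  fixes g :: "real^'N \<Rightarrow> 'b::euclidean_space"
  assumes g: "L1loc U g" and U: "open U"
    and test: "\<And>\<phi>::real^'N \<Rightarrow> real. test_function U \<phi> \<Longrightarrow> (LINT x:U|lebesgue. \<phi> x *\<^sub>R g x) = 0"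
  shows "AE x in lebesgue. x \<in> U \<longrightarrow> g x = 0"
proof -
  obtain D where D: "countable D" "D \<subseteq> Pow U" "\<And>X. X \<in> D \<Longrightarrow> \<exists>a b. X = box a b \<and> cbox a b \<subseteq> U" "\<Union>D = U"
  proof -
    let ?F = "{box a b | a b. cbox a b \<subseteq> U}"
    obtain D where D: "D \<subseteq> ?F" "countable D" "\<Union>D = \<Union>?F"
      using Lindelof[of ?F] open_box by (smt (verit, best) mem_Collect_eq)
    have "\<Union>?F = U"
    proof
      show "\<Union>?F \<subseteq> U" using box_subset_cbox by fastforce
      show "U \<subseteq> \<Union>?F"
      proof
        fix x assume "x \<in> U"
        then obtain a b where "cbox a b \<subseteq> U" "x \<in> box a b"
          using open_contains_cbox[OF U] by metis
        then show "x \<in> \<Union>?F" by blast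
      qed
    qed
    moreover have "D \<subseteq> Pow U"
      using D(1) box_subset_cbox by fastforce
    moreover have "\<exists>a b. X = box a b \<and> cbox a b \<subseteq> U" if "X \<in> D" for X
      using D(1) that by auto
    ultimately show ?thesis
      using D(2,3) that[of D] by simp
  qed
  have "AE x in lebesgue. \<forall>X\<in>D. x \<in> X \<longrightarrow> g x = 0"
  proof (subst AE_ball_countable[OF D(1)], intro ballI)
    fix X assume "X \<in> D"
    then obtain a b where "X = box a b" "cbox a b \<subseteq> U" using D(3) by blast
    then show "AE x in lebesgue. x \<in> X \<longrightarrow> g x = 0"
      using null_on_box_if_test_integrals_vanish[OF g _ _ test] U by auto
  qed
  then show ?thesis
    by eventually_elim (use D(4) in blast)
qed

lemma L1loc_imp_set_integrable: "L1loc U w \<Longrightarrow> compact K \<Longrightarrow> K \<subseteq> U \<Longrightarrow> set_integrable lebesgue K w"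
  by (simp add: L1loc_def)

lemma L1loc_diff: "L1loc U f \<Longrightarrow> L1loc U g \<Longrightarrow> L1loc U (\<lambda>x. f x - g x)"
  unfolding L1loc_def by (auto intro: set_integral_diff)

lemma smooth_imp_continuous_pderivs: "smooth f \<Longrightarrow> continuous_on S (pderivs I f)"
  unfolding smooth_def
  by (meson continuous_at_imp_continuous_on differentiable_imp_continuous_within)

lemma pderivs_eq_0_outside_support:
  "x \<notin> closure {x. \<phi> x \<noteq> 0} \<Longrightarrow> pderivs I \<phi> x = 0"
proof (induction I arbitrary: x)
  case Nil
  then show ?case using closure_subset[of "{x. \<phi> x \<noteq> 0}"] by auto
next
  case (Cons i I)
  have "((\<lambda>x. 0) has_derivative (\<lambda>h. 0)) (at x)" by simp
  then have "(pderivs I \<phi> has_derivative (\<lambda>h. 0)) (at x)"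
    by (rule has_derivative_transform_within_open[where s="- closure {x. \<phi> x \<noteq> 0}"])
       (use Cons in auto)
  from frechet_derivative_at[OF this] show ?case by (metis pderivs.simps(2))
qed

lemma set_integrable_pderivs_scaleR:
  fixes \<phi> :: "real^'N \<Rightarrow> real" and g :: "real^'N \<Rightarrow> 'b::euclidean_space"
  assumes g: "L1loc U g" and \<phi>: "test_function U \<phi>"
  shows "set_integrable lebesgue U (\<lambda>x. pderivs I \<phi> x *\<^sub>R g x)"
proof -
  let ?K = "closure {x. \<phi> x \<noteq> 0}"
  have K: "compact ?K" "?K \<subseteq> U" "smooth \<phi>" using \<phi> by (auto simp: test_function_def)
  have c: "continuous_on UNIV (pderivs I \<phi>)" by (rule smooth_imp_continuous_pderivs[OF K(3)])
  then have "pderivs I \<phi> \<in> borel_measurable borel" by (rule borel_measurable_continuous_onI)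
  then have m: "pderivs I \<phi> \<in> borel_measurable lebesgue" by (intro measurable_completion) simp
  have "bounded (pderivs I \<phi> ` ?K)"
    using c K(1) by (meson compact_continuous_image compact_imp_bounded continuous_on_subset subset_UNIV)
  then obtain C where C: "\<And>x. x \<in> ?K \<Longrightarrow> norm (pderivs I \<phi> x) \<le> C" by (auto simp: bounded_iff)
  have i: "integrable lebesgue (\<lambda>x. indicat_real ?K x *\<^sub>R g x)"
    using L1loc_imp_set_integrable[OF g K(1,2)] by (simp add: set_integrable_def)
  have "integrable lebesgue (\<lambda>x. pderivs I \<phi> x *\<^sub>R (indicat_real ?K x *\<^sub>R g x))"
  proof (rule Bochner_Integration.integrable_bound)
    show "integrable lebesgue (\<lambda>x. C *\<^sub>R (indicat_real ?K x *\<^sub>R g x))"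
      using i by (rule integrable_scaleR_right)
    show "(\<lambda>x. pderivs I \<phi> x *\<^sub>R (indicat_real ?K x *\<^sub>R g x)) \<in> borel_measurable lebesgue"
      by (rule borel_measurable_scaleR[OF m borel_measurable_integrable[OF i]])
    show "AE x in lebesgue. norm (pderivs I \<phi> x *\<^sub>R indicat_real ?K x *\<^sub>R g x) \<le> norm (C *\<^sub>R indicat_real ?K x *\<^sub>R g x)"
    proof (rule AE_I2)
      fix x show "norm (pderivs I \<phi> x *\<^sub>R indicat_real ?K x *\<^sub>R g x) \<le> norm (C *\<^sub>R indicat_real ?K x *\<^sub>R g x)"
        using C[of x] by (cases "x \<in> ?K") (auto intro!: mult_right_mono)
    qed
  qed
  moreover have "pderivs I \<phi> x *\<^sub>R (indicat_real ?K x *\<^sub>R g x) = indicat_real U x *\<^sub>R (pderivs I \<phi> x *\<^sub>R g x)" for x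
    using K(2) pderivs_eq_0_outside_support[of x \<phi> I] by (cases "x \<in> ?K") (auto simp: indicator_def)
  ultimately show ?thesis
    unfolding set_integrable_def by (simp only:)
qed

text \<open>\<open>weak_partial\<close> is a Hilbert choice, made independently for a function and for its rescaling; this
lemma relates the two choices almost everywhere.\<close>

lemma weak_partial_unique:
  fixes w :: "real^'N \<Rightarrow> 'b::euclidean_space"
  assumes U: "open U" and g: "has_weak_partial U I w g" and h: "has_weak_partial U I w h"
  shows "AE x in lebesgue. x \<in> U \<longrightarrow> g x = h x"
proof -
  have L: "L1loc U g" "L1loc U h" using g h by (auto simp: has_weak_partial_def)
  have "AE x in lebesgue. x \<in> U \<longrightarrow> g x - h x = 0"
  proof (rule AE_zero_if_test_integrals_vanish[OF L1loc_diff[OF L] U])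
    fix \<phi> :: "real^'N \<Rightarrow> real" assume t: "test_function U \<phi>"
    have i: "set_integrable lebesgue U (\<lambda>x. \<phi> x *\<^sub>R g x)" "set_integrable lebesgue U (\<lambda>x. \<phi> x *\<^sub>R h x)"
      using set_integrable_pderivs_scaleR[OF L(1) t, of "[]"] set_integrable_pderivs_scaleR[OF L(2) t, of "[]"] by simp_all
    have "(-1) ^ length I *\<^sub>R (LINT x:U|lebesgue. \<phi> x *\<^sub>R g x) = (-1) ^ length I *\<^sub>R (LINT x:U|lebesgue. \<phi> x *\<^sub>R h x)"
      using g h t unfolding has_weak_partial_def by simp
    then have "(LINT x:U|lebesgue. \<phi> x *\<^sub>R g x) = (LINT x:U|lebesgue. \<phi> x *\<^sub>R h x)"
      by simp
    then show "(LINT x:U|lebesgue. \<phi> x *\<^sub>R (g x - h x)) = 0"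
      using set_integral_diff(2)[OF i] by (simp add: scaleR_diff_right)
  qed
  then show ?thesis by eventually_elim auto
qed


section \<open>Rescaling\<close>

abbreviation zoom :: "'a::real_vector \<Rightarrow> real \<Rightarrow> 'a \<Rightarrow> 'a" where
  "zoom x r \<equiv> (\<lambda>y. x + r *\<^sub>R y)"

abbreviation local_energy ::
  "nat \<Rightarrow> (('N list \<Rightarrow> 'b) \<Rightarrow> real) \<Rightarrow> (real^'N) set \<Rightarrow> real \<Rightarrow> (real^'N \<Rightarrow> 'b::euclidean_space) \<Rightarrow> (real^'N) set \<Rightarrow> ennreal" where
  "local_energy n F \<Omega> \<epsilon> w A \<equiv> (\<integral>\<^sup>+z\<in>A. ennreal (1 / \<epsilon> * F (scaled_jet n \<Omega> \<epsilon> w z)) \<partial>lebesgue)"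

lemma
  fixes x :: "'a::euclidean_space"
  assumes "0 < r"
  shows lebesgue_eq_scaled: "lebesgue = density (distr lebesgue lebesgue (zoom x r)) (\<lambda>_. ennreal (r ^ DIM('a)))"
    and measurable_scaled: "(zoom x r) \<in> lebesgue \<rightarrow>\<^sub>M lebesgue"
proof -
  have T: "(\<lambda>y. x + (\<Sum>j\<in>Basis. (r * (y \<bullet> j)) *\<^sub>R j)) = (zoom x r)"
    by (simp add: scaleR_scaleR[symmetric] scaleR_sum_right[symmetric] euclidean_representation del: scaleR_scaleR)
  show "lebesgue = density (distr lebesgue lebesgue (zoom x r)) (\<lambda>_. ennreal (r ^ DIM('a)))"
    using lebesgue_affine_euclidean[of "\<lambda>_. r" x] assms by (simp add: T)
  show "(zoom x r) \<in> lebesgue \<rightarrow>\<^sub>M lebesgue"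
    using lebesgue_affine_measurable[of "\<lambda>_. r" x] assms by (simp add: T)
qed

lemma nn_integral_scaled:
  fixes x :: "'a::euclidean_space"
  assumes r: "0 < r" and f: "f \<in> borel_measurable lebesgue"
  shows "(\<integral>\<^sup>+z. f z \<partial>lebesgue) = ennreal (r ^ DIM('a)) * (\<integral>\<^sup>+y. f (x + r *\<^sub>R y) \<partial>lebesgue)"
proof -
  note m = measurable_scaled[OF r, of x]
  have "(\<integral>\<^sup>+z. f z \<partial>lebesgue) = (\<integral>\<^sup>+z. f z \<partial>density (distr lebesgue lebesgue (zoom x r)) (\<lambda>_. ennreal (r ^ DIM('a))))"
    by (subst lebesgue_eq_scaled[OF r, of x]) simp
  also have "\<dots> = ennreal (r ^ DIM('a)) * (\<integral>\<^sup>+z. f z \<partial>distr lebesgue lebesgue (zoom x r))"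
    using f by (subst nn_integral_density) (auto simp: nn_integral_cmult)
  also have "(\<integral>\<^sup>+z. f z \<partial>distr lebesgue lebesgue (zoom x r)) = (\<integral>\<^sup>+y. f (x + r *\<^sub>R y) \<partial>lebesgue)"
    using f m by (subst nn_integral_distr) auto
  finally show ?thesis .
qed

lemma integral_scaled:
  fixes x :: "'a::euclidean_space" and f :: "'a \<Rightarrow> 'b::euclidean_space"
  assumes r: "0 < r" and f: "integrable lebesgue f"
  shows "integrable lebesgue (\<lambda>y. f (x + r *\<^sub>R y))"
    and "integral\<^sup>L lebesgue f = (r ^ DIM('a)) *\<^sub>R (LINT y|lebesgue. f (x + r *\<^sub>R y))"
proof -
  note m = measurable_scaled[OF r, of x]
  have fm: "f \<in> borel_measurable lebesgue" using f by (rule borel_measurable_integrable)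
  let ?D = "distr lebesgue lebesgue (zoom x r)"
  have "integrable (density ?D (\<lambda>_. ennreal (r ^ DIM('a)))) f"
    using f lebesgue_eq_scaled[OF r, of x] by simp
  then have "integrable ?D (\<lambda>z. (r ^ DIM('a)) *\<^sub>R f z)"
    using fm r by (subst (asm) integrable_density) auto
  then have "integrable ?D f"
    using r integrable_scaleR_right[of "1 / r ^ DIM('a)" ?D "\<lambda>z. (r ^ DIM('a)) *\<^sub>R f z"] by simp
  then show "integrable lebesgue (\<lambda>y. f (x + r *\<^sub>R y))"
    using fm m by (subst (asm) integrable_distr_eq) auto
  have "integral\<^sup>L lebesgue f = integral\<^sup>L (density ?D (\<lambda>_. ennreal (r ^ DIM('a)))) f"
    by (subst lebesgue_eq_scaled[OF r, of x]) simp
  also have "\<dots> = (r ^ DIM('a)) *\<^sub>R integral\<^sup>L ?D f"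
    using fm r by (subst integral_density) auto
  also have "integral\<^sup>L ?D f = (LINT y|lebesgue. f (x + r *\<^sub>R y))"
    using fm m by (subst integral_distr) auto
  finally show "integral\<^sup>L lebesgue f = (r ^ DIM('a)) *\<^sub>R (LINT y|lebesgue. f (x + r *\<^sub>R y))" .
qed

text \<open>For a function \<open>f\<close> that need not be measurable: each simple function below the integrand on the
left is carried by the scaling to a measurable function below the integrand on the right.\<close>

lemma nn_integral_scaled_le:
  fixes x :: "'a::euclidean_space" and f :: "'a \<Rightarrow> ennreal"
  assumes r: "0 < r"
  shows "(\<integral>\<^sup>+y\<in>Q. f (x + r *\<^sub>R y) \<partial>lebesgue)
    \<le> ennreal ((1 / r) ^ DIM('a)) * (\<integral>\<^sup>+z\<in>zoom x r ` Q. f z \<partial>lebesgue)"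
proof -
  have "integral\<^sup>S lebesgue s \<le> ennreal ((1 / r) ^ DIM('a)) * (\<integral>\<^sup>+z\<in>zoom x r ` Q. f z \<partial>lebesgue)"
    if s: "simple_function lebesgue s" "s \<le> (\<lambda>y. f (x + r *\<^sub>R y) * indicator Q y)" for s
  proof -
    let ?g = "\<lambda>z. s (- (1 / r) *\<^sub>R x + (1 / r) *\<^sub>R z)"
    have inv: "- (1 / r) *\<^sub>R x + (1 / r) *\<^sub>R (x + r *\<^sub>R y) = y" "x + r *\<^sub>R (- (1 / r) *\<^sub>R x + (1 / r) *\<^sub>R y) = y" for y
      using r by (auto simp: scaleR_add_right scaleR_diff_right)
    have sm: "s \<in> borel_measurable lebesgue" using s(1) by (rule borel_measurable_simple_function)
    have gm: "?g \<in> borel_measurable lebesgue"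
      using measurable_compose[OF measurable_scaled[of "1/r" "- (1 / r) *\<^sub>R x"] sm] r by simp
    have "ennreal (r ^ DIM('a)) * integral\<^sup>N lebesgue s = (\<integral>\<^sup>+z. ?g z \<partial>lebesgue)"
      using nn_integral_scaled[OF r gm, of x] by (simp only: inv)
    also have "\<dots> \<le> (\<integral>\<^sup>+z\<in>zoom x r ` Q. f z \<partial>lebesgue)"
    proof (rule nn_integral_mono)
      fix z
      let ?y = "- (1 / r) *\<^sub>R x + (1 / r) *\<^sub>R z"
      have "s ?y \<le> f (x + r *\<^sub>R ?y) * indicator Q ?y" using s(2) by (auto simp: le_fun_def)
      also have "\<dots> \<le> f z * indicator (zoom x r ` Q) z"
        using inv(2)[of z] by (auto simp: indicator_def simp del: scaleR_minus_left) (metis imageI)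
      finally show "s ?y \<le> f z * indicator (zoom x r ` Q) z" .
    qed
    finally have le: "ennreal (r ^ DIM('a)) * integral\<^sup>N lebesgue s \<le> (\<integral>\<^sup>+z\<in>zoom x r ` Q. f z \<partial>lebesgue)" .
    have "integral\<^sup>S lebesgue s = integral\<^sup>N lebesgue s"
      using s(1) by (simp add: nn_integral_eq_simple_integral)
    also have "\<dots> = ennreal ((1 / r) ^ DIM('a)) * (ennreal (r ^ DIM('a)) * integral\<^sup>N lebesgue s)"
      using r by (simp add: mult.assoc[symmetric] ennreal_mult[symmetric] power_mult_distrib[symmetric])
    also have "\<dots> \<le> ennreal ((1 / r) ^ DIM('a)) * (\<integral>\<^sup>+z\<in>zoom x r ` Q. f z \<partial>lebesgue)"
      by (rule mult_left_mono[OF le]) simp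
    finally show ?thesis .
  qed
  then show ?thesis
    unfolding nn_integral_def by (intro SUP_least) auto
qed

text \<open>For measurable \<open>f\<close> this is an equality; for arbitrary \<open>f\<close> the inequality is inherited from the
simple functions below the integrand, which remain measurable when divided by \<open>c\<close>.\<close>

lemma nn_integral_cmult_le:
  assumes c: "0 < c"
  shows "(\<integral>\<^sup>+x. ennreal c * f x \<partial>M) \<le> ennreal c * integral\<^sup>N M f"
proof -
  have "integral\<^sup>S M s \<le> ennreal c * integral\<^sup>N M f"
    if s: "simple_function M s" "s \<le> (\<lambda>x. ennreal c * f x)" for s
  proof -
    have m: "s \<in> borel_measurable M" using s(1) by (rule borel_measurable_simple_function)
    have inv: "ennreal c * (ennreal (1 / c) * t) = t" "ennreal (1 / c) * (ennreal c * t) = t" for t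
      using c by (simp_all add: mult.assoc[symmetric] ennreal_mult[symmetric])
    have "integral\<^sup>S M s = integral\<^sup>N M s"
      using s(1) by (simp add: nn_integral_eq_simple_integral)
    also have "\<dots> = ennreal c * (\<integral>\<^sup>+x. ennreal (1 / c) * s x \<partial>M)"
      using m by (simp add: nn_integral_cmult inv)
    also have "\<dots> \<le> ennreal c * integral\<^sup>N M f"
    proof (intro mult_left_mono nn_integral_mono)
      fix x
      have "ennreal (1 / c) * s x \<le> ennreal (1 / c) * (ennreal c * f x)"
        using s(2) by (intro mult_left_mono) (auto simp: le_fun_def)
      then show "ennreal (1 / c) * s x \<le> f x" by (simp only: inv)
    qed simp
    finally show ?thesis .
  qed
  then show ?thesis
    unfolding nn_integral_def[of _ "\<lambda>x. ennreal c * f x"] by (intro SUP_least) auto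
qed

lemma L1loc_scaled:
  fixes f :: "real^'N \<Rightarrow> 'b::euclidean_space"
  assumes r: "0 < r" and f: "L1loc \<Omega> f" and Q: "zoom x r ` Q \<subseteq> \<Omega>"
  shows "L1loc Q (\<lambda>y. f (x + r *\<^sub>R y))"
  unfolding L1loc_def
proof (intro allI impI)
  fix K assume K: "compact K \<and> K \<subseteq> Q"
  let ?K = "zoom x r ` K"
  have "compact ?K" using K by (intro compact_continuous_image continuous_intros) auto
  then have "integrable lebesgue (\<lambda>z. indicat_real ?K z *\<^sub>R f z)"
    using L1loc_imp_set_integrable[OF f, of ?K] K Q by (auto simp: set_integrable_def)
  from integral_scaled(1)[OF r this, of x]
  have "integrable lebesgue (\<lambda>y. indicat_real ?K (x + r *\<^sub>R y) *\<^sub>R f (x + r *\<^sub>R y))" .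
  moreover have "indicat_real ?K (x + r *\<^sub>R y) = indicat_real K y" for y
    using r by (auto simp: indicator_def)
  ultimately show "set_integrable lebesgue K (\<lambda>y. f (x + r *\<^sub>R y))"
    by (simp add: set_integrable_def)
qed

lemma pderivs_rescaled:
  fixes \<phi> :: "real^'N \<Rightarrow> real"
  assumes "smooth \<phi>"
  shows "pderivs I (\<lambda>z. \<phi> ((1 / r) *\<^sub>R (z - x))) = (\<lambda>z. (1 / r) ^ length I * pderivs I \<phi> ((1 / r) *\<^sub>R (z - x)))"
proof (induction I)
  case Nil
  then show ?case by simp
next
  case (Cons i I)
  show ?case
  proof
    fix z
    let ?y = "(1 / r) *\<^sub>R (z - x)"
    have d: "(pderivs I \<phi> has_derivative frechet_derivative (pderivs I \<phi>) (at ?y)) (at ?y)"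
      using assms unfolding smooth_def frechet_derivative_works[symmetric] by blast
    have a: "((\<lambda>z. (1 / r) *\<^sub>R (z - x)) has_derivative (\<lambda>h. (1 / r) *\<^sub>R h)) (at z)"
      by (auto intro!: derivative_eq_intros)
    have "((\<lambda>z. (1 / r) ^ length I * pderivs I \<phi> ((1 / r) *\<^sub>R (z - x))) has_derivative
       (\<lambda>h. (1 / r) ^ length I * frechet_derivative (pderivs I \<phi>) (at ?y) ((1 / r) *\<^sub>R h))) (at z)"
      using has_derivative_compose[OF a d] by (rule has_derivative_mult_right)
    from frechet_derivative_at[OF this]
    have "pderivs (i # I) (\<lambda>z. \<phi> ((1 / r) *\<^sub>R (z - x))) z =
       (1 / r) ^ length I * frechet_derivative (pderivs I \<phi>) (at ?y) ((1 / r) *\<^sub>R axis i 1)"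
      unfolding pderivs.simps Cons.IH by metis
    also have "frechet_derivative (pderivs I \<phi>) (at ?y) ((1 / r) *\<^sub>R axis i 1) =
       (1 / r) *\<^sub>R frechet_derivative (pderivs I \<phi>) (at ?y) (axis i 1)"
      using has_derivative_linear[OF d] by (rule linear_cmul)
    finally show "pderivs (i # I) (\<lambda>z. \<phi> ((1 / r) *\<^sub>R (z - x))) z = (1 / r) ^ length (i # I) * pderivs (i # I) \<phi> ?y"
      by simp
  qed
qed

lemma test_function_rescaled:
  fixes \<phi> :: "real^'N \<Rightarrow> real"
  assumes r: "0 < r" and \<phi>: "test_function Q \<phi>" and Q: "zoom x r ` Q \<subseteq> \<Omega>"
  shows "test_function \<Omega> (\<lambda>z. \<phi> ((1 / r) *\<^sub>R (z - x)))" (is "test_function \<Omega> ?\<psi>")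
proof -
  have sm: "smooth \<phi>" using \<phi> by (simp add: test_function_def)
  let ?K = "closure {y. \<phi> y \<noteq> 0}"
  let ?A = "\<lambda>y. x + r *\<^sub>R y"
  have K: "compact ?K" "?K \<subseteq> Q" using \<phi> by (auto simp: test_function_def)
  have cK: "compact (?A ` ?K)"
    using K by (intro compact_continuous_image continuous_intros) auto
  have "{z. ?\<psi> z \<noteq> 0} \<subseteq> ?A ` ?K"
  proof
    fix z assume "z \<in> {z. ?\<psi> z \<noteq> 0}"
    then have "(1 / r) *\<^sub>R (z - x) \<in> ?K" using closure_subset[of "{y. \<phi> y \<noteq> 0}"] by auto
    moreover have "z = ?A ((1 / r) *\<^sub>R (z - x))" using r by simp
    ultimately show "z \<in> ?A ` ?K" by blast
  qed
  then have sub: "closure {z. ?\<psi> z \<noteq> 0} \<subseteq> ?A ` ?K"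
    using cK by (intro closure_minimal compact_imp_closed)
  then have "compact (closure {z. ?\<psi> z \<noteq> 0})"
    using cK by (meson closed_closure compact_closure compact_eq_bounded_closed bounded_subset)
  moreover have "closure {z. ?\<psi> z \<noteq> 0} \<subseteq> \<Omega>" using sub K Q by blast
  moreover have "smooth ?\<psi>"
    unfolding smooth_def pderivs_rescaled[OF sm]
  proof (intro allI)
    fix I z
    have "pderivs I \<phi> differentiable (at ((1 / r) *\<^sub>R (z - x)))"
      using sm by (simp add: smooth_def)
    moreover have "(\<lambda>z. (1 / r) *\<^sub>R (z - x)) differentiable (at z)"
      by (intro derivative_intros)
    ultimately have "(\<lambda>z. pderivs I \<phi> ((1 / r) *\<^sub>R (z - x))) differentiable (at z)"
      using differentiable_chain_at[of "\<lambda>z. (1 / r) *\<^sub>R (z - x)" z "pderivs I \<phi>"] by (simp add: o_def)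
    then show "(\<lambda>z. (1 / r) ^ length I * pderivs I \<phi> ((1 / r) *\<^sub>R (z - x))) differentiable at z"
      by (intro differentiable_mult) auto
  qed
  ultimately show ?thesis by (simp add: test_function_def)
qed

text \<open>A test function on \<open>Q\<close> and its transplant to \<open>\<Omega>\<close> are in bijection under the scaling, and the chain
rule contributes one factor \<open>1 / r\<close> for each derivative. This is how all the conditions that are
formulated by test functions (weak derivatives and vanishing divergence) pass to rescaled
functions.\<close>

lemma integral_pderivs_scaled:
  fixes \<phi> :: "real^'N \<Rightarrow> real" and f :: "real^'N \<Rightarrow> 'b::euclidean_space"
  assumes r: "0 < r" and \<phi>: "test_function Q \<phi>" and Q: "zoom x r ` Q \<subseteq> \<Omega>" and f: "L1loc \<Omega> f"
  shows "(LINT y:Q|lebesgue. pderivs I \<phi> y *\<^sub>R f (x + r *\<^sub>R y)) =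
    (r ^ length I * (1 / r) ^ CARD('N)) *\<^sub>R (LINT z:\<Omega>|lebesgue. pderivs I (\<lambda>z. \<phi> ((1 / r) *\<^sub>R (z - x))) z *\<^sub>R f z)"
proof -
  let ?\<psi> = "\<lambda>z. \<phi> ((1 / r) *\<^sub>R (z - x))"
  let ?H = "\<lambda>z. indicat_real \<Omega> z *\<^sub>R (pderivs I ?\<psi> z *\<^sub>R f z)"
  have sm: "smooth \<phi>" and sup: "closure {y. \<phi> y \<noteq> 0} \<subseteq> Q" using \<phi> by (auto simp: test_function_def)
  have i: "integrable lebesgue ?H"
    using set_integrable_pderivs_scaleR[OF f test_function_rescaled[OF r \<phi> Q]] by (simp add: set_integrable_def)
  have H: "?H (x + r *\<^sub>R y) = (1 / r) ^ length I *\<^sub>R (indicat_real Q y *\<^sub>R (pderivs I \<phi> y *\<^sub>R f (x + r *\<^sub>R y)))" for y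
  proof (cases "y \<in> Q")
    case True
    then have "x + r *\<^sub>R y \<in> \<Omega>" using Q by auto
    then show ?thesis using True r by (simp add: pderivs_rescaled[OF sm])
  next
    case False
    then have "pderivs I \<phi> y = 0" using sup by (intro pderivs_eq_0_outside_support) auto
    then show ?thesis using False r by (simp add: pderivs_rescaled[OF sm])
  qed
  have "(LINT z:\<Omega>|lebesgue. pderivs I ?\<psi> z *\<^sub>R f z) = integral\<^sup>L lebesgue ?H"
    by (simp add: set_lebesgue_integral_def)
  also have "\<dots> = (r ^ CARD('N)) *\<^sub>R (LINT y|lebesgue. ?H (x + r *\<^sub>R y))"
    using integral_scaled(2)[OF r i, of x] by simp
  also have "\<dots> = (r ^ CARD('N) * (1 / r) ^ length I) *\<^sub>R (LINT y:Q|lebesgue. pderivs I \<phi> y *\<^sub>R f (x + r *\<^sub>R y))"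
    unfolding H set_lebesgue_integral_def by (subst integral_scaleR_right) simp
  finally show ?thesis
    using r by (simp add: power_mult_distrib[symmetric] mult.assoc power_divide)
qed

lemma has_weak_partial_scaled:
  fixes w :: "real^'N \<Rightarrow> 'b::euclidean_space"
  assumes r: "0 < r" and w: "has_weak_partial \<Omega> I w g" and Q: "zoom x r ` Q \<subseteq> \<Omega>"
  shows "has_weak_partial Q I (\<lambda>y. w (x + r *\<^sub>R y)) (\<lambda>y. r ^ length I *\<^sub>R g (x + r *\<^sub>R y))"
  unfolding has_weak_partial_def
proof (intro conjI allI impI)
  have L: "L1loc \<Omega> w" "L1loc \<Omega> g" using w by (auto simp: has_weak_partial_def)
  show "L1loc Q (\<lambda>y. w (x + r *\<^sub>R y))" by (rule L1loc_scaled[OF r L(1) Q])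
  show "L1loc Q (\<lambda>y. r ^ length I *\<^sub>R g (x + r *\<^sub>R y))"
    using L1loc_scaled[OF r L(2) Q] by (simp add: L1loc_def)
  fix \<phi> :: "real^'N \<Rightarrow> real" assume \<phi>: "test_function Q \<phi>"
  let ?\<psi> = "\<lambda>z. \<phi> ((1 / r) *\<^sub>R (z - x))"
  have "(LINT y:Q|lebesgue. pderivs I \<phi> y *\<^sub>R w (x + r *\<^sub>R y)) =
    (r ^ length I * (1 / r) ^ CARD('N)) *\<^sub>R (LINT z:\<Omega>|lebesgue. pderivs I ?\<psi> z *\<^sub>R w z)"
    by (rule integral_pderivs_scaled[OF r \<phi> Q L(1)])
  also have "(LINT z:\<Omega>|lebesgue. pderivs I ?\<psi> z *\<^sub>R w z) = (-1) ^ length I *\<^sub>R (LINT z:\<Omega>|lebesgue. ?\<psi> z *\<^sub>R g z)"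
    using w test_function_rescaled[OF r \<phi> Q] unfolding has_weak_partial_def by blast
  also have "(r ^ length I * (1 / r) ^ CARD('N)) *\<^sub>R \<dots> =
     (-1) ^ length I *\<^sub>R r ^ length I *\<^sub>R ((1 / r) ^ CARD('N) *\<^sub>R (LINT z:\<Omega>|lebesgue. ?\<psi> z *\<^sub>R g z))"
    by (simp add: algebra_simps)
  also have "(1 / r) ^ CARD('N) *\<^sub>R (LINT z:\<Omega>|lebesgue. ?\<psi> z *\<^sub>R g z) = (LINT y:Q|lebesgue. \<phi> y *\<^sub>R g (x + r *\<^sub>R y))"
    using integral_pderivs_scaled[OF r \<phi> Q L(2), of "[]"] by simp
  also have "r ^ length I *\<^sub>R \<dots> = (LINT y:Q|lebesgue. \<phi> y *\<^sub>R (r ^ length I *\<^sub>R g (x + r *\<^sub>R y)))"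
    unfolding set_lebesgue_integral_def by (simp add: integral_scaleR_right[symmetric] mult_ac del: integral_scaleR_right)
  finally show "(LINT y:Q|lebesgue. pderivs I \<phi> y *\<^sub>R w (x + r *\<^sub>R y)) =
     (-1) ^ length I *\<^sub>R (LINT y:Q|lebesgue. \<phi> y *\<^sub>R (r ^ length I *\<^sub>R g (x + r *\<^sub>R y)))" .
qed

lemma L1loc_scaleR: "L1loc U w \<Longrightarrow> L1loc U (\<lambda>x. c *\<^sub>R w x)"
  by (simp add: L1loc_def)

lemma has_weak_partial_scaleR:
  fixes w :: "real^'N \<Rightarrow> 'b::euclidean_space"
  assumes "has_weak_partial U I w g"
  shows "has_weak_partial U I (\<lambda>x. c *\<^sub>R w x) (\<lambda>x. c *\<^sub>R g x)"
proof -
  have *: "(LINT x:U|lebesgue. f x *\<^sub>R c *\<^sub>R h x) = c *\<^sub>R (LINT x:U|lebesgue. f x *\<^sub>R h x)"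
    for f :: "real^'N \<Rightarrow> real" and h :: "real^'N \<Rightarrow> 'b"
    unfolding set_lebesgue_integral_def by (simp add: integral_scaleR_right[symmetric] mult_ac del: integral_scaleR_right)
  show ?thesis
    using assms unfolding has_weak_partial_def * by (auto simp: L1loc_scaleR)
qed

lemma W1loc_scaled:
  fixes w :: "real^'N \<Rightarrow> 'b::euclidean_space"
  assumes r: "0 < r" and w: "W1loc n \<Omega> w" and Q: "zoom x r ` Q \<subseteq> \<Omega>"
  shows "W1loc n Q (\<lambda>y. w (x + r *\<^sub>R y))"
  using w L1loc_scaled[OF r _ Q] has_weak_partial_scaled[OF r _ Q] unfolding W1loc_def by blast

lemma L1loc_component:
  "L1loc U h \<Longrightarrow> L1loc U (\<lambda>x. h x $ i $ j)"
  for h :: "real^'N \<Rightarrow> real^'m^'d"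
  unfolding L1loc_def set_integrable_def
proof (intro allI impI)
  fix K assume "\<forall>K. compact K \<and> K \<subseteq> U \<longrightarrow> integrable lebesgue (\<lambda>x. indicat_real K x *\<^sub>R h x)"
    and "compact K \<and> K \<subseteq> U"
  then have i: "integrable lebesgue (\<lambda>x. indicat_real K x *\<^sub>R h x)" by blast
  have "bounded_linear (\<lambda>A::real^'m^'d. A $ i $ j)"
    by (intro bounded_linear_compose[OF bounded_linear_vec_nth] bounded_linear_vec_nth)
  from integrable_bounded_linear[OF this i]
  show "integrable lebesgue (\<lambda>x. indicat_real K x *\<^sub>R h x $ i $ j)" by simp
qed

lemma div_free_scaled:
  fixes h :: "real^'N \<Rightarrow> real^'N^'d"
  assumes r: "0 < r" and h: "L1loc \<Omega> h" "div_free \<Omega> h" and Q: "zoom x r ` Q \<subseteq> \<Omega>"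
  shows "div_free Q (\<lambda>y. h (x + r *\<^sub>R y))"
  unfolding div_free_def
proof (intro allI impI)
  fix \<phi> :: "real^'N \<Rightarrow> real" and i assume \<phi>: "test_function Q \<phi>"
  let ?\<psi> = "\<lambda>z. \<phi> ((1 / r) *\<^sub>R (z - x))"
  have split: "(LINT y:U|lebesgue. (\<Sum>j\<in>UNIV. g y $ i $ j * pderivs [j] f y)) = (\<Sum>j\<in>UNIV. LINT y:U|lebesgue. pderivs [j] f y *\<^sub>R (g y $ i $ j))"
    if "L1loc U g" "test_function U f" for g :: "real^'N \<Rightarrow> real^'N^'d" and f U
    using set_integrable_pderivs_scaleR[OF L1loc_component[OF that(1)] that(2)]
    unfolding set_integrable_def set_lebesgue_integral_def
    by (subst Bochner_Integration.integral_sum[symmetric]) (auto simp: sum_distrib_left mult_ac simp del: pderivs.simps)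
  have "(LINT y:Q|lebesgue. (\<Sum>j\<in>UNIV. h (x + r *\<^sub>R y) $ i $ j * pderivs [j] \<phi> y)) =
     (\<Sum>j\<in>UNIV. LINT y:Q|lebesgue. pderivs [j] \<phi> y *\<^sub>R (h (x + r *\<^sub>R y) $ i $ j))"
    by (rule split[OF L1loc_scaled[OF r h(1) Q] \<phi>])
  also have "\<dots> = (\<Sum>j\<in>UNIV. (r * (1 / r) ^ CARD('N)) *\<^sub>R (LINT z:\<Omega>|lebesgue. pderivs [j] ?\<psi> z *\<^sub>R (h z $ i $ j)))"
    using integral_pderivs_scaled[OF r \<phi> Q L1loc_component[OF h(1)], of "[_]"] by simp
  also have "\<dots> = (r * (1 / r) ^ CARD('N)) *\<^sub>R (LINT z:\<Omega>|lebesgue. (\<Sum>j\<in>UNIV. h z $ i $ j * pderivs [j] ?\<psi> z))"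
    unfolding split[OF h(1) test_function_rescaled[OF r \<phi> Q]] by (simp add: sum_distrib_left)
  also have "\<dots> = 0"
    using h(2) test_function_rescaled[OF r \<phi> Q] unfolding div_free_def by (simp del: pderivs.simps)
  finally show "(LINT y:Q|lebesgue. (\<Sum>j\<in>UNIV. h (x + r *\<^sub>R y) $ i $ j * pderivs [j] \<phi> y)) = 0" .
qed

text \<open>The gradient component keeps its values only if the potential \<open>u\<close> is divided by \<open>r\<close>.\<close>

lemma class_B_scaled:
  fixes v :: "real^'N \<Rightarrow> ('N::finite, 'k::finite, 'd::finite, 'm::finite) state"
  assumes r: "0 < r" and v: "class_B \<Omega> v" and Q: "zoom x r ` Q \<subseteq> \<Omega>"
  shows "class_B Q (\<lambda>y. v (x + r *\<^sub>R y))"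
proof -
  obtain u :: "real^'N \<Rightarrow> real^'k" and G h \<psi> where *: "L1loc \<Omega> v" "W1loc 1 \<Omega> u" "is_weak_gradient \<Omega> u G"
      "L1loc \<Omega> h" "div_free \<Omega> h" "L1loc \<Omega> \<psi>" "\<And>x. x \<in> \<Omega> \<Longrightarrow> v x = (G x, h x, \<psi> x)"
    using v unfolding class_B_def by blast
  let ?u = "\<lambda>y. (1 / r) *\<^sub>R u (x + r *\<^sub>R y)"
  have "W1loc 1 Q ?u"
    using W1loc_scaled[OF r *(2) Q] has_weak_partial_scaleR L1loc_scaleR unfolding W1loc_def by blast
  moreover have "is_weak_gradient Q ?u (\<lambda>y. G (x + r *\<^sub>R y))"
    unfolding is_weak_gradient_def
  proof
    fix j
    have "has_weak_partial \<Omega> [j] u (\<lambda>x. column j (G x))"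
      using *(3) unfolding is_weak_gradient_def by blast
    from has_weak_partial_scaleR[OF has_weak_partial_scaled[OF r this Q], of "1 / r"]
    show "has_weak_partial Q [j] ?u (\<lambda>y. column j (G (x + r *\<^sub>R y)))"
      using r by simp
  qed
  ultimately show ?thesis
    unfolding class_B_def
    using L1loc_scaled[OF r *(1) Q] L1loc_scaled[OF r *(4) Q] L1loc_scaled[OF r *(6) Q]
      div_free_scaled[OF r *(4,5) Q] *(7) Q
    by (intro conjI exI[of _ ?u] exI[of _ "\<lambda>y. G (x + r *\<^sub>R y)"] exI[of _ "\<lambda>y. h (x + r *\<^sub>R y)"]
         exI[of _ "\<lambda>y. \<psi> (x + r *\<^sub>R y)"]) (auto simp: image_subset_iff)
qed

text \<open>With \<open>y = (z - x) / r\<close> one has \<open>(\<epsilon> / r) \<partial>\<^sub>y = \<epsilon> \<partial>\<^sub>z\<close>, so the jets of the rescaled function with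
parameter \<open>\<epsilon> / r\<close> are those of \<open>w\<close> with parameter \<open>\<epsilon>\<close>, up to a null set that comes from the choice
of representatives. The factor \<open>r\<close> is the quotient of \<open>1 / (\<epsilon> / r)\<close> and \<open>1 / \<epsilon>\<close>; the power of
\<open>1 / r\<close> is the Jacobian.\<close>

lemma energy_scaled_le:
  fixes w :: "real^'N \<Rightarrow> 'b::euclidean_space"
  assumes r: "0 < r" and \<epsilon>: "0 < \<epsilon>" and w: "W1loc n \<Omega> w" and Q: "zoom x r ` Q \<subseteq> \<Omega>"
    and open_Q: "open Q"
  shows "energy n F Q (\<epsilon> / r) (\<lambda>y. w (x + r *\<^sub>R y)) \<le>
    ennreal (r * (1 / r) ^ CARD('N)) * local_energy n F \<Omega> \<epsilon> w (zoom x r ` Q)"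
proof -
  let ?A = "\<lambda>y. x + r *\<^sub>R y"
  have wp: "has_weak_partial \<Omega> I w (weak_partial \<Omega> I w)" if "length I \<le> n" for I
    unfolding weak_partial_def using w that unfolding W1loc_def by (metis someI_ex)
  have AE1: "AE y in lebesgue. y \<in> Q \<longrightarrow> weak_partial Q I (\<lambda>y. w (?A y)) y = r ^ length I *\<^sub>R weak_partial \<Omega> I w (?A y)"
    if "length I \<le> n" for I
  proof -
    have h: "has_weak_partial Q I (\<lambda>y. w (?A y)) (\<lambda>y. r ^ length I *\<^sub>R weak_partial \<Omega> I w (?A y))"
      by (rule has_weak_partial_scaled[OF r wp[OF that] Q])
    then have "has_weak_partial Q I (\<lambda>y. w (?A y)) (weak_partial Q I (\<lambda>y. w (?A y)))"
      unfolding weak_partial_def[of Q] by (rule someI[of "has_weak_partial Q I (\<lambda>y. w (?A y))"])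
    from weak_partial_unique[OF open_Q this h] show ?thesis .
  qed
  have "AE y in lebesgue. \<forall>I\<in>{I. length I \<le> n}. y \<in> Q \<longrightarrow> weak_partial Q I (\<lambda>y. w (?A y)) y = r ^ length I *\<^sub>R weak_partial \<Omega> I w (?A y)"
    by (subst AE_ball_countable) (use AE1 in auto)
  then have ae: "AE y in lebesgue. y \<in> Q \<longrightarrow> scaled_jet n Q (\<epsilon> / r) (\<lambda>y. w (?A y)) y = scaled_jet n \<Omega> \<epsilon> w (?A y)"
  proof eventually_elim
    case (elim y)
    then show ?case using r by (auto simp: scaled_jet_def fun_eq_iff power_divide)
  qed
  have "energy n F Q (\<epsilon> / r) (\<lambda>y. w (?A y)) \<le> (\<integral>\<^sup>+y\<in>Q. ennreal r * ennreal (1 / \<epsilon> * F (scaled_jet n \<Omega> \<epsilon> w (?A y))) \<partial>lebesgue)"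
    unfolding energy_def
  proof (rule nn_integral_mono_AE)
    show "AE y in lebesgue. ennreal (1 / (\<epsilon> / r) * F (scaled_jet n Q (\<epsilon> / r) (\<lambda>y. w (?A y)) y)) * indicator Q y
       \<le> ennreal r * ennreal (1 / \<epsilon> * F (scaled_jet n \<Omega> \<epsilon> w (?A y))) * indicator Q y"
      using ae
    proof eventually_elim
      case (elim y)
      then show ?case using r \<epsilon>
        by (cases "y \<in> Q") (auto simp: ennreal_mult'[symmetric])
    qed
  qed
  also have "\<dots> \<le> ennreal ((1 / r) ^ CARD('N)) * (\<integral>\<^sup>+z\<in>?A ` Q. ennreal r * ennreal (1 / \<epsilon> * F (scaled_jet n \<Omega> \<epsilon> w z)) \<partial>lebesgue)"
    using nn_integral_scaled_le[OF r, of "\<lambda>z. ennreal r * ennreal (1 / \<epsilon> * F (scaled_jet n \<Omega> \<epsilon> w z))" x Q] by simp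
  also have "\<dots> \<le> ennreal ((1 / r) ^ CARD('N)) * (ennreal r * local_energy n F \<Omega> \<epsilon> w (?A ` Q))"
    unfolding mult.assoc[of "ennreal r"] by (intro mult_left_mono nn_integral_cmult_le[OF r]) simp
  finally show ?thesis
    using r by (simp add: ennreal_mult mult_ac)
qed


section \<open>Blow-up at jump points\<close>

abbreviation deviation :: "('a::euclidean_space \<Rightarrow> 'b::euclidean_space) \<Rightarrow> 'b \<Rightarrow> 'a set \<Rightarrow> ennreal" where
  "deviation g a A \<equiv> (\<integral>\<^sup>+y\<in>A. ennreal (norm (g y - a)) \<partial>lebesgue)"

abbreviation Lp_error :: "real \<Rightarrow> 'a::euclidean_space set \<Rightarrow> ('a \<Rightarrow> 'b::euclidean_space) \<Rightarrow> ('a \<Rightarrow> 'b) \<Rightarrow> ennreal" where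
  "Lp_error p U f g \<equiv> (\<integral>\<^sup>+y\<in>U. ennreal (norm (f y - g y) powr p) \<partial>lebesgue)"

abbreviation blow_up_error ::
  "real \<Rightarrow> 'a::euclidean_space set \<Rightarrow> ('a \<Rightarrow> 'b::euclidean_space) \<Rightarrow> 'a \<Rightarrow> real \<Rightarrow> 'b \<Rightarrow> 'b \<Rightarrow> 'a \<Rightarrow> ennreal" where
  "blow_up_error p U f x r a b \<nu> \<equiv>
     (\<integral>\<^sup>+y\<in>U. ennreal (norm (f (x + r *\<^sub>R y) - jump_profile a b \<nu> y) powr p) \<partial>lebesgue)"

definition cube_at :: "'a::euclidean_space set \<Rightarrow> 'a \<Rightarrow> real \<Rightarrow> 'a set" where
  "cube_at S x r = zoom x r ` unit_cube S"

lemma orthonormal_basis_facts: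
  fixes S :: "'a::euclidean_space set"
  assumes "orthonormal_basis_through \<nu> S"
  shows "\<nu> \<in> S" "finite S" "card S = DIM('a)" "independent S" "\<And>b. b \<in> S \<Longrightarrow> norm b = 1"
    "\<And>y. (\<Sum>b\<in>S. (y \<bullet> b) *\<^sub>R b) = y" "\<And>y. (norm y)\<^sup>2 = (\<Sum>b\<in>S. (y \<bullet> b)\<^sup>2)"
    "\<And>b c. b \<in> S \<Longrightarrow> c \<in> S \<Longrightarrow> b \<bullet> c = (if b = c then 1 else 0)"
proof -
  have S: "\<nu> \<in> S" "pairwise orthogonal S" "\<And>b. b \<in> S \<Longrightarrow> norm b = 1" "span S = UNIV"
    using assms by (auto simp: orthonormal_basis_through_def)
  have ind: "independent S"
    using S(2,3) by (intro pairwise_orthogonal_independent) force+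
  then have fin: "finite S" by (rule independent_imp_finite)
  have "card S = dim (UNIV :: 'a set)"
    using dim_span_eq_card_independent[OF ind] S(4) by simp
  moreover have inner: "b \<bullet> c = (if b = c then 1 else 0)" if "b \<in> S" "c \<in> S" for b c
    using S(2,3) that by (auto simp: pairwise_def orthogonal_def norm_eq_1)
  moreover have rep: "(\<Sum>b\<in>S. (y \<bullet> b) *\<^sub>R b) = y" for y
  proof -
    have "y \<in> span S" using S(4) by simp
    from orthonormal_basis_expand[of S, OF S(2) S(3) this fin]
    show ?thesis .
  qed
  moreover have "(norm y)\<^sup>2 = (\<Sum>b\<in>S. (y \<bullet> b)\<^sup>2)" for y
  proof -
    have "(norm y)\<^sup>2 = y \<bullet> (\<Sum>b\<in>S. (y \<bullet> b) *\<^sub>R b)" by (simp add: rep power2_norm_eq_inner)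
    also have "\<dots> = (\<Sum>b\<in>S. (y \<bullet> b)\<^sup>2)" by (simp add: inner_sum_right power2_eq_square)
    finally show ?thesis .
  qed
  ultimately show "\<nu> \<in> S" "finite S" "card S = DIM('a)" "independent S" "\<And>b. b \<in> S \<Longrightarrow> norm b = 1"
    "\<And>y. (\<Sum>b\<in>S. (y \<bullet> b) *\<^sub>R b) = y" "\<And>y. (norm y)\<^sup>2 = (\<Sum>b\<in>S. (y \<bullet> b)\<^sup>2)"
    "\<And>b c. b \<in> S \<Longrightarrow> c \<in> S \<Longrightarrow> b \<bullet> c = (if b = c then 1 else 0)"
    using S ind fin by auto
qed

lemma open_unit_cube: "finite S \<Longrightarrow> open (unit_cube S)"
proof -
  assume "finite S"
  moreover have "unit_cube S = (\<Inter>b\<in>S. {y. - 1/2 < y \<bullet> b} \<inter> {y. y \<bullet> b < 1/2})"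
    by (auto simp: unit_cube_def)
  ultimately show ?thesis
    by (auto intro!: open_INT open_Int open_Collect_less continuous_intros)
qed

lemma norm_unit_cube:
  fixes S :: "'a::euclidean_space set"
  assumes S: "orthonormal_basis_through \<nu> S" and y: "y \<in> unit_cube S"
  shows "norm y < real DIM('a)"
proof -
  note f = orthonormal_basis_facts[OF S]
  have "norm y \<le> (\<Sum>b\<in>S. norm ((y \<bullet> b) *\<^sub>R b))"
    using norm_sum[of "\<lambda>b. (y \<bullet> b) *\<^sub>R b" S] f(6)[of y] by simp
  also have "\<dots> \<le> (\<Sum>b\<in>S. 1 / 2)"
    using y f(5) by (intro sum_mono) (auto simp: unit_cube_def abs_le_iff less_imp_le)
  also have "\<dots> < real DIM('a)" using f(3) by simp
  finally show ?thesis .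
qed

lemma cube_at_subset_ball:
  fixes S :: "'a::euclidean_space set"
  assumes "orthonormal_basis_through \<nu> S" "0 < r"
  shows "cube_at S x r \<subseteq> ball x (real DIM('a) * r)"
  using norm_unit_cube[OF assms(1)] assms(2) by (auto simp: cube_at_def dist_norm)

lemma L1loc_imp_measurable:
  fixes f :: "real^'N \<Rightarrow> 'b::euclidean_space"
  assumes f: "L1loc U f" and U: "open U"
  shows "(\<lambda>x. indicat_real U x *\<^sub>R f x) \<in> borel_measurable lebesgue"
proof -
  obtain C where C: "\<And>n::nat. compact (C n)" "\<And>n. C n \<subseteq> U" "\<And>n. C n \<subseteq> interior (C (Suc n))" "(\<Union>n. C n) = U"
    using open_Union_compact_subsets[OF U] by (metis (no_types))
  have inc: "C n \<subseteq> C m" if "n \<le> m" for n m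
    using that C(3) interior_subset by (induction rule: dec_induct) blast+
  have "(\<lambda>n. indicat_real (C n) x *\<^sub>R f x) \<longlonglongrightarrow> indicat_real U x *\<^sub>R f x" for x
  proof (cases "x \<in> U")
    case True
    then obtain n where n: "x \<in> C n" using C(4) by auto
    have "eventually (\<lambda>m. indicat_real (C m) x *\<^sub>R f x = indicat_real U x *\<^sub>R f x) sequentially"
      using eventually_ge_at_top[of n] by eventually_elim (use n inc True in \<open>auto simp: indicator_def\<close>)
    then show ?thesis by (rule tendsto_eventually)
  next
    case False
    then have "indicat_real (C n) x = 0" for n using C(2) by (auto simp: indicator_def)
    then show ?thesis using False by simp
  qed
  moreover have "(\<lambda>x. indicat_real (C n) x *\<^sub>R f x) \<in> borel_measurable lebesgue" for n
    using L1loc_imp_set_integrable[OF f C(1,2)] by (simp add: set_integrable_def borel_measurable_integrable)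
  ultimately show ?thesis
    by (rule borel_measurable_LIMSEQ_metric[rotated])
qed

lemma powr_add_le:
  fixes a b p :: real
  assumes "0 \<le> a" "0 \<le> b" "1 \<le> p"
  shows "(a + b) powr p \<le> 2 powr p * (a powr p + b powr p)"
proof -
  have "(a + b) powr p \<le> (2 * max a b) powr p"
    using assms by (intro powr_mono2) auto
  also have "\<dots> = 2 powr p * (max a b) powr p"
    using assms by (simp add: powr_mult)
  also have "\<dots> \<le> 2 powr p * (a powr p + b powr p)"
    by (intro mult_left_mono) (auto simp: max_def)
  finally show ?thesis .
qed

lemma open_half_ball: "open (half_ball x \<nu> r)"
proof -
  have "half_ball x \<nu> r = ball x r \<inter> {y. 0 < (y - x) \<bullet> \<nu>}" by (auto simp: half_ball_def)
  then show ?thesis by (auto intro!: open_Int open_Collect_less continuous_intros)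
qed

text \<open>Dividing by \<open>r\<^sup>N\<close> instead of the volume of the half-ball gives bounds that can be compared with
those on other sets of size \<open>r\<close>.\<close>

lemma one_sided_approx_limitD:
  fixes v :: "real^'N \<Rightarrow> 'b::euclidean_space"
  assumes "one_sided_approx_limit v x \<nu> a" and "0 < e"
  shows "eventually (\<lambda>r. deviation v a (half_ball x \<nu> r) \<le> ennreal (e * r ^ CARD('N))) (at_right 0)"
proof -
  let ?B = "unit_ball_vol (real CARD('N))"
  have B: "0 < ?B" by (rule unit_ball_vol_pos) simp
  have gen: "ennreal (e / B) * ennreal (B * t) = ennreal (e * t)" if "0 < B" "0 \<le> t" for B t :: real
    using that assms(2) by (simp add: ennreal_mult[symmetric])
  have "eventually (\<lambda>r. deviation v a (half_ball x \<nu> r)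
             / emeasure lebesgue (half_ball x \<nu> r) < ennreal (e / ?B)) (at_right 0)"
    using assms B unfolding one_sided_approx_limit_def by (intro order_tendstoD) auto
  then show ?thesis
    using eventually_at_right_less[of 0]
  proof eventually_elim
    case (elim r)
    let ?m = "emeasure lebesgue (half_ball x \<nu> r)"
    let ?I = "deviation v a (half_ball x \<nu> r)"
    have "?m \<le> emeasure lebesgue (ball x r)" by (intro emeasure_mono) (auto simp: half_ball_def)
    also have "\<dots> = ennreal (?B * r ^ CARD('N))" using elim by (simp add: emeasure_ball)
    finally have m: "?m \<le> ennreal (?B * r ^ CARD('N))" .
    have fin: "?m \<noteq> top" using m by (auto simp: top_unique)
    have "?I \<le> ennreal (e / ?B) * ?m"
    proof (cases "?m = 0")
      case True
      have "half_ball x \<nu> r \<in> sets lebesgue" by (simp add: open_half_ball)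
      then have "half_ball x \<nu> r \<in> null_sets lebesgue" using True by auto
      then have "?I = 0" by (rule nn_integral_null_set)
      then show ?thesis by simp
    next
      case False
      have "?I = ?I / ?m * ?m" using False fin by (simp add: ennreal_divide_times ennreal_divide_self less_top)
      also have "\<dots> \<le> ennreal (e / ?B) * ?m" using elim(1) by (intro mult_right_mono) auto
      finally show ?thesis .
    qed
    also have "\<dots> \<le> ennreal (e / ?B) * ennreal (?B * r ^ CARD('N))" using m by (intro mult_left_mono) auto
    also have "\<dots> = ennreal (e * r ^ CARD('N))"
      using gen[OF B, of "r ^ CARD('N)"] elim by simp
    finally show ?case .
  qed
qed

text \<open>The one-sided limits only control the mean of \<open>\<bar>v - a\<bar>\<close>. As \<open>v\<close> is bounded, \<open>\<bar>v - a\<bar>\<^sup>p\<close> is at most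
a constant times \<open>\<bar>v - a\<bar>\<close>, so convergence of the blow-ups in the mean is convergence in \<open>L\<^sup>p\<close>.\<close>

lemma blow_up_converges:
  fixes v :: "real^'N \<Rightarrow> 'b::euclidean_space"
  assumes \<Omega>: "open \<Omega>" "x \<in> \<Omega>" and v: "set_integrable lebesgue \<Omega> v" and C: "AE x in lebesgue_on \<Omega>. norm (v x) \<le> C"
    and J: "jump_triple v x a b \<nu>" and S: "orthonormal_basis_through \<nu> S" and p: "1 \<le> p" and e: "0 < e"
  shows "eventually (\<lambda>r. blow_up_error p (unit_cube S) v x r a b \<nu> \<le> ennreal e) (at_right 0)"
proof -
  let ?N = "CARD('N)"
  let ?I = "\<lambda>\<nu> a r. deviation v a (half_ball x \<nu> r)"
  define K where "K = (\<bar>C\<bar> + norm a + norm b + 1) powr (p - 1)"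
  have K: "0 < K" by (simp add: K_def) (metis abs_ge_zero add_nonneg_nonneg add_nonneg_pos less_irrefl norm_ge_zero zero_less_one)
  define e' where "e' = e / (2 * K * real ?N ^ ?N)"
  have e': "0 < e'" using e K by (simp add: e'_def)
  have \<nu>: "norm \<nu> = 1" "one_sided_approx_limit v x \<nu> a" "one_sided_approx_limit v x (- \<nu>) b"
    using J by (auto simp: jump_triple_def)
  have scale: "filterlim (\<lambda>r. real ?N * r) (at_right 0) (at_right 0)"
    unfolding filterlim_at by (auto intro!: tendsto_eq_intros eventually_mono[OF eventually_at_right_less])
  obtain R where R: "R > 0" "ball x R \<subseteq> \<Omega>" using \<Omega> openE by blast
  have "eventually (\<lambda>r. real ?N * r < R) (at_right 0)"
  proof (rule order_tendstoD(2)[OF _ R(1)])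
    show "((\<lambda>r. real ?N * r) \<longlongrightarrow> 0) (at_right 0)" by (auto intro!: tendsto_eq_intros)
  qed
  with eventually_compose_filterlim[OF one_sided_approx_limitD[OF \<nu>(2) e'] scale]
    eventually_compose_filterlim[OF one_sided_approx_limitD[OF \<nu>(3) e'] scale]
  show ?thesis using eventually_at_right_less[of 0]
  proof eventually_elim
    case (elim r)
    let ?R = "real ?N * r"
    let ?f = "\<lambda>z. ennreal (norm (v z - jump_profile a b \<nu> (z - x)) powr p)"
    let ?A = "zoom x r ` unit_cube S"
    have r: "0 < r" using elim by simp
    have AB: "?A \<subseteq> ball x ?R" using cube_at_subset_ball[OF S r, of x] by (simp add: cube_at_def)
    have prof: "jump_profile a b \<nu> (x + r *\<^sub>R y - x) = jump_profile a b \<nu> y" for y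
      using r by (simp add: jump_profile_def zero_less_mult_iff)
    have m1: "(\<lambda>z. indicat_real \<Omega> z *\<^sub>R v z) \<in> borel_measurable lebesgue"
      using v by (simp add: set_integrable_def borel_measurable_integrable)
    have m: "(\<lambda>z. ennreal (norm (v z - c)) * indicator (half_ball x \<mu> ?R) z) \<in> borel_measurable lebesgue" for c \<mu>
    proof -
      have "half_ball x \<mu> ?R \<in> sets lebesgue" by (simp add: open_half_ball)
      then have "(\<lambda>z. ennreal (norm (indicat_real \<Omega> z *\<^sub>R v z - c)) * indicator (half_ball x \<mu> ?R) z) \<in> borel_measurable lebesgue"
        using m1 by (intro borel_measurable_times_ennreal measurable_compose[OF _ measurable_ennreal] borel_measurable_norm borel_measurable_diff borel_measurable_indicator) auto
      moreover have "half_ball x \<mu> ?R \<subseteq> \<Omega>" using R(2) elim by (auto simp: half_ball_def)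
      then have "ennreal (norm (indicat_real \<Omega> z *\<^sub>R v z - c)) * indicator (half_ball x \<mu> ?R) z = ennreal (norm (v z - c)) * indicator (half_ball x \<mu> ?R) z" for z
        by (auto simp: indicator_def)
      ultimately show ?thesis by simp
    qed
    have bd: "norm (v z - c) powr p \<le> K * norm (v z - c)" if "norm (v z) \<le> C" "c = a \<or> c = b" for z c
    proof (cases "v z = c")
      case False
      have "norm (v z - c) powr p = norm (v z - c) powr (p - 1) * norm (v z - c)"
        using False by (simp add: powr_diff)
      also have "norm (v z - c) powr (p - 1) \<le> K"
      proof -
        have c: "norm c \<le> norm a + norm b"
          using that(2) by (elim disjE) simp_all
        have "norm (v z - c) \<le> \<bar>C\<bar> + norm a + norm b + 1"
          using that(1) c norm_triangle_ineq4[of "v z" c] norm_ge_zero[of a] norm_ge_zero[of b] abs_ge_self[of C] by linarith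
        then show ?thesis
          unfolding K_def using p by (intro powr_mono2) auto
      qed
      finally show ?thesis by (simp add: mult_right_mono)
    qed (use p in simp)
    have plane: "AE z in lebesgue. (z - x) \<bullet> \<nu> \<noteq> 0"
    proof -
      have "negligible {z. \<nu> \<bullet> z = \<nu> \<bullet> x}"
        using \<nu>(1) by (intro negligible_hyperplane) auto
      then show ?thesis
        unfolding negligible_iff_null_sets
        by (rule AE_I') (auto simp: inner_diff_right inner_commute[of _ \<nu>])
    qed
    have CA: "AE z in lebesgue. z \<in> \<Omega> \<longrightarrow> norm (v z) \<le> C"
      using C \<Omega>(1) by (subst (asm) AE_restrict_space_iff) auto
    have le1: "blow_up_error p (unit_cube S) v x r a b \<nu>
        \<le> ennreal ((1 / r) ^ ?N) * (\<integral>\<^sup>+z\<in>?A. ?f z \<partial>lebesgue)"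
      using nn_integral_scaled_le[OF r, of ?f x "unit_cube S"] unfolding prof by simp
    have "(\<integral>\<^sup>+z\<in>?A. ?f z \<partial>lebesgue) \<le>
      (\<integral>\<^sup>+z. ennreal K * (ennreal (norm (v z - a)) * indicator (half_ball x \<nu> ?R) z + ennreal (norm (v z - b)) * indicator (half_ball x (- \<nu>) ?R) z) \<partial>lebesgue)"
    proof (rule nn_integral_mono_AE)
      show "AE z in lebesgue. ?f z * indicator ?A z \<le> ennreal K * (ennreal (norm (v z - a)) * indicator (half_ball x \<nu> ?R) z + ennreal (norm (v z - b)) * indicator (half_ball x (- \<nu>) ?R) z)"
        using plane CA
      proof eventually_elim
        case (elim z)
        show ?case
        proof (cases "z \<in> ?A")
          case True
          then have z0: "z \<in> ball x ?R" using AB by blast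
          moreover have "ball x ?R \<subseteq> \<Omega>" using R(2) \<open>?R < R\<close> by (auto simp: subset_eq)
          ultimately have z: "z \<in> ball x ?R" "z \<in> \<Omega>" "norm (v z) \<le> C" using elim(2) by blast+
          consider "(z - x) \<bullet> \<nu> > 0" | "(z - x) \<bullet> \<nu> < 0" using elim by linarith
          then show ?thesis
          proof cases
            case 1
            then have "jump_profile a b \<nu> (z - x) = a" "z \<in> half_ball x \<nu> ?R" "z \<notin> half_ball x (- \<nu>) ?R"
              using z by (auto simp: jump_profile_def half_ball_def inner_commute)
            then show ?thesis using True bd[OF z(3), of a] K by (simp add: ennreal_mult[symmetric] ennreal_leI)
          next
            case 2
            then have "jump_profile a b \<nu> (z - x) = b" "z \<notin> half_ball x \<nu> ?R" "z \<in> half_ball x (- \<nu>) ?R"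
              using z by (auto simp: jump_profile_def half_ball_def inner_commute)
            then show ?thesis using True bd[OF z(3), of b] K by (simp add: ennreal_mult[symmetric] ennreal_leI)
          qed
        qed simp
      qed
    qed
    also have "\<dots> = ennreal K * (?I \<nu> a ?R + ?I (- \<nu>) b ?R)"
      by (subst nn_integral_cmult nn_integral_add; (intro borel_measurable_add m)?)+ simp
    also have "\<dots> \<le> ennreal K * (ennreal (e' * ?R ^ ?N) + ennreal (e' * ?R ^ ?N))"
      using elim by (intro mult_left_mono add_mono) auto
    also have "\<dots> = ennreal (K * (2 * e' * ?R ^ ?N))"
      using K e' r by (simp add: ennreal_mult[symmetric] ennreal_plus[symmetric] del: ennreal_plus)
    finally have "ennreal ((1 / r) ^ ?N) * (\<integral>\<^sup>+z\<in>?A. ?f z \<partial>lebesgue)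
        \<le> ennreal ((1 / r) ^ ?N) * ennreal (K * (2 * e' * ?R ^ ?N))"
      by (intro mult_left_mono) auto
    also have "\<dots> = ennreal e"
      using K e' r by (simp add: ennreal_mult[symmetric] e'_def power_mult_distrib field_simps)
    finally show ?case using le1 by (rule order_trans[rotated])
  qed
qed

text \<open>The blow-up magnifies the distance of \<open>w\<close> and \<open>v\<close> by \<open>r\<^sup>-\<^sup>N\<close>; hence the parameter of the family
\<open>w\<close> has to be chosen after the scale \<open>r\<close>, and small in dependence on it.\<close>

lemma Lp_blow_up_le:
  fixes v w :: "real^'N \<Rightarrow> 'b::euclidean_space"
  assumes \<Omega>: "open \<Omega>" and v: "set_integrable lebesgue \<Omega> v" and w: "L1loc \<Omega> w" and r: "0 < r"
    and Q: "zoom x r ` Q \<subseteq> \<Omega>" "open Q" and p: "1 \<le> p" and d: "0 \<le> d"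
    and wv: "Lp_error p \<Omega> w v \<le> ennreal (r ^ CARD('N) * d)"
    and vp: "blow_up_error p Q v x r a b \<nu> \<le> ennreal d"
  shows "blow_up_error p Q w x r a b \<nu> \<le> ennreal (2 powr p * (2 * d))"
proof -
  let ?A = "\<lambda>y. x + r *\<^sub>R y"
  let ?f1 = "\<lambda>y. ennreal (norm (w (?A y) - v (?A y)) powr p) * indicator Q y"
  let ?f2 = "\<lambda>y. ennreal (norm (v (?A y) - jump_profile a b \<nu> y) powr p) * indicator Q y"
  have sQ: "Q \<in> sets lebesgue" using Q(2) by simp
  have mv: "(\<lambda>z. indicat_real \<Omega> z *\<^sub>R v z) \<in> borel_measurable lebesgue"
    using v by (simp add: set_integrable_def borel_measurable_integrable)
  note mA = measurable_scaled[OF r, of x]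
  have mvA: "(\<lambda>y. indicat_real \<Omega> (?A y) *\<^sub>R v (?A y)) \<in> borel_measurable lebesgue"
    using measurable_compose[OF mA mv] .
  have mwA: "(\<lambda>y. indicat_real \<Omega> (?A y) *\<^sub>R w (?A y)) \<in> borel_measurable lebesgue"
    using measurable_compose[OF mA L1loc_imp_measurable[OF w \<Omega>]] .
  have mp: "jump_profile a b \<nu> \<in> borel_measurable lebesgue"
  proof -
    have "open {y. 0 < \<nu> \<bullet> y}" by (intro open_Collect_less continuous_intros)
    then show ?thesis unfolding jump_profile_def by (intro measurable_If) auto
  qed
  have m1: "?f1 \<in> borel_measurable lebesgue"
  proof -
    have "(\<lambda>y. ennreal (norm (indicat_real \<Omega> (?A y) *\<^sub>R w (?A y) - indicat_real \<Omega> (?A y) *\<^sub>R v (?A y)) powr p) * indicator Q y) \<in> borel_measurable lebesgue"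
      using mvA mwA sQ by (intro borel_measurable_times_ennreal measurable_compose[OF _ measurable_ennreal] borel_measurable_norm borel_measurable_diff borel_measurable_indicator powr_real_measurable) auto
    moreover have "ennreal (norm (indicat_real \<Omega> (?A y) *\<^sub>R w (?A y) - indicat_real \<Omega> (?A y) *\<^sub>R v (?A y)) powr p) * indicator Q y = ?f1 y" for y
      using Q(1) by (cases "y \<in> Q") (auto simp: image_subset_iff)
    ultimately show ?thesis by simp
  qed
  have m2: "?f2 \<in> borel_measurable lebesgue"
  proof -
    have "(\<lambda>y. ennreal (norm (indicat_real \<Omega> (?A y) *\<^sub>R v (?A y) - jump_profile a b \<nu> y) powr p) * indicator Q y) \<in> borel_measurable lebesgue"
      using mvA mp sQ by (intro borel_measurable_times_ennreal measurable_compose[OF _ measurable_ennreal] borel_measurable_norm borel_measurable_diff borel_measurable_indicator powr_real_measurable) auto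
    moreover have "ennreal (norm (indicat_real \<Omega> (?A y) *\<^sub>R v (?A y) - jump_profile a b \<nu> y) powr p) * indicator Q y = ?f2 y" for y
      using Q(1) by (cases "y \<in> Q") (auto simp: image_subset_iff)
    ultimately show ?thesis by simp
  qed
  have i1: "integral\<^sup>N lebesgue ?f1 \<le> ennreal d"
  proof -
    have "integral\<^sup>N lebesgue ?f1 \<le> ennreal ((1 / r) ^ CARD('N)) * (\<integral>\<^sup>+z\<in>?A ` Q. ennreal (norm (w z - v z) powr p) \<partial>lebesgue)"
      using nn_integral_scaled_le[OF r, of "\<lambda>z. ennreal (norm (w z - v z) powr p)" x Q] by simp
    also have "\<dots> \<le> ennreal ((1 / r) ^ CARD('N)) * ennreal (r ^ CARD('N) * d)"
      using Q(1) by (intro mult_left_mono order_trans[OF nn_integral_mono wv]) (auto simp: indicator_def)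
    also have "\<dots> = ennreal d"
      using r d by (simp add: ennreal_mult[symmetric] power_divide)
    finally show ?thesis .
  qed
  have "(\<integral>\<^sup>+y\<in>Q. ennreal (norm (w (?A y) - jump_profile a b \<nu> y) powr p) \<partial>lebesgue) \<le> (\<integral>\<^sup>+y. ennreal (2 powr p) * (?f1 y + ?f2 y) \<partial>lebesgue)"
  proof (rule nn_integral_mono)
    fix y
    have "norm (w (?A y) - jump_profile a b \<nu> y) powr p \<le> (norm (w (?A y) - v (?A y)) + norm (v (?A y) - jump_profile a b \<nu> y)) powr p"
      using p norm_triangle_ineq[of "w (?A y) - v (?A y)" "v (?A y) - jump_profile a b \<nu> y"] by (intro powr_mono2) auto
    also have "\<dots> \<le> 2 powr p * (norm (w (?A y) - v (?A y)) powr p + norm (v (?A y) - jump_profile a b \<nu> y) powr p)"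
      using p by (intro powr_add_le) auto
    finally have "ennreal (norm (w (?A y) - jump_profile a b \<nu> y) powr p) \<le> ennreal (2 powr p) * (ennreal (norm (w (?A y) - v (?A y)) powr p) + ennreal (norm (v (?A y) - jump_profile a b \<nu> y) powr p))"
      by (simp add: ennreal_mult[symmetric] ennreal_plus[symmetric] ennreal_leI del: ennreal_plus)
    then show "ennreal (norm (w (?A y) - jump_profile a b \<nu> y) powr p) * indicator Q y \<le> ennreal (2 powr p) * (?f1 y + ?f2 y)"
      by (cases "y \<in> Q") auto
  qed
  also have "\<dots> = ennreal (2 powr p) * (integral\<^sup>N lebesgue ?f1 + integral\<^sup>N lebesgue ?f2)"
    using m1 m2 by (simp add: nn_integral_cmult nn_integral_add)
  also have "\<dots> \<le> ennreal (2 powr p) * (ennreal d + ennreal d)"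
    using i1 vp by (intro mult_left_mono add_mono) auto
  also have "\<dots> = ennreal (2 powr p * (2 * d))"
    using d by (simp add: ennreal_mult[symmetric] ennreal_plus[symmetric] del: ennreal_plus)
  finally show ?thesis .
qed

lemma Liminf_le_if_frequently_le:
  fixes f :: "'a \<Rightarrow> ennreal"
  assumes "frequently (\<lambda>x. f x \<le> c) G"
  shows "Liminf G f \<le> c"
proof (rule ccontr)
  assume "\<not> Liminf G f \<le> c"
  then have "c < Liminf G f" by simp
  then have "eventually (\<lambda>x. c < f x) G" by (rule less_LiminfD)
  then have "\<not> frequently (\<lambda>x. f x \<le> c) G"
    unfolding frequently_def by (simp add: not_le)
  then show False using assms by simp
qed

text \<open>If the estimate failed at arbitrarily small scales, one could choose scales \<open>\<rho> k \<rightarrow> 0\<close> and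
parameters \<open>\<tau> k\<close>, so small that both \<open>\<tau> k / \<rho> k\<close> and the \<open>L\<^sup>p\<close> distance of the blow-up of
\<open>w (\<tau> k)\<close> from the jump profile tend to zero, at which the energy is at most \<open>c (\<rho> k)\<^sup>N\<^sup>-\<^sup>1\<close>. The
blow-ups then form an admissible competitor in the infimum \<open>E_abst\<close>, of energy at most \<open>c\<close>.\<close>

lemma eventually_energy_ge_E_abst:
  fixes F :: "('N list \<Rightarrow> ('N::finite, 'k::finite, 'd::finite, 'm::finite) state) \<Rightarrow> real"
    and v :: "real^'N \<Rightarrow> ('N, 'k, 'd, 'm) state"
  assumes \<Omega>: "open \<Omega>" "x \<in> \<Omega>" and v: "set_integrable lebesgue \<Omega> v" and C: "AE x in lebesgue_on \<Omega>. norm (v x) \<le> C"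
    and J: "jump_triple v x a b \<nu>" and S: "orthonormal_basis_through \<nu> S" and p: "1 \<le> p"
    and w: "\<And>\<epsilon>. \<epsilon> > 0 \<Longrightarrow> class_B \<Omega> (w \<epsilon>) \<and> W1loc n \<Omega> (w \<epsilon>)" and wv: "Lp_tendsto p \<Omega> w v"
    and c: "c < E_abst n F p S a b \<nu>"
  shows "\<exists>R>0. \<forall>r. 0 < r \<and> r < R \<longrightarrow> cube_at S x r \<subseteq> \<Omega> \<and>
    eventually (\<lambda>\<epsilon>. c * ennreal (r ^ (CARD('N) - 1)) \<le>
      local_energy n F \<Omega> \<epsilon> (w \<epsilon>) (cube_at S x r)) (at_right 0)"
proof (rule ccontr)
  assume contra: "\<not> ?thesis"
  let ?N = "CARD('N)" and ?Q = "unit_cube S"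
  let ?e = "\<lambda>\<epsilon> r. local_energy n F \<Omega> \<epsilon> (w \<epsilon>) (cube_at S x r)"
  have oQ: "open ?Q" using orthonormal_basis_facts(2)[OF S] by (rule open_unit_cube)
  obtain R0 where R0: "R0 > 0" "ball x R0 \<subseteq> \<Omega>" using \<Omega> openE by blast
  have cube: "cube_at S x r \<subseteq> \<Omega>" if "0 < r" "r < R0 / real ?N" for r
  proof -
    have "cube_at S x r \<subseteq> ball x (real ?N * r)" using cube_at_subset_ball[OF S that(1)] by simp
    also have "\<dots> \<subseteq> ball x R0" using that by (intro subset_ball) (simp add: field_simps)
    finally show ?thesis using R0(2) by blast
  qed
  \<comment> \<open>a scale and a parameter at which the estimate fails and the blow-up is admissible up to an error
    \<open>1 / (k + 1)\<close>\<close>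
  define good where "good k r \<epsilon> \<longleftrightarrow> 0 < r \<and> 0 < \<epsilon> \<and> cube_at S x r \<subseteq> \<Omega> \<and> \<epsilon> / r < 1 / real (Suc k) \<and>
      blow_up_error p ?Q v x r a b \<nu> \<le> ennreal (1 / real (Suc k)) \<and>
      Lp_error p \<Omega> (w \<epsilon>) v \<le> ennreal (r ^ ?N * (1 / real (Suc k))) \<and>
      ?e \<epsilon> r \<le> c * ennreal (r ^ (?N - 1))" for k r \<epsilon>
  have "\<exists>r \<epsilon>. good k r \<epsilon>" for k
  proof -
    have "eventually (\<lambda>r. blow_up_error p ?Q v x r a b \<nu> \<le> ennreal (1 / real (Suc k))) (at_right 0)"
      by (rule blow_up_converges[OF \<Omega> v C J S p]) simp
    then obtain R1 where R1: "R1 > 0" "\<And>r. 0 < r \<Longrightarrow> r < R1 \<Longrightarrow>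
        blow_up_error p ?Q v x r a b \<nu> \<le> ennreal (1 / real (Suc k))"
      unfolding eventually_at_right_field by blast
    have "min (R0 / real ?N) R1 > 0" using R0(1) R1(1) by simp
    with contra obtain r where r: "0 < r" "r < min (R0 / real ?N) R1"
      "\<not> (cube_at S x r \<subseteq> \<Omega> \<and> eventually (\<lambda>\<epsilon>. c * ennreal (r ^ (?N - 1)) \<le> ?e \<epsilon> r) (at_right 0))"
      by blast
    have cr: "cube_at S x r \<subseteq> \<Omega>" using cube r(1,2) by simp
    with r(3) have fr: "frequently (\<lambda>\<epsilon>. \<not> c * ennreal (r ^ (?N - 1)) \<le> ?e \<epsilon> r) (at_right 0)"
      by (simp add: not_eventually)
    have "eventually (\<lambda>\<epsilon>. Lp_error p \<Omega> (w \<epsilon>) v < ennreal (r ^ ?N * (1 / real (Suc k)))) (at_right 0)"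
      using wv r(1) unfolding Lp_tendsto_def by (intro order_tendstoD(2)) auto
    moreover have "eventually (\<lambda>\<epsilon>::real. \<epsilon> < r / real (Suc k)) (at_right 0)"
      using r(1) by (intro order_tendstoD(2)[OF tendsto_ident_at]) auto
    moreover have "eventually (\<lambda>\<epsilon>::real. 0 < \<epsilon>) (at_right 0)"
      by (rule eventually_at_right_less)
    ultimately have "eventually (\<lambda>\<epsilon>. 0 < \<epsilon> \<and> \<epsilon> < r / real (Suc k) \<and> Lp_error p \<Omega> (w \<epsilon>) v < ennreal (r ^ ?N * (1 / real (Suc k)))) (at_right 0)"
      by eventually_elim auto
    from frequently_eventually_frequently[OF fr this, THEN frequently_ex]
    obtain \<epsilon> where "0 < \<epsilon>" "\<epsilon> < r / real (Suc k)" "Lp_error p \<Omega> (w \<epsilon>) v < ennreal (r ^ ?N * (1 / real (Suc k)))"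
       "\<not> c * ennreal (r ^ (?N - 1)) \<le> ?e \<epsilon> r"
      by blast
    then show ?thesis
      unfolding good_def using r(1,2) cr R1(2)[of r]
      by (intro exI[of _ r] exI[of _ \<epsilon>]) (auto simp: field_simps less_imp_le)
  qed
  then obtain \<rho> \<tau> where "\<And>k. good k (\<rho> k) (\<tau> k)" by metis
  note P' = this[unfolded good_def]
  have P: "0 < \<rho> k" "0 < \<tau> k" "cube_at S x (\<rho> k) \<subseteq> \<Omega>" "\<tau> k / \<rho> k < 1 / real (Suc k)"
      "blow_up_error p ?Q v x (\<rho> k) a b \<nu> \<le> ennreal (1 / real (Suc k))"
      "Lp_error p \<Omega> (w (\<tau> k)) v \<le> ennreal (\<rho> k ^ ?N * (1 / real (Suc k)))"
      "?e (\<tau> k) (\<rho> k) \<le> c * ennreal (\<rho> k ^ (?N - 1))" for k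
    using P'[of k] by blast+
  define \<delta> where "\<delta> k = \<tau> k / \<rho> k" for k
  define Z where "Z k = (\<lambda>y. w (\<tau> k) (x + \<rho> k *\<^sub>R y))" for k
  have sub: "(\<lambda>y. x + \<rho> k *\<^sub>R y) ` ?Q \<subseteq> \<Omega>" for k using P(3)[of k] by (simp add: cube_at_def)
  have \<delta>: "0 < \<delta> k" "\<delta> k < 1 / real (Suc k)" for k using P(1,2,4)[of k] by (auto simp: \<delta>_def)
  have Z: "class_B ?Q (Z k)" "W1loc n ?Q (Z k)" for k
    unfolding Z_def using class_B_scaled[OF P(1) _ sub] W1loc_scaled[OF P(1) _ sub] w[OF P(2)] by blast+
  have ZE: "energy n F ?Q (\<delta> k) (Z k) \<le> c" for k
  proof -
    have "energy n F ?Q (\<delta> k) (Z k) \<le> ennreal (\<rho> k * (1 / \<rho> k) ^ ?N) * ?e (\<tau> k) (\<rho> k)"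
      unfolding Z_def \<delta>_def cube_at_def using w[OF P(2)] by (intro energy_scaled_le P(1,2) sub oQ) auto
    also have "\<dots> \<le> ennreal (\<rho> k * (1 / \<rho> k) ^ ?N) * (c * ennreal (\<rho> k ^ (?N - 1)))"
      by (intro mult_left_mono P(7)) simp
    also have "\<dots> = c * ennreal (\<rho> k * (1 / \<rho> k) ^ ?N * \<rho> k ^ (?N - 1))"
      using P(1)[of k] by (simp add: ennreal_mult mult_ac)
    also have "\<rho> k * (1 / \<rho> k) ^ ?N * \<rho> k ^ (?N - 1) = 1"
    proof -
      have "\<rho> k * \<rho> k ^ (?N - 1) = \<rho> k ^ ?N"
        using power_Suc[of "\<rho> k" "?N - 1"] by simp
      then show ?thesis using P(1)[of k] by (simp add: power_divide)
    qed
    finally show ?thesis by simp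
  qed
  have ZL: "Lp_error p ?Q (Z k) (jump_profile a b \<nu>) \<le> ennreal (2 powr p * (2 * (1 / real (Suc k))))" for k
    unfolding Z_def
  proof (rule Lp_blow_up_le[OF \<Omega>(1) v _ P(1) sub oQ p _ P(6,5)])
    show "L1loc \<Omega> (w (\<tau> k))" using w[OF P(2)[of k]] by (auto simp: class_B_def)
  qed simp
  \<comment> \<open>A competitor is a family indexed by all \<open>\<epsilon> > 0\<close>. The energy bound is available at the parameters
    \<open>\<delta> k\<close> only, which is enough for a limes inferior; any other \<open>\<epsilon>\<close> gets the index \<open>\<lfloor>1/\<epsilon>\<rfloor>\<close>, which
    tends to infinity and so keeps the convergence.\<close>
  define \<kappa> where "\<kappa> \<epsilon> = (if \<epsilon> \<in> range \<delta> then (SOME k. \<delta> k = \<epsilon>) else nat \<lfloor>1 / \<epsilon>\<rfloor>)" for \<epsilon> :: real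
  have \<kappa>\<delta>: "\<delta> (\<kappa> (\<delta> k)) = \<delta> k" for k
    unfolding \<kappa>_def by (simp, rule someI[of "\<lambda>j. \<delta> j = \<delta> k" k]) simp
  have \<kappa>lim: "filterlim \<kappa> at_top (at_right 0)"
    unfolding filterlim_at_top
  proof
    fix K
    define m where "m = Min (insert (1 / real (Suc K)) (\<delta> ` {..K}))"
    have m: "0 < m" unfolding m_def using \<delta>(1) by (subst Min_gr_iff) auto
    have "K \<le> \<kappa> \<epsilon>" if e: "0 < \<epsilon>" "\<epsilon> < m" for \<epsilon>
    proof (cases "\<epsilon> \<in> range \<delta>")
      case True
      then have "\<delta> (\<kappa> \<epsilon>) = \<epsilon>" using \<kappa>\<delta> by auto
      then have "\<delta> (\<kappa> \<epsilon>) < m" using e by simp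
      moreover have "m \<le> \<delta> j" if "j \<le> K" for j unfolding m_def using that by (intro Min_le) auto
      ultimately show ?thesis by (meson not_le less_imp_le)
    next
      case False
      have "m \<le> 1 / real (Suc K)" unfolding m_def by (intro Min_le) auto
      then have "\<epsilon> < 1 / real (Suc K)" using e by simp
      then have "real (Suc K) \<le> 1 / \<epsilon>" using e(1) by (simp add: field_simps)
      then have "int (Suc K) \<le> \<lfloor>1 / \<epsilon>\<rfloor>" by (simp add: le_floor_iff)
      then have "Suc K \<le> nat \<lfloor>1 / \<epsilon>\<rfloor>" by linarith
      then show ?thesis using False by (simp add: \<kappa>_def)
    qed
    then show "eventually (\<lambda>\<epsilon>. K \<le> \<kappa> \<epsilon>) (at_right 0)"
      unfolding eventually_at_right_field using m by blast
  qed
  define \<zeta> where "\<zeta> \<epsilon> = Z (\<kappa> \<epsilon>)" for \<epsilon>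
  have "Lp_tendsto p ?Q \<zeta> (jump_profile a b \<nu>)"
    unfolding Lp_tendsto_def
  proof (rule tendsto_sandwich[OF _ _ tendsto_const])
    show "eventually (\<lambda>\<epsilon>. 0 \<le> Lp_error p ?Q (\<zeta> \<epsilon>) (jump_profile a b \<nu>)) (at_right 0)" by simp
    show "eventually (\<lambda>\<epsilon>. Lp_error p ?Q (\<zeta> \<epsilon>) (jump_profile a b \<nu>)
        \<le> ennreal (2 powr p * (2 * (1 / real (Suc (\<kappa> \<epsilon>)))))) (at_right 0)"
      unfolding \<zeta>_def using ZL by simp
    have "((\<lambda>k. 2 powr p * (2 * (1 / real (Suc k)))) \<longlongrightarrow> 2 powr p * (2 * 0)) sequentially"
      by (intro tendsto_intros LIMSEQ_Suc[OF lim_1_over_n])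
    then have "((\<lambda>k. ennreal (2 powr p * (2 * (1 / real (Suc k))))) \<longlongrightarrow> ennreal 0) sequentially"
      by (intro tendsto_ennrealI) simp
    from filterlim_compose[OF this \<kappa>lim]
    show "((\<lambda>\<epsilon>. ennreal (2 powr p * (2 * (1 / real (Suc (\<kappa> \<epsilon>)))))) \<longlongrightarrow> 0) (at_right 0)" by simp
  qed
  then have "E_abst n F p S a b \<nu> \<le> Liminf (at_right 0) (\<lambda>\<epsilon>. energy n F ?Q \<epsilon> (\<zeta> \<epsilon>))"
    unfolding E_abst_def
    by (intro INF_lower CollectI conjI allI impI; (assumption | simp add: \<zeta>_def Z))
  also have "\<dots> \<le> c"
  proof (rule Liminf_le_if_frequently_le)
    show "frequently (\<lambda>\<epsilon>. energy n F ?Q \<epsilon> (\<zeta> \<epsilon>) \<le> c) (at_right 0)"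
      unfolding frequently_def eventually_at_right_field
    proof
      assume "\<exists>b>0. \<forall>y>0. y < b \<longrightarrow> \<not> energy n F ?Q y (\<zeta> y) \<le> c"
      then obtain d where d: "d > 0" "\<And>y. 0 < y \<Longrightarrow> y < d \<Longrightarrow> \<not> energy n F ?Q y (\<zeta> y) \<le> c" by blast
      obtain k where k: "1 / real (Suc k) < d" using d(1) reals_Archimedean inverse_eq_divide by metis
      have "energy n F ?Q (\<delta> k) (\<zeta> (\<delta> k)) \<le> c"
        using ZE[of "\<kappa> (\<delta> k)"] by (simp add: \<kappa>\<delta> \<zeta>_def)
      moreover have "\<delta> k < d" using \<delta>(2)[of k] k by linarith
      ultimately show False using d(2)[of "\<delta> k"] \<delta>(1) by blast
    qed
  qed
  finally show False using c by simp
qed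


section \<open>Hausdorff measure\<close>

lemma hausdorff_outer_mono:
  fixes A B :: "'a::metric_space set"
  shows "A \<subseteq> B \<Longrightarrow> hausdorff_outer s A \<le> hausdorff_outer s B"
  unfolding hausdorff_outer_def by (intro SUP_mono' hausdorff_pre_mono)

lemma hausdorff_outer_empty: "hausdorff_outer s ({} :: 'a::metric_space set) = 0"
  using outer_measure_space_hausdorff[of s, where 'a='a] by (simp add: outer_measure_space_def positive_def)

lemma hausdorff_outer_UN:
  fixes A :: "nat \<Rightarrow> 'a::metric_space set"
  shows "hausdorff_outer s (\<Union>i. A i) \<le> (\<Sum>i. hausdorff_outer s (A i))"
proof -
  have "hausdorff_outer s (\<Union>i. disjointed A i) \<le> (\<Sum>i. hausdorff_outer s (disjointed A i))"
    using outer_measure_space_hausdorff[of s, where 'a='a] disjoint_family_disjointed[of A]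
    by (simp add: outer_measure_space_def countably_subadditive_def)
  also have "\<dots> \<le> (\<Sum>i. hausdorff_outer s (A i))"
    by (intro suminf_le summableI hausdorff_outer_mono disjointed_subset)
  finally show ?thesis by (simp add: UN_disjointed_eq)
qed

lemma hausdorff_outer_Un: "hausdorff_outer s (A \<union> B) \<le> hausdorff_outer s A + hausdorff_outer s B"
  for A B :: "'a::metric_space set"
proof -
  have "hausdorff_outer s (\<Union>i. binaryset A B i) \<le> (\<Sum>i. hausdorff_outer s (binaryset A B i))"
    by (rule hausdorff_outer_UN)
  then show ?thesis
    using suminf_binaryset_eq[of "hausdorff_outer s" A B] hausdorff_outer_empty[of s, where 'a='a]
    by (simp add: UN_binaryset_eq)
qed

lemma hausdorff_pre_Un:
  fixes A B :: "'a::metric_space set"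
  assumes "0 < \<delta>"
  shows "hausdorff_pre s \<delta> (A \<union> B) \<le> hausdorff_pre s \<delta> A + hausdorff_pre s \<delta> B"
proof -
  have "hausdorff_pre s \<delta> (\<Union>i. binaryset A B i) \<le> (\<Sum>i. hausdorff_pre s \<delta> (binaryset A B i))"
    by (rule hausdorff_pre_UN)
  then show ?thesis
    using suminf_binaryset_eq[of "hausdorff_pre s \<delta>" A B] hausdorff_pre_empty[OF assms, of s, where 'a='a]
    by (simp add: UN_binaryset_eq)
qed

lemma hausdorff_pre_antimono: "\<delta> \<le> \<delta>' \<Longrightarrow> hausdorff_pre s \<delta>' A \<le> hausdorff_pre s \<delta> A"
  unfolding hausdorff_pre_def by (rule INF_superset_mono) (auto intro: order_trans)

text \<open>Covering sets of diameter below the distance of \<open>A\<close> and \<open>B\<close> meet at most one of them, so a cover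
of the union splits into covers of \<open>A\<close> and of \<open>B\<close>.\<close>

lemma hausdorff_pre_separated:
  fixes A B :: "'a::metric_space set"
  assumes sep: "\<And>x y. x \<in> A \<Longrightarrow> y \<in> B \<Longrightarrow> \<delta> < dist x y" and \<delta>: "0 < \<delta>"
  shows "hausdorff_pre s \<delta> A + hausdorff_pre s \<delta> B \<le> hausdorff_pre s \<delta> (A \<union> B)"
  unfolding hausdorff_pre_def[of s \<delta> "A \<union> B"]
proof (rule INF_greatest)
  fix C :: "nat \<Rightarrow> 'a set"
  assume "C \<in> {C. A \<union> B \<subseteq> (\<Union>i. C i) \<and> (\<forall>i. bounded (C i) \<and> diameter (C i) \<le> \<delta>)}"
  then have C: "A \<union> B \<subseteq> (\<Union>i. C i)" "\<And>i. bounded (C i)" "\<And>i. diameter (C i) \<le> \<delta>" by auto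
  define CA where "CA i = (if C i \<inter> A = {} then {} else C i)" for i
  define CB where "CB i = (if C i \<inter> B = {} then {} else C i)" for i
  have d: "C i \<inter> A = {} \<or> C i \<inter> B = {}" for i
  proof (rule ccontr)
    assume "\<not> ?thesis"
    then obtain x y where "x \<in> C i" "x \<in> A" "y \<in> C i" "y \<in> B" by auto
    then show False using sep[of x y] diameter_bounded_bound[OF C(2), of x i y] C(3)[of i] by auto
  qed
  have "hausdorff_pre s \<delta> A \<le> (\<Sum>i. hausdorff_weight s (CA i))"
    unfolding hausdorff_pre_def
    by (rule INF_lower) (use C \<delta> in \<open>auto simp: CA_def, blast\<close>)
  moreover have "hausdorff_pre s \<delta> B \<le> (\<Sum>i. hausdorff_weight s (CB i))"
    unfolding hausdorff_pre_def
    by (rule INF_lower) (use C \<delta> in \<open>auto simp: CB_def, blast\<close>)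
  ultimately have "hausdorff_pre s \<delta> A + hausdorff_pre s \<delta> B \<le> (\<Sum>i. hausdorff_weight s (CA i) + hausdorff_weight s (CB i))"
    by (subst suminf_add[symmetric]) (auto intro: add_mono)
  also have "\<dots> \<le> (\<Sum>i. hausdorff_weight s (C i))"
    using d by (intro suminf_le summableI) (auto simp: CA_def CB_def hausdorff_weight_def)
  finally show "hausdorff_pre s \<delta> A + hausdorff_pre s \<delta> B \<le> (\<Sum>i. hausdorff_weight s (C i))" .
qed

lemma ennreal_SUP_add_le:
  fixes f :: "'i \<Rightarrow> ennreal" and g :: "'j \<Rightarrow> ennreal"
  assumes "\<And>i j. i \<in> I \<Longrightarrow> j \<in> J \<Longrightarrow> f i + g j \<le> c" "I \<noteq> {}" "J \<noteq> {}"
  shows "(SUP i\<in>I. f i) + (SUP j\<in>J. g j) \<le> c"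
proof -
  have "(SUP i\<in>I. f i) + g j \<le> c" if "j \<in> J" for j
    using assms(1)[OF _ that] assms(2) by (subst ennreal_SUP_add_left[symmetric]) (auto intro: SUP_least)
  then show ?thesis
    using assms(3) by (simp add: ennreal_SUP_add_right SUP_least)
qed

text \<open>Hausdorff outer measure is a metric outer measure.\<close>

lemma hausdorff_outer_separated:
  fixes A B :: "'a::metric_space set"
  assumes sep: "\<And>x y. x \<in> A \<Longrightarrow> y \<in> B \<Longrightarrow> d \<le> dist x y" and d: "0 < d"
  shows "hausdorff_outer s A + hausdorff_outer s B \<le> hausdorff_outer s (A \<union> B)"
proof -
  let ?D = "{0<..<d}"
  have eq: "hausdorff_outer s X = (SUP \<delta>\<in>?D. hausdorff_pre s \<delta> X)" for X :: "'a set"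
    unfolding hausdorff_outer_def
  proof (rule antisym)
    show "(SUP \<delta>\<in>{0<..}. hausdorff_pre s \<delta> X) \<le> (SUP \<delta>\<in>?D. hausdorff_pre s \<delta> X)"
    proof (rule SUP_mono)
      fix \<delta> :: real assume "\<delta> \<in> {0<..}"
      then show "\<exists>m\<in>?D. hausdorff_pre s \<delta> X \<le> hausdorff_pre s m X"
        using d by (intro bexI[of _ "min \<delta> (d/2)"] hausdorff_pre_antimono) auto
    qed
    show "(SUP \<delta>\<in>?D. hausdorff_pre s \<delta> X) \<le> (SUP \<delta>\<in>{0<..}. hausdorff_pre s \<delta> X)"
      by (rule SUP_subset_mono) auto
  qed
  have "hausdorff_outer s A + hausdorff_outer s B \<le> (SUP \<delta>\<in>?D. hausdorff_pre s \<delta> (A \<union> B))"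
    unfolding eq[of A] eq[of B]
  proof (rule ennreal_SUP_add_le)
    fix i j assume ij: "i \<in> ?D" "j \<in> ?D"
    have "hausdorff_pre s i A + hausdorff_pre s j B \<le> hausdorff_pre s (min i j) A + hausdorff_pre s (min i j) B"
      by (intro add_mono hausdorff_pre_antimono) auto
    also have "\<dots> \<le> hausdorff_pre s (min i j) (A \<union> B)"
    proof (rule hausdorff_pre_separated)
      fix x y assume "x \<in> A" "y \<in> B"
      then show "min i j < dist x y" using sep[of x y] ij by (auto simp: min_def)
    qed (use ij in auto)
    also have "\<dots> \<le> (SUP \<delta>\<in>?D. hausdorff_pre s \<delta> (A \<union> B))"
      using ij by (intro SUP_upper) auto
    finally show "hausdorff_pre s i A + hausdorff_pre s j B \<le> (SUP \<delta>\<in>?D. hausdorff_pre s \<delta> (A \<union> B))" .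
  qed (use d in auto)
  then show ?thesis unfolding eq .
qed

text \<open>This is Caratheodory's criterion for metric outer measures. The part \<open>A - C\<close> is the union of the
sets \<open>B k\<close> of points at distance at least \<open>1 / (k + 1)\<close> from \<open>C\<close>, and the measure of \<open>A - C - B k\<close>
has to tend to zero. It consists of the layers \<open>R i\<close> with \<open>i \<ge> k\<close>. Layers whose indices have the
same parity are separated from each other, hence additive, so the sum of the measures of all
layers is at most twice the measure of \<open>A\<close>, and its tails tend to zero.\<close>

lemma closed_in_sets_hausdorff:
  fixes C :: "'a::metric_space set"
  assumes "closed C"
  shows "C \<in> sets (hausdorff_measure s)"
proof (cases "C = {}")
  case False
  have key: "hausdorff_outer s (A \<inter> C) + hausdorff_outer s (A - C) \<le> hausdorff_outer s A" for A
  proof (cases "hausdorff_outer s A = top")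
    case False
    let ?h = "hausdorff_outer s :: 'a set \<Rightarrow> ennreal"
    define B where "B k = {x \<in> A. 1 / real (Suc k) \<le> infdist x C}" for k
    define R where "R k = {x \<in> A. 1 / real (Suc (Suc k)) \<le> infdist x C \<and> infdist x C < 1 / real (Suc k)}" for k
    have RA: "R k \<subseteq> A" "B k \<subseteq> A" for k by (auto simp: R_def B_def)
    have sepR: "(\<Sum>i<n. ?h (R (2 * i + p))) \<le> ?h (\<Union>i<n. R (2 * i + p))" for n p
    proof (induction n)
      case (Suc n)
      show ?case
      proof (cases "n = 0")
        case n0: False
        have "(\<Sum>i<Suc n. ?h (R (2 * i + p))) \<le> ?h (\<Union>i<n. R (2 * i + p)) + ?h (R (2 * n + p))"
          using Suc by (simp add: add_right_mono)
        also have "\<dots> \<le> ?h ((\<Union>i<n. R (2 * i + p)) \<union> R (2 * n + p))"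
        \<comment> \<open>between \<open>R (2 * i + p)\<close> with \<open>i < n\<close> and \<open>R (2 * n + p)\<close> lies the layer \<open>R (2 * n + p - 1)\<close>\<close>
        proof (rule hausdorff_outer_separated[where d="1 / real (2 * n + p) - 1 / real (Suc (2 * n + p))"])
          fix x y assume x: "x \<in> (\<Union>i<n. R (2 * i + p))" and y: "y \<in> R (2 * n + p)"
          then obtain i where i: "i < n" "x \<in> R (2 * i + p)" by auto
          have "1 / real (2 * n + p) \<le> 1 / real (Suc (Suc (2 * i + p)))"
            using i(1) by (intro divide_left_mono) auto
          also have "\<dots> \<le> infdist x C" using i(2) by (simp add: R_def)
          also have "\<dots> \<le> infdist y C + dist x y" by (rule infdist_triangle)
          also have "infdist y C < 1 / real (Suc (2 * n + p))" using y by (simp add: R_def)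
          finally show "1 / real (2 * n + p) - 1 / real (Suc (2 * n + p)) \<le> dist x y" by simp
        next
          show "0 < 1 / real (2 * n + p) - 1 / real (Suc (2 * n + p))"
            using n0 by (auto intro!: divide_strict_left_mono)
        qed
        also have "(\<Union>i<n. R (2 * i + p)) \<union> R (2 * n + p) = (\<Union>i<Suc n. R (2 * i + p))"
          by (auto simp: lessThan_Suc)
        finally show ?thesis .
      qed (simp add: hausdorff_outer_empty lessThan_Suc)
    qed (simp add: hausdorff_outer_empty)
    have "(\<Sum>i<2 * n. ?h (R i)) = (\<Sum>i<n. ?h (R (2 * i + 0))) + (\<Sum>i<n. ?h (R (2 * i + 1)))" for n
      by (induction n) (auto simp: add_ac)
    moreover have "(\<Sum>i<n. ?h (R (2 * i + p))) \<le> ?h A" for n p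
      using RA by (intro order_trans[OF sepR hausdorff_outer_mono]) auto
    ultimately have sum2: "(\<Sum>i<2 * n. ?h (R i)) \<le> ?h A + ?h A" for n
      by (simp only: add_mono)
    have "(\<Sum>i. ?h (R i)) \<le> ?h A + ?h A"
      unfolding suminf_eq_SUP
    proof (rule SUP_least)
      fix n
      have "(\<Sum>i<n. ?h (R i)) \<le> (\<Sum>i<2 * n. ?h (R i))" by (intro sum_mono2) auto
      then show "(\<Sum>i<n. ?h (R i)) \<le> ?h A + ?h A" using sum2[of n] by (rule order_trans)
    qed
    then have sumR: "(\<Sum>i. ?h (R i)) \<noteq> top" using False by (auto simp: top_unique)
    have bound: "?h (A - C) \<le> ?h (B k) + (\<Sum>i. ?h (R (i + k)))" for k
    proof -
      have "A - C \<subseteq> B k \<union> (\<Union>i. R (i + k))"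
      proof
        fix x assume x: "x \<in> A - C"
        then have pos: "0 < infdist x C"
          using infdist_pos_not_in_closed[OF assms \<open>C \<noteq> {}\<close>] by blast
        show "x \<in> B k \<union> (\<Union>i. R (i + k))"
        proof (cases "1 / real (Suc k) \<le> infdist x C")
          case True
          then show ?thesis using x by (auto simp: B_def)
        next
          case nk: False
          define n where "n = (LEAST n. 1 / real (Suc n) \<le> infdist x C)"
          obtain m where "1 / real (Suc m) < infdist x C"
            using pos reals_Archimedean[of "infdist x C"] by (auto simp: inverse_eq_divide)
          then have n: "1 / real (Suc n) \<le> infdist x C"
            unfolding n_def by (intro LeastI[of "\<lambda>n. 1 / real (Suc n) \<le> infdist x C" m]) simp
          have "k < n"
          proof (rule ccontr)
            assume "\<not> k < n"
            then have "1 / real (Suc k) \<le> 1 / real (Suc n)" by (intro divide_left_mono) auto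
            then show False using n nk by simp
          qed
          then obtain j where j: "n = Suc (j + k)" using less_imp_Suc_add[of k n] by (auto simp: add.commute)
          have "\<not> 1 / real (Suc (j + k)) \<le> infdist x C"
            using not_less_Least[of "j + k" "\<lambda>n. 1 / real (Suc n) \<le> infdist x C"] j unfolding n_def[symmetric] by simp
          then have "x \<in> R (j + k)" using n x by (auto simp: R_def j)
          then show ?thesis by blast
        qed
      qed
      then have "?h (A - C) \<le> ?h (B k \<union> (\<Union>i. R (i + k)))" by (rule hausdorff_outer_mono)
      also have "\<dots> \<le> ?h (B k) + ?h (\<Union>i. R (i + k))" by (rule hausdorff_outer_Un)
      also have "\<dots> \<le> ?h (B k) + (\<Sum>i. ?h (R (i + k)))" by (intro add_left_mono hausdorff_outer_UN)
      finally show ?thesis .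
    qed
    have sepB: "?h (A \<inter> C) + ?h (B k) \<le> ?h A" for k
    proof -
      have "?h (A \<inter> C) + ?h (B k) \<le> ?h ((A \<inter> C) \<union> B k)"
      proof (rule hausdorff_outer_separated[where d="1 / real (Suc k)"])
        fix x y assume "x \<in> A \<inter> C" "y \<in> B k"
        then show "1 / real (Suc k) \<le> dist x y"
          using infdist_le[of x C y] by (auto simp: B_def dist_commute)
      qed simp
      also have "\<dots> \<le> ?h A" using RA by (intro hausdorff_outer_mono) auto
      finally show ?thesis .
    qed
    have "(\<lambda>k. \<Sum>i. ?h (R (i + k))) \<longlonglongrightarrow> 0"
    proof -
      define g where "g i = enn2real (?h (R i))" for i
      have "?h (R i) \<le> (\<Sum>i. ?h (R i))" for i using sum_le_suminf[of "\<lambda>i. ?h (R i)" "{i}"] by simp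
      then have fg: "?h (R i) = ennreal (g i)" for i
        unfolding g_def using sumR by (metis ennreal_enn2real less_top top_unique)
      have g0: "0 \<le> g i" for i by (simp add: g_def)
      have sg: "summable g" using sumR unfolding fg by (intro summable_suminf_not_top) (auto simp: g0)
      have sg': "summable (\<lambda>i. g (i + k))" for k using sg by (subst summable_iff_shift)
      have "(\<lambda>k. \<Sum>i. g (i + k)) \<longlonglongrightarrow> 0"
        unfolding LIMSEQ_iff using suminf_exist_split[OF _ sg] by simp
      then have "(\<lambda>k. ennreal (\<Sum>i. g (i + k))) \<longlonglongrightarrow> ennreal 0" by (rule tendsto_ennrealI)
      moreover have "(\<Sum>i. ?h (R (i + k))) = ennreal (\<Sum>i. g (i + k))" for k
        unfolding fg using g0 sg' by (intro suminf_ennreal2)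
      ultimately show ?thesis by simp
    qed
    then have "(\<lambda>k. ?h A + (\<Sum>i. ?h (R (i + k)))) \<longlonglongrightarrow> ?h A + 0"
      by (intro tendsto_add tendsto_const) auto
    moreover have "?h (A \<inter> C) + ?h (A - C) \<le> ?h A + (\<Sum>i. ?h (R (i + k)))" for k
    proof -
      have "?h (A \<inter> C) + ?h (A - C) \<le> ?h (A \<inter> C) + (?h (B k) + (\<Sum>i. ?h (R (i + k))))"
        using bound by (intro add_left_mono)
      also have "\<dots> \<le> ?h A + (\<Sum>i. ?h (R (i + k)))"
        using sepB[of k] by (simp add: add.assoc[symmetric] add_right_mono)
      finally show ?thesis .
    qed
    ultimately show ?thesis
      using LIMSEQ_le_const[of "\<lambda>k. ?h A + (\<Sum>i. ?h (R (i + k)))" "?h A" "?h (A \<inter> C) + ?h (A - C)"] by auto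
  qed simp
  show ?thesis
    unfolding sets_hausdorff_measure lambda_system_def
  proof (intro CollectI conjI ballI)
    fix A :: "'a set" assume "A \<in> UNIV"
    have "hausdorff_outer s A \<le> hausdorff_outer s ((A \<inter> C) \<union> (A - C))" by (simp add: Int_Diff_Un)
    also have "\<dots> \<le> hausdorff_outer s (A \<inter> C) + hausdorff_outer s (A - C)" by (rule hausdorff_outer_Un)
    finally show "hausdorff_outer s (C \<inter> A) + hausdorff_outer s ((UNIV - C) \<inter> A) = hausdorff_outer s A"
      using key[of A] by (simp add: Int_commute Diff_eq)
  qed simp
qed simp

lemma borel_subset_sets_hausdorff: "sets borel \<subseteq> sets (hausdorff_measure s)"
  for s :: nat
proof -
  have "space (hausdorff_measure s :: 'a::metric_space measure) = UNIV"
    unfolding hausdorff_measure_def by (rule space_measure_of) simp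
  then have "sigma_sets UNIV {C :: 'a set. closed C} \<subseteq> sets (hausdorff_measure s)"
    using sets.sigma_sets_subset[of "{C :: 'a set. closed C}" "hausdorff_measure s"] closed_in_sets_hausdorff by auto
  then show ?thesis by (simp add: borel_eq_closed)
qed

text \<open>Replacing the sets of a cover by their closures changes neither their diameters nor their weights,
so the hull can be built from nearly optimal covers of mesh \<open>1 / (k + 1)\<close>.\<close>

lemma hausdorff_borel_hull:
  fixes E :: "'a::metric_space set"
  obtains B where "B \<in> sets borel" "E \<subseteq> B" "hausdorff_outer s B = hausdorff_outer s E"
proof (cases "hausdorff_outer s E = top")
  case True
  then have "hausdorff_outer s (UNIV :: 'a set) = top" using hausdorff_outer_mono[of E UNIV s] by (auto simp: top_unique)
  then show ?thesis using that[of UNIV] True by simp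
next
  case False
  have "\<exists>C :: nat \<Rightarrow> 'a set. E \<subseteq> (\<Union>i. C i) \<and> (\<forall>i. bounded (C i) \<and> diameter (C i) \<le> 1 / real (Suc k)) \<and>
      (\<Sum>i. hausdorff_weight s (C i)) \<le> hausdorff_outer s E + ennreal (1 / real (Suc k))" for k
  proof -
    have "hausdorff_pre s (1 / real (Suc k)) E \<le> hausdorff_outer s E"
      unfolding hausdorff_outer_def by (rule SUP_upper) simp
    also have "\<dots> < hausdorff_outer s E + ennreal (1 / real (Suc k))"
      using False by (cases "hausdorff_outer s E") (auto simp: ennreal_plus[symmetric] ennreal_less_iff simp del: ennreal_plus)
    finally show ?thesis
      unfolding hausdorff_pre_def INF_less_iff by (auto intro: less_imp_le)
  qed
  then obtain C :: "nat \<Rightarrow> nat \<Rightarrow> 'a set" where C: "\<And>k. E \<subseteq> (\<Union>i. C k i)" "\<And>k i. bounded (C k i)" "\<And>k i. diameter (C k i) \<le> 1 / real (Suc k)"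
    "\<And>k. (\<Sum>i. hausdorff_weight s (C k i)) \<le> hausdorff_outer s E + ennreal (1 / real (Suc k))"
    by metis
  define B where "B = (\<Inter>k. \<Union>i. closure (C k i))"
  have "E \<subseteq> B" using C(1) closure_subset unfolding B_def by (intro INT_greatest order_trans[OF C(1)] UN_mono) auto
  moreover have "B \<in> sets borel" unfolding B_def by (intro sets.countable_INT sets.countable_UN) auto
  moreover have "hausdorff_outer s B \<le> hausdorff_outer s E"
    unfolding hausdorff_outer_def[of s B]
  proof (rule SUP_least)
    fix \<delta> :: real assume "\<delta> \<in> {0<..}"
    then obtain k0 where k0: "1 / real (Suc k0) < \<delta>" using reals_Archimedean inverse_eq_divide by (metis greaterThan_iff)
    have "hausdorff_pre s \<delta> B \<le> hausdorff_outer s E + ennreal (1 / real (Suc k))" if "k0 \<le> k" for k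
    proof -
      have "1 / real (Suc k) \<le> 1 / real (Suc k0)" using that by (simp add: frac_le)
      then have "diameter (closure (C k i)) \<le> \<delta>" for i using C(3)[of k i] k0 by (simp add: diameter_closure[OF C(2)])
      then have "hausdorff_pre s \<delta> B \<le> (\<Sum>i. hausdorff_weight s (closure (C k i)))"
        unfolding hausdorff_pre_def using C(2) by (intro INF_lower) (auto simp: B_def)
      also have "\<dots> = (\<Sum>i. hausdorff_weight s (C k i))"
      proof -
        have "hausdorff_weight s (closure (C k i)) = hausdorff_weight s (C k i)" for i
          by (auto simp: hausdorff_weight_def diameter_closure[OF C(2)])
        then show ?thesis by simp
      qed
      finally show ?thesis using C(4)[of k] by simp
    qed
    moreover have "(\<lambda>k. hausdorff_outer s E + ennreal (1 / real (Suc k))) \<longlonglongrightarrow> hausdorff_outer s E + ennreal 0"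
      by (intro tendsto_add tendsto_const tendsto_ennrealI LIMSEQ_Suc[OF lim_1_over_n])
    ultimately show "hausdorff_pre s \<delta> B \<le> hausdorff_outer s E"
      using LIMSEQ_le_const[of "\<lambda>k. hausdorff_outer s E + ennreal (1 / real (Suc k))"] by auto
  qed
  ultimately show ?thesis using that[of B] hausdorff_outer_mono[of E B s] by auto
qed

text \<open>Removing from a Borel hull of \<open>E\<close> a Borel hull of the excess leaves a Borel set \<open>B \<subseteq> E\<close> of the
same measure. Restricted to \<open>B\<close>, Hausdorff measure is a finite Borel measure, and these are inner
regular on complete separable metric spaces.\<close>

lemma hausdorff_inner_compact:
  fixes E :: "'a::{second_countable_topology, complete_space} set"
  assumes E: "E \<in> sets (hausdorff_measure s)" and fin: "hausdorff_outer s E < top" and t: "t < hausdorff_outer s E"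
  obtains K where "compact K" "K \<subseteq> E" "t < hausdorff_outer s K"
proof -
  let ?H = "hausdorff_measure s :: 'a measure"
  note em = emeasure_hausdorff_measure[of _ s]
  obtain B1 where B1: "B1 \<in> sets borel" "E \<subseteq> B1" "hausdorff_outer s B1 = hausdorff_outer s E"
    by (rule hausdorff_borel_hull)
  obtain B2 where B2: "B2 \<in> sets borel" "B1 - E \<subseteq> B2" "hausdorff_outer s B2 = hausdorff_outer s (B1 - E)"
    by (rule hausdorff_borel_hull)
  have s: "B1 \<in> sets ?H" "B2 \<in> sets ?H" using B1 B2 borel_subset_sets_hausdorff by auto
  have "emeasure ?H (B1 - E) = emeasure ?H B1 - emeasure ?H E"
    using E s B1 fin by (intro emeasure_Diff) (auto simp: em)
  then have "hausdorff_outer s (B1 - E) = 0" using E s B1 fin by (simp add: em sets.Diff)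
  then have B20: "emeasure ?H B2 = 0" using B2 s by (simp add: em)
  define B where "B = B1 - B2"
  have B: "B \<in> sets borel" "B \<subseteq> E" using B1 B2 by (auto simp: B_def)
  have "emeasure ?H B = emeasure ?H B1" unfolding B_def using s B20 by (intro emeasure_Diff_null_set) auto
  then have emB: "emeasure ?H B = hausdorff_outer s E" using s B1 by (simp add: em)
  define M where "M = distr (density ?H (indicator B)) borel (\<lambda>x. x)"
  have sp: "space ?H = UNIV" unfolding hausdorff_measure_def by (rule space_measure_of) simp
  have m: "(\<lambda>x. x) \<in> density ?H (indicator B) \<rightarrow>\<^sub>M borel"
    using borel_subset_sets_hausdorff[of s] sp by (auto simp: measurable_def)
  have BH: "X \<in> sets borel \<Longrightarrow> X \<in> sets ?H" for X using borel_subset_sets_hausdorff by auto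
  have eM: "emeasure M X = emeasure ?H (B \<inter> X)" if "X \<in> sets borel" for X
  proof -
    have "emeasure M X = emeasure (density ?H (indicator B)) X"
      unfolding M_def using m that sp by (subst emeasure_distr) auto
    also have "\<dots> = (\<integral>\<^sup>+x. indicator B x * indicator X x \<partial>?H)"
      using BH[OF that] BH[OF B(1)] by (intro emeasure_density) auto
    also have "\<dots> = (\<integral>\<^sup>+x. indicator (B \<inter> X) x \<partial>?H)" by (simp add: indicator_inter_arith)
    also have "\<dots> = emeasure ?H (B \<inter> X)" using BH[OF that] BH[OF B(1)] by (intro nn_integral_indicator) auto
    finally show ?thesis .
  qed
  have "emeasure M B = (SUP K\<in>{K. K \<subseteq> B \<and> compact K}. emeasure M K)"
    by (rule inner_regular) (use B eM emB fin in \<open>auto simp: M_def[symmetric] space_borel\<close>, auto simp: M_def)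
  then have "t < (SUP K\<in>{K. K \<subseteq> B \<and> compact K}. emeasure M K)" using eM[OF B(1)] emB t by simp
  then obtain K where K: "K \<subseteq> B" "compact K" "t < emeasure M K" by (auto simp: less_SUP_iff)
  have "K \<in> sets borel" using K(2) by (simp add: borel_compact)
  then have "t < hausdorff_outer s K" using K eM[of K] BH[of K] by (simp add: em Int_absorb1)
  then show ?thesis using that[of K] K B by blast
qed

section \<open>Projections onto a lower-dimensional space\<close>

abbreviation disjoint_shapes :: "('a \<Rightarrow> real \<Rightarrow> 'b set) \<Rightarrow> ('a \<times> real) set \<Rightarrow> bool" where
  "disjoint_shapes D C \<equiv> pairwise (\<lambda>i j. disjnt (D (fst i) (snd i)) (D (fst j) (snd j))) C"

lemma emeasure_UN_disjoint_balls_le: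
  fixes a :: "'i \<Rightarrow> 'b::euclidean_space"
  assumes C: "countable C" and disj: "pairwise (\<lambda>i j. disjnt (ball (a i) (r i)) (ball (a j) (r j))) C"
    and inj: "\<And>i. i \<in> C \<Longrightarrow> 0 < r i" and W: "\<And>i. i \<in> C \<Longrightarrow> ball (a i) (r i) \<subseteq> W" "W \<in> sets lebesgue"
  shows "(\<integral>\<^sup>+i. ennreal (unit_ball_vol (real DIM('b)) * r i ^ DIM('b)) \<partial>count_space C) \<le> emeasure lebesgue W"
proof -
  have "(\<integral>\<^sup>+i. ennreal (unit_ball_vol (real DIM('b)) * r i ^ DIM('b)) \<partial>count_space C) = (\<integral>\<^sup>+i. emeasure lebesgue (ball (a i) (r i)) \<partial>count_space C)"
    using inj by (intro nn_integral_cong) (auto simp: emeasure_ball less_imp_le)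
  also have "\<dots> = emeasure lebesgue (\<Union>i\<in>C. ball (a i) (r i))"
    using C disj by (intro emeasure_UN_countable[symmetric]) (auto simp: disjoint_family_on_def pairwise_def disjnt_def)
  also have "\<dots> \<le> emeasure lebesgue W" using W by (intro emeasure_mono) auto
  finally show ?thesis .
qed

lemma hausdorff_pre_le_countable:
  fixes A :: "'a::metric_space set" and D :: "'i \<Rightarrow> 'a set"
  assumes "countable C" "A \<subseteq> (\<Union>i\<in>C. D i)" "\<And>i. i \<in> C \<Longrightarrow> bounded (D i)" "\<And>i. i \<in> C \<Longrightarrow> diameter (D i) \<le> \<delta>" "0 < \<delta>"
  shows "hausdorff_pre s \<delta> A \<le> (\<integral>\<^sup>+i. hausdorff_weight s (D i) \<partial>count_space C)"
proof -
  define X where "X n = (if n \<in> to_nat_on C ` C then D (from_nat_into C n) else {})" for n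
  have e: "from_nat_into C (to_nat_on C i) = i" if "i \<in> C" for i using assms(1) that by simp
  have "hausdorff_pre s \<delta> A \<le> (\<Sum>n. hausdorff_weight s (X n))"
    unfolding hausdorff_pre_def
  proof (rule INF_lower, intro CollectI conjI allI)
    show "A \<subseteq> (\<Union>i. X i)"
    proof
      fix x assume "x \<in> A"
      then obtain i where "i \<in> C" "x \<in> D i" using assms(2) by auto
      then have "x \<in> X (to_nat_on C i)" using e by (simp add: X_def)
      then show "x \<in> (\<Union>i. X i)" by blast
    qed
    show "bounded (X n)" "diameter (X n) \<le> \<delta>" for n
      using assms(3,4,5) e by (auto simp: X_def)
  qed
  also have "\<dots> = (\<integral>\<^sup>+n. hausdorff_weight s (X n) \<partial>count_space UNIV)"
    by (rule nn_integral_count_space_nat[symmetric])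
  also have "\<dots> = (\<integral>\<^sup>+n. hausdorff_weight s (X n) * indicator (to_nat_on C ` C) n \<partial>count_space UNIV)"
    by (intro nn_integral_cong) (auto simp: X_def hausdorff_weight_def)
  also have "\<dots> = (\<integral>\<^sup>+n. hausdorff_weight s (X n) \<partial>count_space (to_nat_on C ` C))"
    by (simp add: nn_integral_count_space_indicator)
  also have "\<dots> = (\<integral>\<^sup>+i. hausdorff_weight s (X (to_nat_on C i)) \<partial>count_space C)"
    using inj_on_to_nat_on[OF assms(1)] by (intro nn_integral_bij_count_space[symmetric]) (auto simp: bij_betw_def)
  also have "\<dots> = (\<integral>\<^sup>+i. hausdorff_weight s (D i) \<partial>count_space C)"
    by (intro nn_integral_cong) (auto simp: X_def e)
  finally show ?thesis .
qed

lemma hausdorff_weight_le: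
  fixes X :: "'a::metric_space set"
  assumes "\<And>x y. x \<in> X \<Longrightarrow> y \<in> X \<Longrightarrow> dist x y \<le> 2 * d" "0 \<le> d"
  shows "bounded X" "diameter X \<le> 2 * d" "hausdorff_weight s X \<le> ennreal (unit_ball_vol (real s) * d ^ s)"
proof -
  show bX: "bounded X" using assms(1) by (auto simp: bounded_two_points)
  show dX: "diameter X \<le> 2 * d"
    using assms by (auto simp: diameter_def intro!: cSUP_least)
  have "0 \<le> diameter X" using bX by (rule diameter_ge_0)
  then show "hausdorff_weight s X \<le> ennreal (unit_ball_vol (real s) * d ^ s)"
    using dX by (auto simp: hausdorff_weight_def intro!: ennreal_leI mult_left_mono power_mono)
qed

text \<open>The part of \<open>E\<close> that lies over a ball of radius \<open>r\<close> has diameter at most \<open>2 K r\<close>, and the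
normalisation of the weights makes its weight at most \<open>K\<^sup>s\<close> times the measure of the ball.
Disjoint small balls exhaust \<open>W\<close> up to a null set by the Vitali covering theorem. The part over
the null set is covered by balls of small total measure, since \<open>5\<close>-fold enlargements of disjoint
balls in a small open neighbourhood suffice. Covering by disjoint balls is what gives the sharp
constant \<open>K\<^sup>s\<close>.\<close>

lemma hausdorff_outer_le_projection:
  fixes E :: "'a::metric_space set" and L :: "'a \<Rightarrow> 'b::euclidean_space"
  assumes K: "0 < K" "\<And>x y. x \<in> E \<Longrightarrow> y \<in> E \<Longrightarrow> dist x y \<le> K * dist (L x) (L y)"
    and W: "open W" "L ` E \<subseteq> W"
  shows "hausdorff_outer DIM('b) E \<le> ennreal (K ^ DIM('b)) * emeasure lebesgue W"
  unfolding hausdorff_outer_def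
proof (rule SUP_least)
  fix \<delta> :: real assume "\<delta> \<in> {0<..}"
  then have \<delta>: "0 < \<delta>" by simp
  let ?s = "DIM('b)"
  let ?v = "unit_ball_vol (real ?s)"
  define E' where "E' i = E \<inter> L -` ball (fst i) (snd i)" for i :: "'b \<times> real"
  have E'd: "dist x y \<le> 2 * (K * snd i)" if "x \<in> E' i" "y \<in> E' i" for x y i
  proof -
    have "dist x y \<le> K * dist (L x) (L y)" using that K by (auto simp: E'_def)
    also have "dist (L x) (L y) \<le> 2 * snd i"
      using that dist_triangle_less_add[of "L x" "fst i" "snd i" "L y" "snd i"] by (auto simp: E'_def dist_commute less_imp_le)
    finally show ?thesis using K(1) by (simp add: mult_ac mult_left_mono)
  qed
  have main: "hausdorff_pre ?s \<delta> A \<le> ennreal (K ^ ?s) * (\<integral>\<^sup>+i. ennreal (?v * snd i ^ ?s) \<partial>count_space C)"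
    if C: "countable C" "A \<subseteq> E" "L ` A \<subseteq> (\<Union>i\<in>C. ball (fst i) (snd i))" "\<And>i. i \<in> C \<Longrightarrow> 0 < snd i \<and> 2 * (K * snd i) \<le> \<delta>"
    for A and C :: "('b \<times> real) set"
  proof -
    have "hausdorff_pre ?s \<delta> A \<le> (\<integral>\<^sup>+i. hausdorff_weight ?s (E' i) \<partial>count_space C)"
    proof (rule hausdorff_pre_le_countable[OF C(1)])
      show "A \<subseteq> (\<Union>i\<in>C. E' i)" using C(2,3) by (fastforce simp: E'_def image_subset_iff)
      fix i assume i: "i \<in> C"
      show "bounded (E' i)" using hausdorff_weight_le(1)[OF E'd[where i=i]] C(4)[OF i] K(1) by simp
      have "diameter (E' i) \<le> 2 * (K * snd i)"
        using E'd[where i=i] C(4)[OF i] K(1) by (intro hausdorff_weight_le(2)) auto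
      then show "diameter (E' i) \<le> \<delta>" using C(4)[OF i] by simp
    qed (rule \<delta>)
    also have "\<dots> \<le> (\<integral>\<^sup>+i. ennreal (K ^ ?s) * ennreal (?v * snd i ^ ?s) \<partial>count_space C)"
    proof (rule nn_integral_mono)
      fix i assume "i \<in> space (count_space C)"
      then have i: "i \<in> C" by simp
      have "hausdorff_weight ?s (E' i) \<le> ennreal (?v * (K * snd i) ^ ?s)"
        using hausdorff_weight_le(3)[OF E'd[where i=i]] C(4)[OF i] K(1) by simp
      also have "\<dots> = ennreal (K ^ ?s) * ennreal (?v * snd i ^ ?s)"
        using K(1) C(4)[OF i] by (simp add: ennreal_mult[symmetric] power_mult_distrib mult_ac)
      finally show "hausdorff_weight ?s (E' i) \<le> ennreal (K ^ ?s) * ennreal (?v * snd i ^ ?s)" .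
    qed
    also have "\<dots> = ennreal (K ^ ?s) * (\<integral>\<^sup>+i. ennreal (?v * snd i ^ ?s) \<partial>count_space C)"
      by (rule nn_integral_cmult) simp
    finally show ?thesis .
  qed
  define r0 where "r0 = \<delta> / (2 * K)"
  have r0: "0 < r0" using \<delta> K by (simp add: r0_def)
  have small: "2 * (K * r) \<le> \<delta>" if "r \<le> r0" for r using that K by (simp add: r0_def field_simps)
  \<comment> \<open>the radii are bounded so that the parts of \<open>E\<close> over the balls have diameter at most \<open>\<delta>\<close>\<close>
  define I where "I = {i. 0 < snd i \<and> snd i \<le> r0 \<and> ball (fst i) (snd i) \<subseteq> W}"
  have fine: "\<exists>i. i \<in> I \<and> x \<in> ball (fst i) (snd i) \<and> snd i < d" if "x \<in> W" "0 < d" for x d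
  proof -
    obtain e where e: "e > 0" "ball x e \<subseteq> W" using W(1) \<open>x \<in> W\<close> open_contains_ball by blast
    have "ball x (min (min e r0) (d/2)) \<subseteq> W" using e(2) by auto
    then show ?thesis using e(1) r0 that(2)
      by (intro exI[of _ "(x, min (min e r0) (d/2))"]) (auto simp: I_def)
  qed
  obtain C where C: "countable C" "C \<subseteq> I" "disjoint_shapes ball C"
      "negligible (W - (\<Union>i\<in>C. ball (fst i) (snd i)))"
    using Vitali_covering_theorem_balls[where S=W and K=I and a=fst and r=snd, OF fine] by blast
  define Z where "Z = W - (\<Union>i\<in>C. ball (fst i) (snd i))"
  define E1 where "E1 = E \<inter> L -` (\<Union>i\<in>C. ball (fst i) (snd i))"
  define E2 where "E2 = E \<inter> L -` Z"
  have "E \<subseteq> E1 \<union> E2" using W(2) by (auto simp: E1_def E2_def Z_def)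
  have p1: "hausdorff_pre ?s \<delta> E1 \<le> ennreal (K ^ ?s) * emeasure lebesgue W"
  proof -
    have "hausdorff_pre ?s \<delta> E1 \<le> ennreal (K ^ ?s) * (\<integral>\<^sup>+i. ennreal (?v * snd i ^ ?s) \<partial>count_space C)"
      using C(1,2) small by (intro main) (auto simp: E1_def I_def)
    also have "\<dots> \<le> ennreal (K ^ ?s) * emeasure lebesgue W"
      using C W(1) by (intro mult_left_mono emeasure_UN_disjoint_balls_le[where a=fst]) (auto simp: I_def)
    finally show ?thesis .
  qed
  have p2: "hausdorff_pre ?s \<delta> E2 \<le> ennreal e" if e: "0 < e" for e
  proof -
    define e' where "e' = e / (K * 5) ^ ?s"
    have e': "0 < e'" using e K by (simp add: e'_def)
    have "Z \<in> lmeasurable" "measure lebesgue Z = 0"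
      using C(4) by (auto simp: Z_def negligible_imp_measurable negligible_imp_measure0)
    then obtain O' where O': "open O'" "Z \<subseteq> O'" "O' - Z \<in> lmeasurable" "emeasure lebesgue (O' - Z) < ennreal e'"
      using sets_lebesgue_outer_open[of Z e'] e' by (metis fmeasurableD)
    have "O' = (O' - Z) \<union> Z" using O'(2) by auto
    then have "emeasure lebesgue O' \<le> emeasure lebesgue (O' - Z) + emeasure lebesgue Z"
      using O'(3) \<open>Z \<in> lmeasurable\<close> by (metis emeasure_subadditive fmeasurableD)
    also have "emeasure lebesgue Z = 0"
      using \<open>Z \<in> lmeasurable\<close> \<open>measure lebesgue Z = 0\<close> by (simp add: emeasure_eq_measure2)
    finally have O'e: "emeasure lebesgue O' \<le> ennreal e'" using O'(4) by simp
    define I' where "I' = {i. 0 < snd i \<and> 5 * snd i \<le> r0 \<and> ball (fst i) (snd i) \<subseteq> O'}"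
    have cov: "Z \<subseteq> (\<Union>i\<in>I'. ball (fst i) (snd i))"
    proof
      fix x assume "x \<in> Z"
      then obtain d where d: "d > 0" "ball x d \<subseteq> O'" using O'(1,2) openE by blast
      have "ball x (min d (r0/5)) \<subseteq> O'" using d(2) by auto
      then have "(x, min d (r0/5)) \<in> I'" using d(1) r0 by (auto simp: I'_def)
      moreover have "x \<in> ball (fst (x, min d (r0/5))) (snd (x, min d (r0/5)))" using d(1) r0 by simp
      ultimately show "x \<in> (\<Union>i\<in>I'. ball (fst i) (snd i))" by blast
    qed
    have bnd: "0 < snd i \<and> snd i \<le> r0" if "i \<in> I'" for i using that by (auto simp: I'_def)
    obtain C' where C': "countable C'" "C' \<subseteq> I'" "disjoint_shapes ball C'"
        "Z \<subseteq> (\<Union>i\<in>C'. ball (fst i) (5 * snd i))"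
      by (rule Vitali_covering_lemma_balls[OF cov bnd])
    define C5 where "C5 = (\<lambda>i. (fst i, 5 * snd i)) ` C'"
    have inj5: "inj_on (\<lambda>i::'b \<times> real. (fst i, 5 * snd i)) C'" by (auto simp: inj_on_def prod_eq_iff)
    have "hausdorff_pre ?s \<delta> E2 \<le> ennreal (K ^ ?s) * (\<integral>\<^sup>+i. ennreal (?v * snd i ^ ?s) \<partial>count_space C5)"
    proof (rule main)
      show "L ` E2 \<subseteq> (\<Union>i\<in>C5. ball (fst i) (snd i))" using C'(4) by (auto simp: E2_def C5_def)
      fix i assume "i \<in> C5"
      then obtain j where j: "j \<in> I'" "i = (fst j, 5 * snd j)" using C'(2) by (auto simp: C5_def)
      then show "0 < snd i \<and> 2 * (K * snd i) \<le> \<delta>"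
        using small[of "5 * snd j"] by (simp add: I'_def)
    qed (use C'(1) in \<open>auto simp: C5_def E2_def\<close>)
    also have "(\<integral>\<^sup>+i. ennreal (?v * snd i ^ ?s) \<partial>count_space C5) = (\<integral>\<^sup>+i. ennreal (?v * (5 * snd i) ^ ?s) \<partial>count_space C')"
      using nn_integral_bij_count_space[of "\<lambda>i. (fst i, 5 * snd i)" C' C5 "\<lambda>i. ennreal (?v * snd i ^ ?s)"] inj5
      by (simp add: bij_betw_def C5_def)
    also have "\<dots> = (\<integral>\<^sup>+i. ennreal (5 ^ ?s) * ennreal (?v * snd i ^ ?s) \<partial>count_space C')"
      using C'(2) by (intro nn_integral_cong) (auto simp: ennreal_mult[symmetric] power_mult_distrib mult_ac I'_def)
    also have "\<dots> = ennreal (5 ^ ?s) * (\<integral>\<^sup>+i. ennreal (?v * snd i ^ ?s) \<partial>count_space C')"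
      by (rule nn_integral_cmult) simp
    finally have "hausdorff_pre ?s \<delta> E2 \<le> ennreal (K ^ ?s) * (ennreal (5 ^ ?s) * (\<integral>\<^sup>+i. ennreal (?v * snd i ^ ?s) \<partial>count_space C'))" .
    also have "\<dots> \<le> ennreal (K ^ ?s) * (ennreal (5 ^ ?s) * ennreal e')"
      using C' O'(1) by (intro mult_left_mono order_trans[OF emeasure_UN_disjoint_balls_le[where a=fst] O'e]) (auto simp: I'_def)
    also have "\<dots> = ennreal e"
    proof -
      have "K ^ ?s * (5 ^ ?s * e') = e" using K(1) by (simp add: e'_def power_mult_distrib)
      then show ?thesis using K(1) e' by (simp add: ennreal_mult[symmetric])
    qed
    finally show ?thesis .
  qed
  show "hausdorff_pre ?s \<delta> E \<le> ennreal (K ^ ?s) * emeasure lebesgue W"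
  proof (rule ennreal_le_epsilon)
    fix e :: real assume "0 < e"
    have "hausdorff_pre ?s \<delta> E \<le> hausdorff_pre ?s \<delta> (E1 \<union> E2)"
      using \<open>E \<subseteq> E1 \<union> E2\<close> by (rule hausdorff_pre_mono)
    also have "\<dots> \<le> hausdorff_pre ?s \<delta> E1 + hausdorff_pre ?s \<delta> E2"
      by (rule hausdorff_pre_Un[OF \<delta>])
    also have "\<dots> \<le> ennreal (K ^ ?s) * emeasure lebesgue W + ennreal e"
      using p1 p2[OF \<open>0 < e\<close>] by (rule add_mono)
    finally show "hausdorff_pre ?s \<delta> E \<le> ennreal (K ^ ?s) * emeasure lebesgue W + ennreal e" .
  qed
qed


section \<open>A Vitali covering theorem for sets of bounded eccentricity\<close>

text \<open>The covering lemma for balls yields disjoint balls whose \<open>5\<close>-fold enlargements cover \<open>T\<close>, and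
finitely many of these enlargements carry half of the measure of \<open>T\<close>. The sets \<open>D\<close> inside contain
balls that are smaller by the factor \<open>\<kappa> / 5\<close> than the enlargements, so they have total measure at
least \<open>2 \<eta> \<mu>(T)\<close>. They are chosen within an open set \<open>V\<close> with \<open>\<mu>(V) \<le> (1 + \<eta>) \<mu>(T)\<close>, so at least
\<open>\<eta> \<mu>(T)\<close> of this measure lies in \<open>T\<close>. The open set \<open>W\<close> allows the step to be iterated on what is
left of \<open>T\<close>.\<close>

lemma Vitali_step:
  fixes D :: "'b::euclidean_space \<Rightarrow> real \<Rightarrow> 'b set"
  assumes T: "T \<in> lmeasurable" and \<kappa>: "0 < \<kappa>" "\<kappa> \<le> 1" and W: "open W" "T \<subseteq> W"
    and D: "\<And>x r. x \<in> T \<Longrightarrow> 0 < r \<Longrightarrow> ball x (\<kappa> * r) \<subseteq> D x r \<and> D x r \<subseteq> cball x r \<and> compact (D x r)"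
    and R: "\<And>x. x \<in> T \<Longrightarrow> 0 < R x"
  defines "\<eta> \<equiv> (\<kappa> / 5) ^ DIM('b) / 4"
  shows "\<exists>C. finite C \<and> C \<subseteq> T \<times> {0<..} \<and> (\<forall>(x, r)\<in>C. r < R x \<and> D x r \<subseteq> W) \<and>
    disjoint_shapes D C \<and>
    measure lebesgue (T - (\<Union>i\<in>C. D (fst i) (snd i))) \<le> (1 - \<eta>) * measure lebesgue T"
proof (cases "measure lebesgue T = 0")
  case True
  then show ?thesis by (intro exI[of _ "{}"]) simp
next
  case False
  let ?\<mu> = "measure lebesgue" and ?s = "DIM('b)"
  let ?v = "unit_ball_vol (real ?s)"
  have pos: "0 < ?\<mu> T" using False measure_nonneg[of lebesgue T] by linarith
  have \<eta>: "0 < \<eta>" "\<eta> < 1"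
  proof -
    show "0 < \<eta>" using \<kappa> by (simp add: \<eta>_def)
    have "(\<kappa> / 5) ^ ?s \<le> 1" using \<kappa> by (intro power_le_one) auto
    then show "\<eta> < 1" by (simp add: \<eta>_def)
  qed
  obtain W0 where W0: "open W0" "T \<subseteq> W0" "W0 - T \<in> lmeasurable" "emeasure lebesgue (W0 - T) < ennreal (\<eta> * ?\<mu> T)"
    using sets_lebesgue_outer_open[of T "\<eta> * ?\<mu> T"] T \<eta> pos by (metis fmeasurableD mult_pos_pos)
  define V where "V = W0 \<inter> W"
  have W0l: "W0 \<in> lmeasurable"
    using fmeasurable.Un[OF W0(3) T] W0(2) by (simp add: Un_absorb2)
  have V: "open V" "T \<subseteq> V" "V \<in> lmeasurable" "V \<subseteq> W"
    using W W0 fmeasurable_Int_fmeasurable[OF W0l, of W] by (auto simp: V_def)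
  have muV: "?\<mu> V \<le> (1 + \<eta>) * ?\<mu> T"
  proof -
    have "?\<mu> V \<le> ?\<mu> W0" using V W0l by (intro measure_mono_fmeasurable) (auto simp: V_def)
    also have "?\<mu> W0 = ?\<mu> T + ?\<mu> (W0 - T)"
      using W0 W0l T by (subst measurable_measure_Diff) auto
    also have "?\<mu> (W0 - T) \<le> \<eta> * ?\<mu> T"
      using W0(4) \<eta> pos by (intro less_imp_le) (simp add: emeasure_eq_measure2 W0(3) ennreal_less_iff)
    finally show ?thesis by (simp add: algebra_simps)
  qed
  define I where "I = {i. fst i \<in> T \<and> 0 < snd i \<and> snd i < R (fst i) \<and> snd i \<le> 1 \<and> cball (fst i) (snd i) \<subseteq> V}"
  have cov: "T \<subseteq> (\<Union>i\<in>I. cball (fst i) (snd i))"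
  proof
    fix x assume x: "x \<in> T"
    then obtain d where d: "d > 0" "cball x d \<subseteq> V" using V(1,2) open_contains_cball by blast
    have "(x, min (min d 1) (R x / 2)) \<in> I"
      using d x R[OF x] by (auto simp: I_def subset_eq)
    moreover have "x \<in> cball (fst (x, min (min d 1) (R x / 2))) (snd (x, min (min d 1) (R x / 2)))"
      using d(1) R[OF x] by simp
    ultimately show "x \<in> (\<Union>i\<in>I. cball (fst i) (snd i))" by blast
  qed
  have bnd: "0 < snd i \<and> snd i \<le> 1" if "i \<in> I" for i using that by (auto simp: I_def)
  obtain C where C: "countable C" "C \<subseteq> I" "disjoint_shapes cball C"
      "T \<subseteq> (\<Union>i\<in>C. cball (fst i) (5 * snd i))"
    by (rule Vitali_covering_lemma_cballs[OF cov bnd])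
  \<comment> \<open>otherwise all finite unions of the enlarged balls, and so their whole union, which contains \<open>T\<close>, would
    have at most half of the measure of \<open>T\<close>\<close>
  have "\<exists>C0. finite C0 \<and> C0 \<subseteq> C \<and> ?\<mu> T / 2 < (\<Sum>i\<in>C0. ?\<mu> (cball (fst i) (5 * snd i)))"
  proof (rule ccontr)
    assume neg: "\<not> ?thesis"
    have "?\<mu> (\<Union>i\<in>C. cball (fst i) (5 * snd i)) \<le> ?\<mu> T / 2 \<and> (\<Union>i\<in>C. cball (fst i) (5 * snd i)) \<in> lmeasurable"
    proof -
      have bd: "?\<mu> (\<Union>i\<in>C0. cball (fst i) (5 * snd i)) \<le> ?\<mu> T / 2" if "finite C0" "C0 \<subseteq> C" for C0
      proof -
        have "?\<mu> (\<Union>i\<in>C0. cball (fst i) (5 * snd i)) \<le> (\<Sum>i\<in>C0. ?\<mu> (cball (fst i) (5 * snd i)))"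
          using that(1) by (intro measure_UNION_le) auto
        also have "\<dots> \<le> ?\<mu> T / 2" using neg that by (meson not_le)
        finally show ?thesis .
      qed
      show ?thesis
        using fmeasurable_UN_bound[OF C(1), of "\<lambda>i. cball (fst i) (5 * snd i)" lebesgue "?\<mu> T / 2"]
          measure_UN_bound[OF C(1), of "\<lambda>i. cball (fst i) (5 * snd i)" lebesgue "?\<mu> T / 2"] bd by auto
    qed
    then have "?\<mu> T \<le> ?\<mu> T / 2"
      using C(4) T measure_mono_fmeasurable[of T "\<Union>i\<in>C. cball (fst i) (5 * snd i)" lebesgue] by auto
    then show False using pos by simp
  qed
  then obtain C0 where C0: "finite C0" "C0 \<subseteq> C" "?\<mu> T / 2 < (\<Sum>i\<in>C0. ?\<mu> (cball (fst i) (5 * snd i)))" by blast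
  have C0I: "i \<in> C0 \<Longrightarrow> i \<in> I" for i using C0(2) C(2) by auto
  have Di: "ball (fst i) (\<kappa> * snd i) \<subseteq> D (fst i) (snd i)" "D (fst i) (snd i) \<subseteq> cball (fst i) (snd i)" "compact (D (fst i) (snd i))"
    if "i \<in> C0" for i using D[of "fst i" "snd i"] C0I[OF that] by (auto simp: I_def)
  have pw: "disjoint_shapes D C0"
    unfolding pairwise_def
  proof (intro ballI impI)
    fix i j assume ij: "i \<in> C0" "j \<in> C0" "i \<noteq> j"
    then have "disjnt (cball (fst i) (snd i)) (cball (fst j) (snd j))" using C(3) C0(2) by (auto simp: pairwise_def)
    then show "disjnt (D (fst i) (snd i)) (D (fst j) (snd j))"
      using Di(2)[OF ij(1)] Di(2)[OF ij(2)] by (auto simp: disjnt_def)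
  qed
  let ?U = "\<Union>i\<in>C0. D (fst i) (snd i)"
  have Dl: "D (fst i) (snd i) \<in> lmeasurable" if "i \<in> C0" for i using Di(3)[OF that] by (rule lmeasurable_compact)
  have Ul: "?U \<in> lmeasurable" using C0(1) Dl by (intro fmeasurable.finite_UN) auto
  have UV: "?U \<subseteq> V" using Di(2) C0I by (fastforce simp: I_def)
  have "2 * \<eta> * ?\<mu> T = (\<kappa> / 5) ^ ?s * (?\<mu> T / 2)" by (simp add: \<eta>_def)
  also have "\<dots> \<le> (\<kappa> / 5) ^ ?s * (\<Sum>i\<in>C0. ?\<mu> (cball (fst i) (5 * snd i)))"
    using C0(3) \<kappa> by (intro mult_left_mono) auto
  also have "\<dots> = (\<Sum>i\<in>C0. ?\<mu> (ball (fst i) (\<kappa> * snd i)))"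
    unfolding sum_distrib_left
  proof (rule sum.cong[OF refl])
    fix i assume "i \<in> C0"
    then have "0 < snd i" using C0I by (auto simp: I_def)
    then show "(\<kappa> / 5) ^ ?s * ?\<mu> (cball (fst i) (5 * snd i)) = ?\<mu> (ball (fst i) (\<kappa> * snd i))"
      using \<kappa> by (simp add: content_cball content_ball power_mult_distrib power_divide)
  qed
  also have "\<dots> \<le> (\<Sum>i\<in>C0. ?\<mu> (D (fst i) (snd i)))"
    using Di Dl by (intro sum_mono measure_mono_fmeasurable) auto
  also have "\<dots> = ?\<mu> ?U"
    using C0(1) Dl pw by (intro measure_UNION'[symmetric]) auto
  finally have muU: "2 * \<eta> * ?\<mu> T \<le> ?\<mu> ?U" .
  have "?\<mu> (T - ?U) \<le> ?\<mu> (V - ?U)"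
    using T V Ul by (intro measure_mono_fmeasurable) (auto intro: fmeasurable.Diff fmeasurableD)
  also have "\<dots> = ?\<mu> V - ?\<mu> ?U"
    using V(3) Ul UV by (intro measurable_measure_Diff) auto
  also have "\<dots> \<le> (1 + \<eta>) * ?\<mu> T - 2 * \<eta> * ?\<mu> T" using muV muU by simp
  also have "\<dots> = (1 - \<eta>) * ?\<mu> T" by (simp add: algebra_simps)
  finally have "?\<mu> (T - ?U) \<le> (1 - \<eta>) * ?\<mu> T" .
  moreover have "D x r \<subseteq> W" if "(x, r) \<in> C0" for x r
    using Di(2)[OF that] C0I[OF that] V(4) by (auto simp: I_def)
  moreover have "C0 \<subseteq> T \<times> {0<..}" using C0I by (fastforce simp: I_def)
  moreover have "r < R x" if "(x, r) \<in> C0" for x r using C0I[OF that] by (simp add: I_def)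
  ultimately show ?thesis
    using C0(1) pw by (intro exI[of _ C0]) auto
qed

text \<open>Each application of \<open>Vitali_step\<close> to the rest of \<open>T\<close>, outside the compact sets chosen before,
reduces the measure of the rest by a fixed factor less than one. In contrast to the case of balls,
the shape of \<open>D x r\<close> may depend on the centre in an arbitrary, nonmeasurable way.\<close>

theorem Vitali_covering_eccentric:
  fixes D :: "'b::euclidean_space \<Rightarrow> real \<Rightarrow> 'b set"
  assumes T: "T \<in> lmeasurable" and \<kappa>: "0 < \<kappa>" "\<kappa> \<le> 1"
    and D: "\<And>x r. x \<in> T \<Longrightarrow> 0 < r \<Longrightarrow> ball x (\<kappa> * r) \<subseteq> D x r \<and> D x r \<subseteq> cball x r \<and> compact (D x r)"
    and R: "\<And>x. x \<in> T \<Longrightarrow> 0 < R x" and e: "0 < e"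
  shows "\<exists>C. finite C \<and> C \<subseteq> T \<times> {0<..} \<and> (\<forall>(x, r)\<in>C. r < R x) \<and>
    disjoint_shapes D C \<and>
    measure lebesgue (T - (\<Union>i\<in>C. D (fst i) (snd i))) < e"
proof -
  let ?U = "\<lambda>C. \<Union>i\<in>C. D (fst i) (snd i)"
  define \<eta> where "\<eta> = (\<kappa> / 5) ^ DIM('b) / 4"
  have \<eta>: "0 < \<eta>" "\<eta> < 1"
  proof -
    show "0 < \<eta>" using \<kappa> by (simp add: \<eta>_def)
    have "(\<kappa> / 5) ^ DIM('b) \<le> 1" using \<kappa> by (intro power_le_one) auto
    then show "\<eta> < 1" by (simp add: \<eta>_def)
  qed
  define ok where "ok C \<longleftrightarrow> finite C \<and> C \<subseteq> T \<times> {0<..} \<and> (\<forall>(x, r)\<in>C. r < R x) \<and>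
      disjoint_shapes D C" for C
  have step: "\<exists>C. ok C \<and> measure lebesgue (T - ?U C) \<le> (1 - \<eta>) ^ k * measure lebesgue T" for k
  proof (induction k)
    case 0
    show ?case by (intro exI[of _ "{}"]) (simp add: ok_def)
  next
    case (Suc k)
    then obtain C where C: "ok C" "measure lebesgue (T - ?U C) \<le> (1 - \<eta>) ^ k * measure lebesgue T" by blast
    have Dc: "compact (D (fst i) (snd i))" if "i \<in> C" for i
      using D[of "fst i" "snd i"] C(1) that by (auto simp: ok_def)
    have U: "compact (?U C)" using C(1) Dc by (intro compact_UN) (auto simp: ok_def)
    define T' where "T' = T - ?U C"
    have T': "T' \<in> lmeasurable" "T' \<subseteq> - ?U C" "T' \<subseteq> T"
      using T U by (auto simp: T'_def lmeasurable_compact fmeasurable.Diff)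
    have oU: "open (- ?U C)" using U by (intro open_Compl compact_imp_closed)
    have D': "ball x (\<kappa> * r) \<subseteq> D x r \<and> D x r \<subseteq> cball x r \<and> compact (D x r)" if "x \<in> T'" "0 < r" for x r
      using D[OF subsetD[OF T'(3)]] that by blast
    have R': "0 < R x" if "x \<in> T'" for x using R[OF subsetD[OF T'(3)]] that by blast
    have "\<exists>C'. finite C' \<and> C' \<subseteq> T' \<times> {0<..} \<and> (\<forall>(x, r)\<in>C'. r < R x \<and> D x r \<subseteq> - ?U C) \<and>
        disjoint_shapes D C' \<and>
        measure lebesgue (T' - ?U C') \<le> (1 - \<eta>) * measure lebesgue T'"
      unfolding \<eta>_def by (rule Vitali_step[OF T'(1) \<kappa> oU T'(2) D' R'])
    then obtain C' where "finite C' \<and> C' \<subseteq> T' \<times> {0<..} \<and> (\<forall>(x, r)\<in>C'. r < R x \<and> D x r \<subseteq> - ?U C) \<and>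
        disjoint_shapes D C' \<and>
        measure lebesgue (T' - ?U C') \<le> (1 - \<eta>) * measure lebesgue T'" ..
    then have C': "finite C'" "C' \<subseteq> T' \<times> {0<..}" "(x, r) \<in> C' \<Longrightarrow> r < R x" "(x, r) \<in> C' \<Longrightarrow> D x r \<subseteq> - ?U C"
        "disjoint_shapes D C'"
        "measure lebesgue (T' - ?U C') \<le> (1 - \<eta>) * measure lebesgue T'" for x r
      by blast+
    have "ok (C \<union> C')"
      unfolding ok_def
    proof (intro conjI)
      have x: "disjnt (D (fst i) (snd i)) (D (fst j) (snd j))" if "i \<in> C" "j \<in> C'" for i j
        using C'(4)[of "fst j" "snd j"] that by (auto simp: disjnt_def)
      show "disjoint_shapes D (C \<union> C')"
        using C(1) C'(5) x by (auto simp: pairwise_def ok_def disjnt_sym)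
    qed (use C(1) C'(1-3) T'(3) in \<open>auto simp: ok_def\<close>)
    moreover have "T - ?U (C \<union> C') = T' - ?U C'" by (auto simp: T'_def)
    moreover have "(1 - \<eta>) * measure lebesgue T' \<le> (1 - \<eta>) ^ Suc k * measure lebesgue T"
      using C(2) \<eta> mult_left_mono[of "measure lebesgue T'" "(1 - \<eta>) ^ k * measure lebesgue T" "1 - \<eta>"] by (simp add: T'_def mult_ac)
    ultimately show ?case using C'(6) by (intro exI[of _ "C \<union> C'"]) auto
  qed
  have "(\<lambda>k. (1 - \<eta>) ^ k * measure lebesgue T) \<longlonglongrightarrow> 0 * measure lebesgue T"
    using \<eta> by (intro tendsto_intros LIMSEQ_power_zero) auto
  then have "eventually (\<lambda>k. (1 - \<eta>) ^ k * measure lebesgue T < e) sequentially"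
    using e by (intro order_tendstoD(2)) auto
  then obtain k where "(1 - \<eta>) ^ k * measure lebesgue T < e" by (auto simp: eventually_sequentially)
  then show ?thesis
    using step[of k] unfolding ok_def by (elim exE conjE) (intro exI conjI, auto)
qed


section \<open>Filling nearly flat compact sets with cubes\<close>

text \<open>An index type for the hyperplanes in \<open>\<real>\<^sup>n\<close>: it has \<open>n - 1\<close> elements, unless \<open>n = 1\<close>, as types are
not empty. The order has no geometric meaning; it makes the type an instance of the classes for
which the determinant is known to describe the volume of linear images.\<close>

typedef ('n::finite) pred_index = "{k::nat. k < max 1 (CARD('n) - 1)}"
  by (intro exI[of _ 0]) simp

instantiation pred_index :: (finite) "{finite, wellorder}"
begin
definition less_eq_pred_index :: "'a pred_index \<Rightarrow> 'a pred_index \<Rightarrow> bool" where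
  "less_eq_pred_index a b \<longleftrightarrow> Rep_pred_index a \<le> Rep_pred_index b"
definition less_pred_index :: "'a pred_index \<Rightarrow> 'a pred_index \<Rightarrow> bool" where
  "less_pred_index a b \<longleftrightarrow> Rep_pred_index a < Rep_pred_index b"
instance
proof
  have "finite (Rep_pred_index -` {k. k < max 1 (CARD('a) - 1)} :: 'a pred_index set)"
    by (rule finite_vimageI) (auto simp: inj_def Rep_pred_index_inject)
  moreover have "Rep_pred_index -` {k. k < max 1 (CARD('a) - 1)} = (UNIV :: 'a pred_index set)"
    using Rep_pred_index by blast
  ultimately show "finite (UNIV :: 'a pred_index set)" by simp
  fix P :: "'a pred_index \<Rightarrow> bool" and a
  assume step: "\<And>x. (\<And>y. y < x \<Longrightarrow> P y) \<Longrightarrow> P x"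
  show "P a"
    by (induction a rule: measure_induct_rule[where f=Rep_pred_index]) (rule step, simp add: less_pred_index_def)
qed (auto simp: less_eq_pred_index_def less_pred_index_def Rep_pred_index_inject)
end

lemma card_pred_index: "CARD('n::finite) \<noteq> 1 \<Longrightarrow> CARD('n pred_index) + 1 = CARD('n)"
proof -
  assume "CARD('n) \<noteq> 1"
  then have "CARD('n) > 1" using zero_less_card_finite[where 'a='n] by linarith
  moreover have "CARD('n pred_index) = card {k::nat. k < max 1 (CARD('n) - 1)}"
    by (rule type_definition.card[OF type_definition_pred_index])
  ultimately show ?thesis by simp
qed

text \<open>The orthogonal projection onto the hyperplane \<open>\<nu>\<^sup>\<bottom>\<close>, followed by an isometry onto \<open>\<real>\<^sup>m\<close>.\<close>

lemma projection_along_exists: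
  fixes \<nu> :: "real^'n"
  assumes \<nu>: "norm \<nu> = 1" and card: "CARD('m) + 1 = CARD('n)"
  obtains L :: "real^'n \<Rightarrow> real^'m" where "linear L" "\<And>x. (norm (L x))\<^sup>2 = (norm x)\<^sup>2 - (x \<bullet> \<nu>)\<^sup>2"
proof -
  let ?S = "{x. \<nu> \<bullet> x = 0}"
  have "\<nu> \<noteq> 0" using \<nu> by auto
  then have "dim ?S = dim (UNIV :: (real^'m) set)"
    using card by (simp add: dim_hyperplane)
  then obtain f :: "real^'n \<Rightarrow> real^'m" and g where f: "linear f" "\<And>x. x \<in> ?S \<Longrightarrow> norm (f x) = norm x"
    using isometries_subspaces[OF subspace_hyperplane subspace_UNIV, of \<nu>] by metis
  define p where "p x = x - (x \<bullet> \<nu>) *\<^sub>R \<nu>" for x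
  have \<nu>\<nu>: "\<nu> \<bullet> \<nu> = 1" using \<nu> by (simp add: norm_eq_1)
  have p: "linear p" unfolding p_def by (intro linearI) (auto simp: inner_add_left algebra_simps)
  have pS: "p x \<in> ?S" for x by (simp add: p_def inner_diff_right \<nu>\<nu> inner_commute)
  have "(norm (f (p x)))\<^sup>2 = (norm x)\<^sup>2 - (x \<bullet> \<nu>)\<^sup>2" for x
  proof -
    have "(norm (f (p x)))\<^sup>2 = p x \<bullet> p x" using f(2)[OF pS] by (simp add: power2_norm_eq_inner)
    also have "\<dots> = x \<bullet> x - (x \<bullet> \<nu>)\<^sup>2"
      unfolding p_def by (simp add: inner_diff_left inner_diff_right \<nu>\<nu> inner_commute[of \<nu> x] power2_eq_square)
    finally show ?thesis by (simp add: power2_norm_eq_inner)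
  qed
  moreover have "linear (f \<circ> p)" using f(1) p by (rule linear_compose[rotated])
  ultimately show ?thesis using that[of "f \<circ> p"] by simp
qed

text \<open>A linear contraction maps the unit ball into itself, hence has determinant at most one in absolute
value.\<close>

lemma measure_linear_image_le:
  fixes M :: "real^'m::{finite,wellorder} \<Rightarrow> real^'m::_"
  assumes M: "linear M" "\<And>e. norm (M e) \<le> norm e" and A: "A \<in> lmeasurable"
  shows "M ` A \<in> lmeasurable" "measure lebesgue (M ` A) \<le> measure lebesgue A"
proof -
  let ?B = "ball (0 :: (real, 'm) vec) 1"
  show mA: "M ` A \<in> lmeasurable" using M(1) A by (rule measurable_linear_image)
  have B: "?B \<in> lmeasurable" by simp
  have "M ` ?B \<subseteq> ?B" by (auto intro: le_less_trans[OF M(2)])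
  then have "\<bar>det (matrix M)\<bar> * measure lebesgue ?B \<le> 1 * measure lebesgue ?B"
    using measure_linear_image[OF M(1) B] measurable_linear_image[OF M(1) B] measure_mono_fmeasurable[of "M ` ?B" ?B lebesgue] B
    by auto
  moreover have "0 < measure lebesgue ?B" by simp
  ultimately have "\<bar>det (matrix M)\<bar> \<le> 1" by (simp only: mult_le_cancel_right)
  then show "measure lebesgue (M ` A) \<le> measure lebesgue A"
    using measure_linear_image[OF M(1) A] by (simp add: mult_left_le_one_le)
qed

definition fat_cube :: "real \<Rightarrow> (real^'m) set" where
  "fat_cube h = {e. \<forall>i. \<bar>e $ i\<bar> \<le> h}"

lemma fat_cube_cbox: "fat_cube h = cbox (\<chi> i. - h) (\<chi> i. h)"
  by (auto simp: fat_cube_def mem_box_cart abs_le_iff minus_le_iff)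

lemma measure_fat_cube: "0 \<le> h \<Longrightarrow> measure lebesgue (fat_cube h :: (real^'m) set) = (2 * h) ^ CARD('m)"
proof -
  assume h: "0 \<le> h"
  then have "(0 :: real^'m) \<in> cbox (\<chi> i. - h) (\<chi> i. h)" by (simp add: mem_box_cart)
  then have "cbox (\<chi> i. - h) (\<chi> i. h) \<noteq> ({} :: (real^'m) set)" by blast
  then show ?thesis unfolding fat_cube_cbox by (simp add: content_cbox_if_cart)
qed

text \<open>The projection \<open>L\<close> along a direction \<open>\<nu>0\<close> near \<open>\<plusminus>\<nu>\<close> nearly annihilates \<open>\<nu>\<close>. So the shadow of the
cube lies in the image \<open>A\<close> of the face orthogonal to \<open>\<nu>\<close>, enlarged by \<open>\<sigma>\<close>, and as \<open>L\<close> is a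
contraction, \<open>A\<close> has at most the measure of the enlarged face. The inner and outer balls bound its
eccentricity.\<close>

lemma cube_shadow:
  fixes \<nu> \<nu>0 :: "real^'n" and L :: "real^'n \<Rightarrow> real^'m::{finite,wellorder}"
  assumes S: "orthonormal_basis_through \<nu> S" and card: "CARD('m) + 1 = CARD('n)"
    and L: "linear L" "\<And>x. (norm (L x))\<^sup>2 = (norm x)\<^sup>2 - (x \<bullet> \<nu>0)\<^sup>2" and \<nu>0: "norm \<nu>0 = 1"
    and \<sigma>: "0 \<le> \<sigma>" "\<sigma> \<le> 1/4" and near: "1 - (\<nu> \<bullet> \<nu>0)\<^sup>2 \<le> \<sigma>\<^sup>2"
  obtains A :: "((real, 'm) vec) set" where "compact A" "L ` unit_cube S \<subseteq> A" "ball 0 (1/4) \<subseteq> A" "A \<subseteq> cball 0 (real CARD('m))"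
    "measure lebesgue A \<le> (1 + 2 * \<sigma>) ^ CARD('m)"
proof -
  note f = orthonormal_basis_facts[OF S]
  have \<nu>: "norm \<nu> = 1" "\<nu> \<bullet> \<nu> = 1" using f(1,5) by (auto simp: norm_eq_1)
  have "card (S - {\<nu>}) = CARD('m)" using f(1,2,3) card by simp
  then obtain \<beta> where \<beta>: "bij_betw \<beta> (UNIV :: 'm set) (S - {\<nu>})"
    using finite_same_card_bij[of "UNIV :: 'm set" "S - {\<nu>}"] f(2) by auto
  have \<beta>S: "\<beta> i \<in> S" "\<beta> i \<noteq> \<nu>" for i using \<beta> by (auto simp: bij_betw_def)
  have \<beta>i: "\<beta> i \<bullet> \<beta> j = (if i = j then 1 else 0)" for i j
    using f(8)[OF \<beta>S(1) \<beta>S(1), of i j] \<beta> by (auto simp: bij_betw_def inj_def)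
  \<comment> \<open>\<open>J\<close> parametrises the hyperplane of the face by the coordinates along the edges, and
    \<open>M = L \<circ> J\<close> is a contraction that is bounded below since \<open>\<nu>\<close> is near \<open>\<plusminus>\<nu>0\<close>.\<close>
  define J :: "(real, 'm) vec \<Rightarrow> real^'n" where "J e = (\<Sum>i\<in>UNIV. e $ i *\<^sub>R \<beta> i)" for e
  have Jl: "linear J" unfolding J_def
    by (intro linearI) (auto simp: scaleR_add_left sum.distrib scaleR_sum_right)
  have Jn: "norm (J e) = norm e" for e
  proof -
    have "J e \<bullet> J e = (\<Sum>i\<in>UNIV. \<Sum>j\<in>UNIV. e $ i * (e $ j * (\<beta> j \<bullet> \<beta> i)))"
      by (simp add: J_def inner_sum_left inner_sum_right sum_distrib_left)
    also have "\<dots> = (\<Sum>i\<in>UNIV. e $ i * e $ i)" by (simp add: \<beta>i if_distrib cong: if_cong)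
    also have "\<dots> = e \<bullet> e" by (simp add: inner_vec_def)
    finally show ?thesis by (simp add: norm_eq_sqrt_inner)
  qed
  have J\<nu>: "J e \<bullet> \<nu> = 0" for e
    using f(8)[OF \<beta>S(1) f(1)] \<beta>S(2) by (simp add: J_def inner_sum_left)
  define M where "M = L \<circ> J"
  have Ml: "linear M" unfolding M_def using Jl L(1) by (rule linear_compose)
  have M1: "norm (M e) \<le> norm e" for e
  proof -
    have "(norm (M e))\<^sup>2 \<le> (norm e)\<^sup>2" by (simp add: M_def L(2) Jn)
    then show ?thesis by (rule power2_le_imp_le) simp
  qed
  have M2: "norm e \<le> 2 * norm (M e)" for e
  proof -
    have gen: "q \<le> a / 16 \<Longrightarrow> 0 \<le> a \<Longrightarrow> a \<le> 4 * (a - q)" for a q :: real by simp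
    have "(norm (\<nu>0 - (\<nu> \<bullet> \<nu>0) *\<^sub>R \<nu>))\<^sup>2 = 1 - (\<nu> \<bullet> \<nu>0)\<^sup>2"
      unfolding power2_norm_eq_inner
      using \<nu>(2) \<nu>0 by (simp add: inner_diff_left inner_diff_right norm_eq_1 inner_commute power2_eq_square)
    then have n: "(norm (\<nu>0 - (\<nu> \<bullet> \<nu>0) *\<^sub>R \<nu>))\<^sup>2 \<le> \<sigma>\<^sup>2" using near by simp
    have "J e \<bullet> \<nu>0 = J e \<bullet> (\<nu>0 - (\<nu> \<bullet> \<nu>0) *\<^sub>R \<nu>)" by (simp add: inner_diff_right J\<nu>)
    then have "(J e \<bullet> \<nu>0)\<^sup>2 \<le> (norm (J e) * norm (\<nu>0 - (\<nu> \<bullet> \<nu>0) *\<^sub>R \<nu>))\<^sup>2"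
      using Cauchy_Schwarz_ineq2[of "J e" "\<nu>0 - (\<nu> \<bullet> \<nu>0) *\<^sub>R \<nu>"] by (metis abs_ge_zero power2_abs power_mono)
    also have "\<dots> \<le> (norm e)\<^sup>2 * \<sigma>\<^sup>2" unfolding power_mult_distrib Jn by (intro mult_left_mono n) simp
    also have "\<dots> \<le> (norm e)\<^sup>2 * (1/4)\<^sup>2" using \<sigma> by (intro mult_left_mono power_mono) auto
    finally have "(J e \<bullet> \<nu>0)\<^sup>2 \<le> (norm e)\<^sup>2 / 16" by (simp add: power_divide)
    then have "(norm e)\<^sup>2 \<le> 4 * ((norm e)\<^sup>2 - (J e \<bullet> \<nu>0)\<^sup>2)" using gen[OF _ zero_le_power2] by blast
    then have "(norm e)\<^sup>2 \<le> (2 * norm (M e))\<^sup>2"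
      by (simp add: M_def L(2) Jn power_mult_distrib)
    then show ?thesis by (rule power2_le_imp_le) simp
  qed
  have "inj M"
    unfolding linear_injective_0[OF Ml] using M2 by (metis mult_zero_right norm_le_zero_iff norm_zero)
  then have "surj M" using Ml using linear_inj_imp_surj by blast
  define A where "A = M ` fat_cube (1/2 + \<sigma>)"
  have inA: "M e \<in> A" if "\<And>i. \<bar>e $ i\<bar> \<le> 1/2 + \<sigma>" for e using that by (auto simp: A_def fat_cube_def)
  have "compact A" unfolding A_def fat_cube_cbox
    using Ml by (intro compact_continuous_image linear_continuous_on linear_conv_bounded_linear[THEN iffD1]) auto
  moreover have "L ` unit_cube S \<subseteq> A"
  proof
    fix z assume "z \<in> L ` unit_cube S"
    then obtain y where y: "y \<in> unit_cube S" "z = L y" by auto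
    have yb: "\<bar>y \<bullet> b\<bar> \<le> 1/2" if "b \<in> S" for b using y(1) that by (auto simp: unit_cube_def abs_le_iff less_imp_le)
    define e :: "(real, 'm) vec" where "e = (\<chi> i. y \<bullet> \<beta> i)"
    have "y = (\<Sum>b\<in>S. (y \<bullet> b) *\<^sub>R b)" by (simp add: f(6))
    also have "\<dots> = (y \<bullet> \<nu>) *\<^sub>R \<nu> + (\<Sum>b\<in>S - {\<nu>}. (y \<bullet> b) *\<^sub>R b)" using f(1,2) by (rule sum.remove[rotated])
    also have "(\<Sum>b\<in>S - {\<nu>}. (y \<bullet> b) *\<^sub>R b) = J e"
      unfolding J_def e_def using \<beta> by (simp add: sum.reindex_bij_betw[symmetric])
    finally have ye: "y = (y \<bullet> \<nu>) *\<^sub>R \<nu> + J e" .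
    \<comment> \<open>the displacement along \<open>\<nu>\<close> is absorbed into a small displacement \<open>u\<close> within the face\<close>
    obtain u where u: "(y \<bullet> \<nu>) *\<^sub>R L \<nu> = M u" using \<open>surj M\<close> by (metis surjD)
    have "(norm (L \<nu>))\<^sup>2 \<le> \<sigma>\<^sup>2" using near \<nu> by (simp add: L(2))
    then have "norm (L \<nu>) \<le> \<sigma>" using \<sigma>(1) by (rule power2_le_imp_le)
    then have "norm (M u) \<le> 1/2 * \<sigma>"
      unfolding u[symmetric] norm_scaleR using yb[OF f(1)] by (intro mult_mono) auto
    then have un: "norm u \<le> \<sigma>" using M2[of u] by simp
    have "L y = (y \<bullet> \<nu>) *\<^sub>R L \<nu> + L (J e)"
      by (subst ye) (simp only: linear_add[OF L(1)] linear_cmul[OF L(1)])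
    also have "\<dots> = M (u + e)" by (simp add: u linear_add[OF Ml]) (simp add: M_def)
    also have "\<dots> \<in> A"
    proof (rule inA)
      fix i
      have "\<bar>u $ i\<bar> \<le> \<sigma>" using component_le_norm_cart[of u i] un by simp
      moreover have "\<bar>e $ i\<bar> \<le> 1/2" using yb[OF \<beta>S(1)] by (simp add: e_def)
      ultimately show "\<bar>(u + e) $ i\<bar> \<le> 1/2 + \<sigma>" by simp
    qed
    finally show "z \<in> A" using y(2) by simp
  qed
  moreover have "ball 0 (1/4) \<subseteq> A"
  proof
    fix z :: "(real, 'm) vec" assume z: "z \<in> ball 0 (1/4)"
    obtain u where u: "z = M u" using \<open>surj M\<close> by (metis surjD)
    have "norm u \<le> 1/2" using M2[of u] z u by simp
    then have "\<bar>u $ i\<bar> \<le> 1/2 + \<sigma>" for i using component_le_norm_cart[of u i] \<sigma>(1) by simp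
    then show "z \<in> A" using inA u by simp
  qed
  moreover have "A \<subseteq> cball 0 (real CARD('m))"
  proof
    fix z assume "z \<in> A"
    then obtain e where e: "z = M e" "\<And>i. \<bar>e $ i\<bar> \<le> 1/2 + \<sigma>" by (auto simp: A_def fat_cube_def)
    have "norm z \<le> norm e" using e M1 by simp
    also have "\<dots> \<le> (\<Sum>i\<in>UNIV. \<bar>e $ i\<bar>)" by (rule norm_le_l1_cart)
    also have "\<dots> \<le> (\<Sum>i\<in>(UNIV::'m set). 1)" using e(2) \<sigma>(2) by (intro sum_mono) (rule order_trans, assumption, simp)
    finally show "z \<in> cball 0 (real CARD('m))" by simp
  qed
  moreover have "measure lebesgue A \<le> (1 + 2 * \<sigma>) ^ CARD('m)"
  proof -
    have "fat_cube (1/2 + \<sigma>) \<in> lmeasurable" unfolding fat_cube_cbox by simp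
    then have "measure lebesgue A \<le> measure lebesgue (fat_cube (1/2 + \<sigma>) :: ((real, 'm) vec) set)"
      unfolding A_def by (rule measure_linear_image_le(2)[OF Ml M1])
    also have "\<dots> = (2 * (1/2 + \<sigma>)) ^ CARD('m)" using \<sigma> by (intro measure_fat_cube) auto
    finally show ?thesis by (simp add: algebra_simps)
  qed
  ultimately show ?thesis using that by blast
qed

lemma hausdorff_outer_0_singleton: "hausdorff_outer 0 {x} \<le> 1"
  unfolding hausdorff_outer_def
proof (rule SUP_least)
  fix \<delta> :: real assume "\<delta> \<in> {0<..}"
  then have "hausdorff_pre 0 \<delta> {x} \<le> (\<Sum>i. hausdorff_weight 0 (if i = (0::nat) then {x} else {}))"
    unfolding hausdorff_pre_def by (intro INF_lower) (auto intro: exI[of _ 0])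
  also have "\<dots> = (\<Sum>i\<in>{0::nat}. hausdorff_weight 0 (if i = 0 then {x} else {}))"
    by (rule suminf_finite) (auto simp: hausdorff_weight_def)
  also have "\<dots> = 1" by (simp add: hausdorff_weight_def)
  finally show "hausdorff_pre 0 \<delta> {x} \<le> 1" .
qed

text \<open>Under the cone condition \<open>\<bar>L (y - x)\<bar>\<^sup>2 \<ge> (1 - \<delta>\<^sup>2) \<bar>y - x\<bar>\<^sup>2\<close>, and \<open>(1 + \<delta>)\<^sup>2 (1 - \<delta>\<^sup>2) \<ge> 1\<close> for
\<open>\<delta> \<le> 1/4\<close>.\<close>

lemma dist_le_dist_projection:
  fixes L :: "real^'n \<Rightarrow> real^'m"
  assumes L: "linear L" "\<And>x. (norm (L x))\<^sup>2 = (norm x)\<^sup>2 - (x \<bullet> \<nu>0)\<^sup>2"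
    and \<delta>: "0 \<le> \<delta>" "\<delta> \<le> 1/4" and cone: "\<bar>(y - x) \<bullet> \<nu>0\<bar> \<le> \<delta> * dist x y"
  shows "dist x y \<le> (1 + \<delta>) * dist (L x) (L y)"
proof -
  have "(norm (L (y - x)))\<^sup>2 = (dist x y)\<^sup>2 - ((y - x) \<bullet> \<nu>0)\<^sup>2" by (simp add: L(2) dist_norm norm_minus_commute)
  moreover have "((y - x) \<bullet> \<nu>0)\<^sup>2 \<le> (\<delta> * dist x y)\<^sup>2"
    using cone by (metis abs_ge_zero power2_abs power_mono)
  ultimately have a: "(1 - \<delta>\<^sup>2) * (dist x y)\<^sup>2 \<le> (norm (L (y - x)))\<^sup>2" by (simp add: algebra_simps power_mult_distrib)
  have "1 \<le> (1 + \<delta>)\<^sup>2 * (1 - \<delta>\<^sup>2)"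
  proof -
    have "(1 + \<delta>)\<^sup>2 * (1 - \<delta>\<^sup>2) - 1 = \<delta> * (2 - 2 * \<delta>\<^sup>2 - \<delta>^3)" by (simp add: power2_eq_square power3_eq_cube algebra_simps)
    moreover have "\<delta>\<^sup>2 \<le> (1/4)\<^sup>2" "\<delta>^3 \<le> (1/4)^3" using \<delta> by (auto intro: power_mono)
    then have "0 \<le> 2 - 2 * \<delta>\<^sup>2 - \<delta>^3" by (simp add: power2_eq_square power3_eq_cube)
    then have "0 \<le> \<delta> * (2 - 2 * \<delta>\<^sup>2 - \<delta>^3)" using \<delta>(1) by (rule mult_nonneg_nonneg[rotated])
    ultimately show ?thesis by linarith
  qed
  then have "(dist x y)\<^sup>2 \<le> ((1 + \<delta>)\<^sup>2 * (1 - \<delta>\<^sup>2)) * (dist x y)\<^sup>2" using mult_right_mono[of 1 "(1 + \<delta>)\<^sup>2 * (1 - \<delta>\<^sup>2)" "(dist x y)\<^sup>2"] by simp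
  also have "\<dots> = (1 + \<delta>)\<^sup>2 * ((1 - \<delta>\<^sup>2) * (dist x y)\<^sup>2)" by simp
  also have "\<dots> \<le> (1 + \<delta>)\<^sup>2 * (norm (L (y - x)))\<^sup>2" using a by (intro mult_left_mono) auto
  also have "\<dots> = ((1 + \<delta>) * dist (L x) (L y))\<^sup>2"
    by (simp add: power_mult_distrib dist_norm linear_diff[OF L(1)] norm_minus_commute)
  finally show ?thesis by (rule power2_le_imp_le) (use \<delta> in auto)
qed

lemma hausdorff_outer_le_measure_projection:
  fixes K :: "(real^'n) set" and L :: "real^'n \<Rightarrow> real^'m"
  assumes L: "linear L" "\<And>x. (norm (L x))\<^sup>2 = (norm x)\<^sup>2 - (x \<bullet> \<nu>0)\<^sup>2" and \<delta>: "0 \<le> \<delta>" "\<delta> \<le> 1/4"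
    and cone: "\<And>x y. x \<in> K \<Longrightarrow> y \<in> K \<Longrightarrow> \<bar>(y - x) \<bullet> \<nu>0\<bar> \<le> \<delta> * dist x y" and T: "L ` K \<in> lmeasurable"
  shows "hausdorff_outer CARD('m) K \<le> ennreal ((1 + \<delta>) ^ CARD('m) * measure lebesgue (L ` K))"
proof -
  let ?s = "CARD('m)" and ?\<mu> = "measure lebesgue"
  have lip: "dist x y \<le> (1 + \<delta>) * dist (L x) (L y)" if "x \<in> K" "y \<in> K" for x y
    using dist_le_dist_projection[OF L \<delta> cone[OF that]] .
  define T where "T = L ` K"
  have T: "T \<in> lmeasurable" using T by (simp add: T_def)
  have "hausdorff_outer ?s K \<le> ennreal ((1 + \<delta>) ^ ?s * ?\<mu> T)"
  proof (rule ennreal_le_epsilon)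
    fix e :: real assume e: "0 < e"
    define e' where "e' = e / (1 + \<delta>) ^ ?s"
    have e': "0 < e'" using e \<delta> by (simp add: e'_def)
    obtain W where W: "open W" "T \<subseteq> W" "W - T \<in> lmeasurable" "emeasure lebesgue (W - T) < ennreal e'"
      using sets_lebesgue_outer_open[of T e'] T e' by (metis fmeasurableD)
    have "W = T \<union> (W - T)" using W(2) by auto
    then have "emeasure lebesgue W \<le> emeasure lebesgue T + emeasure lebesgue (W - T)"
      using W(3) T by (metis emeasure_subadditive fmeasurableD)
    also have "\<dots> \<le> ennreal (?\<mu> T) + ennreal e'" using W(4) T by (intro add_mono) (auto simp: emeasure_eq_measure2)
    finally have "emeasure lebesgue W \<le> ennreal (?\<mu> T + e')" using e' by simp
    moreover have "hausdorff_outer ?s K \<le> ennreal ((1 + \<delta>) ^ ?s) * emeasure lebesgue W"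
      using hausdorff_outer_le_projection[of "1 + \<delta>" K L W] lip \<delta>(1) W(1,2) by (simp add: T_def)
    ultimately have "hausdorff_outer ?s K \<le> ennreal ((1 + \<delta>) ^ ?s) * ennreal (?\<mu> T + e')"
      by (meson mult_left_mono order_trans zero_le)
    also have "\<dots> = ennreal ((1 + \<delta>) ^ ?s * ?\<mu> T) + ennreal e"
      using \<delta> e e' by (simp add: ennreal_mult[symmetric] ennreal_plus[symmetric] distrib_left e'_def del: ennreal_plus)
    finally show "hausdorff_outer ?s K \<le> ennreal ((1 + \<delta>) ^ ?s * ?\<mu> T) + ennreal e" .
  qed
  then show ?thesis by (simp add: T_def)
qed

text \<open>On \<open>K\<close> the projection \<open>L\<close> is injective with Lipschitz inverse \<open>X\<close>. Over each point \<open>z\<close> of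
\<open>T = L ` K\<close> there is a cube centred at \<open>X z\<close>, and \<open>D z \<rho>\<close> is a set of controlled eccentricity that
contains its shadow. Disjoint sets \<open>D z \<rho>\<close> lie under disjoint cubes; they fill almost all of \<open>T\<close>
by the Vitali theorem and have measure at most \<open>(1 + 2 \<delta>)\<^sup>m r\<^sup>m\<close> for an edge of length \<open>r\<close>. The
measure of \<open>T\<close> is at least \<open>(1 + \<delta>)\<^sup>-\<^sup>m\<close> times the Hausdorff measure of \<open>K\<close>.\<close>

lemma cubes_fill_flat_compact_ge2:
  fixes K :: "(real^'n) set" and frm :: "real^'n \<Rightarrow> (real^'n) set" and L :: "real^'n \<Rightarrow> real^'m::{finite,wellorder}"
  assumes card: "CARD('m) + 1 = CARD('n)"
    and L: "linear L" "\<And>x. (norm (L x))\<^sup>2 = (norm x)\<^sup>2 - (x \<bullet> \<nu>0)\<^sup>2" and \<nu>0: "norm \<nu>0 = 1"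
    and K: "compact K" and \<delta>: "0 \<le> \<delta>" "\<delta> \<le> 1/4"
    and cone: "\<And>x y. x \<in> K \<Longrightarrow> y \<in> K \<Longrightarrow> \<bar>(y - x) \<bullet> \<nu>0\<bar> \<le> \<delta> * dist x y"
    and frm: "\<And>x. x \<in> K \<Longrightarrow> orthonormal_basis_through (\<nu> x) (frm x)" "\<And>x. x \<in> K \<Longrightarrow> 1 - (\<nu> x \<bullet> \<nu>0)\<^sup>2 \<le> \<delta>\<^sup>2"
    and R: "\<And>x. x \<in> K \<Longrightarrow> 0 < R x"
    and t: "0 \<le> t" "ennreal (t * ((1 + \<delta>) * (1 + 2 * \<delta>)) ^ CARD('m)) < hausdorff_outer CARD('m) K"
  shows "\<exists>C. finite C \<and> C \<subseteq> K \<times> {0<..} \<and> (\<forall>(x, r)\<in>C. r < R x) \<and>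
    disjoint_shapes (\<lambda>x. cube_at (frm x) x) C \<and>
    t < (\<Sum>i\<in>C. snd i ^ CARD('m))"
proof -
  let ?s = "CARD('m)" and ?\<mu> = "measure lebesgue"
  have s0: "0 < ?s" by simp
  have lip: "dist x y \<le> (1 + \<delta>) * dist (L x) (L y)" if "x \<in> K" "y \<in> K" for x y
    using dist_le_dist_projection[OF L \<delta> cone[OF that]] .
  have inj: "inj_on L K" using lip by (intro inj_onI) fastforce
  define X where "X = inv_into K L"
  have X: "X z \<in> K" "L (X z) = z" if "z \<in> L ` K" for z using that by (auto simp: X_def inv_into_into f_inv_into_f)
  define T where "T = L ` K"
  have "compact T" unfolding T_def using K L(1)
    by (intro compact_continuous_image linear_continuous_on linear_conv_bounded_linear[THEN iffD1])
  then have T: "T \<in> lmeasurable" by (rule lmeasurable_compact)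
  have HT: "hausdorff_outer ?s K \<le> ennreal ((1 + \<delta>) ^ ?s * ?\<mu> T)"
    unfolding T_def by (rule hausdorff_outer_le_measure_projection[OF L \<delta> cone T[unfolded T_def]])
  then have "t * ((1 + \<delta>) * (1 + 2 * \<delta>)) ^ ?s < (1 + \<delta>) ^ ?s * ?\<mu> T"
    using less_le_trans[OF t(2) HT] t(1) \<delta> by (subst (asm) ennreal_less_iff) auto
  then have "(1 + \<delta>) ^ ?s * (t * (1 + 2 * \<delta>) ^ ?s) < (1 + \<delta>) ^ ?s * ?\<mu> T" by (simp add: power_mult_distrib mult_ac)
  then have tT: "t * (1 + 2 * \<delta>) ^ ?s < ?\<mu> T" using \<delta>(1) by (subst (asm) mult_less_cancel_left_pos) auto
  have "\<exists>A :: ((real, 'm) vec) set. compact A \<and> L ` unit_cube (frm x) \<subseteq> A \<and> ball 0 (1/4) \<subseteq> A \<and> A \<subseteq> cball 0 (real ?s)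
      \<and> ?\<mu> A \<le> (1 + 2 * \<delta>) ^ ?s" if "x \<in> K" for x
    using cube_shadow[OF frm(1)[OF that] card L \<nu>0 \<delta> frm(2)[OF that]] by metis
  then obtain A :: "real^'n \<Rightarrow> ((real, 'm) vec) set" where A: "\<And>x. x \<in> K \<Longrightarrow> compact (A x)" "\<And>x. x \<in> K \<Longrightarrow> L ` unit_cube (frm x) \<subseteq> A x"
      "\<And>x. x \<in> K \<Longrightarrow> ball 0 (1/4) \<subseteq> A x" "\<And>x. x \<in> K \<Longrightarrow> A x \<subseteq> cball 0 (real ?s)" "\<And>x. x \<in> K \<Longrightarrow> ?\<mu> (A x) \<le> (1 + 2 * \<delta>) ^ ?s"
    by metis
  \<comment> \<open>The cube has edges of length \<open>\<rho> / m\<close>: as \<open>A\<close> lies in a ball of radius \<open>m\<close>, this makes \<open>D z \<rho>\<close> a subset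
    of the ball of radius \<open>\<rho>\<close>.\<close>
  define D where "D z \<rho> = (\<lambda>a. (\<rho> / real ?s) *\<^sub>R a + z) ` A (X z)" for z \<rho>
  have D: "ball z (1 / (4 * real ?s) * \<rho>) \<subseteq> D z \<rho> \<and> D z \<rho> \<subseteq> cball z \<rho> \<and> compact (D z \<rho>)" if "z \<in> T" "0 < \<rho>" for z \<rho>
  proof (intro conjI)
    have x: "X z \<in> K" using X that by (simp add: T_def)
    define r where "r = \<rho> / real ?s"
    have r: "0 < r" using that by (simp add: r_def)
    show "compact (D z \<rho>)" unfolding D_def using A(1)[OF x] by (intro compact_continuous_image continuous_intros)
    show "ball z (1 / (4 * real ?s) * \<rho>) \<subseteq> D z \<rho>"
    proof
      fix u assume u: "u \<in> ball z (1 / (4 * real ?s) * \<rho>)"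
      have "norm ((1/r) *\<^sub>R (u - z)) = norm (u - z) / r" using r by simp
      also have "\<dots> < 1/4" using u r by (simp add: dist_norm norm_minus_commute r_def field_simps)
      finally have "(1/r) *\<^sub>R (u - z) \<in> A (X z)" using A(3)[OF x] by auto
      moreover have "u = r *\<^sub>R ((1/r) *\<^sub>R (u - z)) + z" using r by simp
      ultimately show "u \<in> D z \<rho>" unfolding D_def r_def[symmetric] by blast
    qed
    show "D z \<rho> \<subseteq> cball z \<rho>"
    proof
      fix u assume "u \<in> D z \<rho>"
      then obtain a where a: "a \<in> A (X z)" "u = r *\<^sub>R a + z" by (auto simp: D_def r_def)
      then have "norm a \<le> real ?s" using A(4)[OF x] by auto
      then have "r * norm a \<le> r * real ?s" using r by (intro mult_left_mono) auto
      moreover have "dist z u = r * norm a" using a(2) r by (simp add: dist_norm)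
      moreover have "r * real ?s = \<rho>" using s0 by (simp add: r_def)
      ultimately show "u \<in> cball z \<rho>" by simp
    qed
  qed
  have \<kappa>: "0 < 1 / (4 * real ?s)" "1 / (4 * real ?s) \<le> 1"
  proof -
    have "1 \<le> real ?s" using s0 by (simp add: Suc_leI)
    then have "0 < 4 * real ?s" "1 \<le> 4 * real ?s" by linarith+
    then show "0 < 1 / (4 * real ?s)" "1 / (4 * real ?s) \<le> 1"
      by (simp_all only: zero_less_divide_1_iff divide_le_eq_1_pos)
  qed
  have R': "0 < real ?s * R (X z)" if "z \<in> T" for z using R[OF X(1)] that by (simp add: T_def)
  have e: "0 < ?\<mu> T - t * (1 + 2 * \<delta>) ^ ?s" using tT by simp
  have "\<exists>C. finite C \<and> C \<subseteq> T \<times> {0<..} \<and> (\<forall>(x, r)\<in>C. r < real ?s * R (X x)) \<and>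
      disjoint_shapes D C \<and>
      ?\<mu> (T - (\<Union>i\<in>C. D (fst i) (snd i))) < ?\<mu> T - t * (1 + 2 * \<delta>) ^ ?s"
    by (rule Vitali_covering_eccentric[OF T \<kappa> D R' e])
  then obtain C where "finite C \<and> C \<subseteq> T \<times> {0<..} \<and> (\<forall>(x, r)\<in>C. r < real ?s * R (X x)) \<and>
      disjoint_shapes D C \<and>
      ?\<mu> (T - (\<Union>i\<in>C. D (fst i) (snd i))) < ?\<mu> T - t * (1 + 2 * \<delta>) ^ ?s" ..
  then have C: "finite C" "C \<subseteq> T \<times> {0<..}" "(x, r) \<in> C \<Longrightarrow> r < real ?s * R (X x)"
      "disjoint_shapes D C"
      "?\<mu> (T - (\<Union>i\<in>C. D (fst i) (snd i))) < ?\<mu> T - t * (1 + 2 * \<delta>) ^ ?s" for x r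
    by blast+
  have CT: "fst i \<in> T" "0 < snd i" if "i \<in> C" for i using C(2) that by auto
  have Dl: "D (fst i) (snd i) \<in> lmeasurable" if "i \<in> C" for i using D[OF CT[OF that]] by (intro lmeasurable_compact) auto
  have Dm: "?\<mu> (D (fst i) (snd i)) \<le> (1 + 2 * \<delta>) ^ ?s * (snd i / real ?s) ^ ?s" if "i \<in> C" for i
  proof -
    have x: "X (fst i) \<in> K" using X CT[OF that] by (simp add: T_def)
    have "?\<mu> (D (fst i) (snd i)) = \<bar>snd i / real ?s\<bar> ^ ?s * ?\<mu> (A (X (fst i)))"
      unfolding D_def using measure_lebesgue_affine[of "snd i / real ?s" "fst i" "A (X (fst i))"] by simp
    also have "\<dots> \<le> \<bar>snd i / real ?s\<bar> ^ ?s * (1 + 2 * \<delta>) ^ ?s" using A(5)[OF x] by (intro mult_left_mono) auto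
    finally show ?thesis using CT[OF that] by (simp add: mult.commute)
  qed
  let ?U = "\<Union>i\<in>C. D (fst i) (snd i)"
  have Ul: "?U \<in> lmeasurable" using C(1) Dl by (intro fmeasurable.finite_UN) auto
  have "?\<mu> T \<le> ?\<mu> (T - ?U) + ?\<mu> ?U"
  proof -
    have "?\<mu> T \<le> ?\<mu> ((T - ?U) \<union> ?U)" using T Ul by (intro measure_mono_fmeasurable) (auto intro: fmeasurable.Un fmeasurable.Diff fmeasurableD)
    also have "\<dots> \<le> ?\<mu> (T - ?U) + ?\<mu> ?U" using T Ul by (intro measure_Un_le) (auto intro: fmeasurableD)
    finally show ?thesis .
  qed
  also have "?\<mu> ?U \<le> (\<Sum>i\<in>C. ?\<mu> (D (fst i) (snd i)))" using C(1) Dl by (intro measure_UNION_le) (auto intro: fmeasurableD)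
  also have "\<dots> \<le> (\<Sum>i\<in>C. (1 + 2 * \<delta>) ^ ?s * (snd i / real ?s) ^ ?s)" using Dm by (rule sum_mono)
  also have "\<dots> = (1 + 2 * \<delta>) ^ ?s * (\<Sum>i\<in>C. (snd i / real ?s) ^ ?s)" by (simp add: sum_distrib_left)
  finally have "(1 + 2 * \<delta>) ^ ?s * t < (1 + 2 * \<delta>) ^ ?s * (\<Sum>i\<in>C. (snd i / real ?s) ^ ?s)" using C(5) by (simp add: mult.commute)
  then have tsum: "t < (\<Sum>i\<in>C. (snd i / real ?s) ^ ?s)" using \<delta>(1) by (subst (asm) mult_less_cancel_left_pos) auto
  define C' where "C' = (\<lambda>i. (X (fst i), snd i / real ?s)) ` C"
  have injC: "inj_on (\<lambda>i. (X (fst i), snd i / real ?s)) C"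
  proof (rule inj_onI)
    fix i j assume "i \<in> C" "j \<in> C" "(X (fst i), snd i / real ?s) = (X (fst j), snd j / real ?s)"
    then have "X (fst i) = X (fst j)" "snd i = snd j" "fst i \<in> L ` K" "fst j \<in> L ` K" using CT(1) s0 by (auto simp: T_def)
    then show "i = j" using X(2) by (metis prod_eqI)
  qed
  have shadow: "L ` cube_at (frm (X (fst i))) (X (fst i)) (snd i / real ?s) \<subseteq> D (fst i) (snd i)" if "i \<in> C" for i
  proof -
    have z: "fst i \<in> L ` K" using CT[OF that] by (simp add: T_def)
    have "L (X (fst i) + (snd i / real ?s) *\<^sub>R y) \<in> D (fst i) (snd i)" if y: "y \<in> unit_cube (frm (X (fst i)))" for y
    proof -
      have "L y \<in> A (X (fst i))" using A(2)[OF X(1)[OF z]] y by auto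
      moreover have "L (X (fst i) + (snd i / real ?s) *\<^sub>R y) = (snd i / real ?s) *\<^sub>R L y + fst i"
        by (simp only: linear_add[OF L(1)] linear_cmul[OF L(1)] X(2)[OF z] add.commute)
      ultimately show ?thesis by (auto simp: D_def)
    qed
    then show ?thesis by (auto simp: cube_at_def)
  qed
  show ?thesis
  proof (intro exI[of _ C'] conjI)
    show "finite C'" using C(1) by (simp add: C'_def)
    show "C' \<subseteq> K \<times> {0<..}" using CT X(1) s0 by (fastforce simp: C'_def T_def)
    show "\<forall>(x, r)\<in>C'. r < R x"
    proof -
      have "snd i / real ?s < R (X (fst i))" if "i \<in> C" for i
        using C(3)[of "fst i" "snd i"] that s0 by (simp add: field_simps)
      then show ?thesis by (auto simp: C'_def)
    qed
    show "disjoint_shapes (\<lambda>x. cube_at (frm x) x) C'"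
      unfolding pairwise_def
    proof (intro ballI impI)
      fix a b assume ab: "a \<in> C'" "b \<in> C'" "a \<noteq> b"
      obtain i j where i: "i \<in> C" "a = (X (fst i), snd i / real ?s)" and j: "j \<in> C" "b = (X (fst j), snd j / real ?s)"
        using ab(1,2) by (auto simp: C'_def)
      have "i \<noteq> j" using ab(3) i(2) j(2) by blast
      then have "disjnt (D (fst i) (snd i)) (D (fst j) (snd j))" using pairwiseD[OF C(4) i(1) j(1)] by blast
      then show "disjnt (cube_at (frm (fst a)) (fst a) (snd a)) (cube_at (frm (fst b)) (fst b) (snd b))"
        using shadow[OF i(1)] shadow[OF j(1)] i(2) j(2) unfolding disjnt_def by fastforce
    qed
    show "t < (\<Sum>i\<in>C'. snd i ^ ?s)" using tsum injC by (simp add: C'_def sum.reindex)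
  qed
qed

text \<open>On a line there is no direction orthogonal to \<open>\<nu>0\<close>, so flat sets are single points.\<close>

lemma flat_dimension_one:
  fixes x y \<nu>0 :: "real^'n"
  assumes N: "CARD('n) = 1" and \<nu>0: "norm \<nu>0 = 1" and \<delta>: "\<delta> \<le> 1/4" and cone: "\<bar>(y - x) \<bullet> \<nu>0\<bar> \<le> \<delta> * dist x y"
  shows "y = x"
proof -
  obtain i :: 'n where i: "(UNIV :: 'n set) = {i}" using N by (metis card_1_singletonE)
  have n: "norm z = \<bar>z $ i\<bar>" for z :: "real^'n" by (simp add: norm_vec_def L2_set_def i)
  have "\<bar>(y - x) \<bullet> \<nu>0\<bar> = norm (y - x) * norm \<nu>0" by (simp add: inner_vec_def i n abs_mult)
  then have "dist x y \<le> \<delta> * dist x y" using cone \<nu>0 by (simp add: dist_norm norm_minus_commute)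
  also have "\<dots> \<le> 1/4 * dist x y" using \<delta> by (intro mult_right_mono) auto
  finally show ?thesis by simp
qed

text \<open>The factor \<open>1 + \<delta>\<close> accounts for the slope of \<open>K\<close>, the factor \<open>1 + 2 \<delta>\<close> for the tilt of the cubes.\<close>

lemma cubes_fill_flat_compact:
  fixes K :: "(real^'n) set" and frm :: "real^'n \<Rightarrow> (real^'n) set"
  assumes \<nu>0: "norm \<nu>0 = 1" and K: "compact K" and \<delta>: "0 \<le> \<delta>" "\<delta> \<le> 1/4"
    and cone: "\<And>x y. x \<in> K \<Longrightarrow> y \<in> K \<Longrightarrow> \<bar>(y - x) \<bullet> \<nu>0\<bar> \<le> \<delta> * dist x y"
    and frm: "\<And>x. x \<in> K \<Longrightarrow> orthonormal_basis_through (\<nu> x) (frm x)" "\<And>x. x \<in> K \<Longrightarrow> 1 - (\<nu> x \<bullet> \<nu>0)\<^sup>2 \<le> \<delta>\<^sup>2"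
    and R: "\<And>x. x \<in> K \<Longrightarrow> 0 < R x"
    and t: "0 \<le> t" "ennreal (t * ((1 + \<delta>) * (1 + 2 * \<delta>)) ^ (CARD('n) - 1)) < hausdorff_outer (CARD('n) - 1) K"
  shows "\<exists>C. finite C \<and> C \<subseteq> K \<times> {0<..} \<and> (\<forall>(x, r)\<in>C. r < R x) \<and>
    disjoint_shapes (\<lambda>x. cube_at (frm x) x) C \<and>
    t < (\<Sum>i\<in>C. snd i ^ (CARD('n) - 1))"
proof (cases "CARD('n) = 1")
  case False
  then have card: "CARD('n pred_index) + 1 = CARD('n)" by (rule card_pred_index)
  then have N: "CARD('n) - 1 = CARD('n pred_index)" by simp
  obtain L :: "real^'n \<Rightarrow> real^'n pred_index" where L: "linear L" "\<And>x. (norm (L x))\<^sup>2 = (norm x)\<^sup>2 - (x \<bullet> \<nu>0)\<^sup>2"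
    using projection_along_exists[OF \<nu>0 card] by blast
  show ?thesis
    unfolding N by (rule cubes_fill_flat_compact_ge2[OF card L \<nu>0 K \<delta> cone frm R t(1) t(2)[unfolded N]])
next
  case True
  have "K \<noteq> {}" using t by (auto simp: hausdorff_outer_empty)
  then obtain x where x: "x \<in> K" by auto
  have only: "y = x" if "y \<in> K" for y
    using flat_dimension_one[OF True \<nu>0 \<delta>(2) cone[OF x that]] .
  have Kx: "K = {x}" using x only by blast
  have "ennreal t < hausdorff_outer 0 {x}" using t True Kx by simp
  also have "\<dots> \<le> 1" by (rule hausdorff_outer_0_singleton)
  finally have "t < 1" using t(1) by (simp add: ennreal_less_iff ennreal_1[symmetric] del: ennreal_1)
  then show ?thesis
    using True R[OF x] x by (intro exI[of _ "{(x, R x / 2)}"]) (auto simp: pairwise_def)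
qed

lemma hausdorff_outer_flat_compact_finite:
  fixes K :: "(real^'n) set"
  assumes \<nu>0: "norm \<nu>0 = 1" and K: "compact K" and \<delta>: "0 \<le> \<delta>" "\<delta> \<le> 1/4"
    and cone: "\<And>x y. x \<in> K \<Longrightarrow> y \<in> K \<Longrightarrow> \<bar>(y - x) \<bullet> \<nu>0\<bar> \<le> \<delta> * dist x y"
  shows "hausdorff_outer (CARD('n) - 1) K < top"
proof (cases "CARD('n) = 1")
  case False
  then have card: "CARD('n pred_index) + 1 = CARD('n)" by (rule card_pred_index)
  then have N: "CARD('n) - 1 = CARD('n pred_index)" by simp
  obtain L :: "real^'n \<Rightarrow> real^'n pred_index" where L: "linear L" "\<And>x. (norm (L x))\<^sup>2 = (norm x)\<^sup>2 - (x \<bullet> \<nu>0)\<^sup>2"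
    using projection_along_exists[OF \<nu>0 card] by blast
  have "compact (L ` K)" using K L(1)
    by (intro compact_continuous_image linear_continuous_on linear_conv_bounded_linear[THEN iffD1])
  from hausdorff_outer_le_measure_projection[OF L \<delta> cone lmeasurable_compact[OF this]]
  show ?thesis unfolding N by (rule le_less_trans) auto
next
  case True
  show ?thesis
  proof (cases "K = {}")
    case False
    then obtain x where x: "x \<in> K" by auto
    then have "K = {x}" using flat_dimension_one[OF True \<nu>0 \<delta>(2) cone] by blast
    then show ?thesis using hausdorff_outer_0_singleton[of x] True by (simp add: le_less_trans)
  qed (simp add: hausdorff_outer_empty)
qed


section \<open>Covering the jump set by closed nearly flat pieces\<close>

text \<open>The part of the half-ball above height \<open>\<tau> r\<close>. Cutting off the flat side makes room for small
changes of the normal: a cap with an approximate normal lies inside the half-ball with the exact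
one.\<close>

definition cap :: "'a::euclidean_space \<Rightarrow> 'a \<Rightarrow> real \<Rightarrow> real \<Rightarrow> 'a set" where
  "cap x \<nu> \<tau> r = {y \<in> ball x r. \<tau> * r < (y - x) \<bullet> \<nu>}"

lemma open_cap: "open (cap x \<nu> \<tau> r)"
proof -
  have "cap x \<nu> \<tau> r = ball x r \<inter> {y. \<tau> * r < (y - x) \<bullet> \<nu>}" by (auto simp: cap_def)
  then show ?thesis by (auto intro!: open_Int open_Collect_less continuous_intros)
qed

text \<open>Caps are open, so a point of a cap belongs to the caps about all nearby centres, and Fatou's lemma
applies.\<close>

lemma nn_integral_cap_lsc:
  fixes f :: "real^'N \<Rightarrow> ennreal"
  assumes f: "f \<in> borel_measurable lebesgue" and X: "X \<longlonglongrightarrow> x"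
    and le: "\<And>n. (\<integral>\<^sup>+y\<in>cap (X n) \<nu> \<tau> r. f y \<partial>lebesgue) \<le> c"
  shows "(\<integral>\<^sup>+y\<in>cap x \<nu> \<tau> r. f y \<partial>lebesgue) \<le> c"
proof -
  have "f y * indicator (cap x \<nu> \<tau> r) y \<le> liminf (\<lambda>n. f y * indicator (cap (X n) \<nu> \<tau> r) y)" for y
  proof (cases "y \<in> cap x \<nu> \<tau> r")
    case True
    have "(\<lambda>n. dist (X n) y) \<longlonglongrightarrow> dist x y" "(\<lambda>n. (y - X n) \<bullet> \<nu>) \<longlonglongrightarrow> (y - x) \<bullet> \<nu>"
      using X by (auto intro!: tendsto_intros)
    then have "eventually (\<lambda>n. dist (X n) y < r) sequentially" "eventually (\<lambda>n. \<tau> * r < (y - X n) \<bullet> \<nu>) sequentially"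
      using True by (auto simp: cap_def intro: order_tendstoD)
    then have "eventually (\<lambda>n. f y \<le> f y * indicator (cap (X n) \<nu> \<tau> r) y) sequentially"
      by eventually_elim (simp add: cap_def)
    then show ?thesis using True by (auto intro: Liminf_bounded)
  qed simp
  then have "(\<integral>\<^sup>+y\<in>cap x \<nu> \<tau> r. f y \<partial>lebesgue) \<le> (\<integral>\<^sup>+y. liminf (\<lambda>n. f y * indicator (cap (X n) \<nu> \<tau> r) y) \<partial>lebesgue)"
    by (intro nn_integral_mono)
  also have "\<dots> \<le> liminf (\<lambda>n. \<integral>\<^sup>+y\<in>cap (X n) \<nu> \<tau> r. f y \<partial>lebesgue)"
    using f by (intro nn_integral_liminf borel_measurable_times_ennreal borel_measurable_indicator) (auto simp: open_cap)
  also have "\<dots> \<le> c"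
    using le by (intro Liminf_le) auto
  finally show ?thesis .
qed

text \<open>The points at which \<open>g\<close> deviates little from \<open>a\<close> above and from \<open>b\<close> below, at all scales up to
\<open>\<rho>\<close>, with respect to a fixed direction. Every jump point of \<open>g\<close> belongs to such a set, with
parameters from a countable family.\<close>

definition flat_piece :: "(real^'N \<Rightarrow> 'b::euclidean_space) \<Rightarrow> real \<Rightarrow> 'b \<Rightarrow> 'b \<Rightarrow> real^'N \<Rightarrow> real \<Rightarrow> real \<Rightarrow> (real^'N) set" where
  "flat_piece g \<tau> a b \<nu> \<rho> \<eta> = {x. \<forall>r. 0 < r \<and> r \<le> \<rho> \<longrightarrow>
     deviation g a (cap x \<nu> \<tau> r) \<le> ennreal (\<eta> * r ^ CARD('N)) \<and>
     deviation g b (cap x (- \<nu>) \<tau> r) \<le> ennreal (\<eta> * r ^ CARD('N))}"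

lemma measurable_norm_diff:
  fixes g :: "real^'N \<Rightarrow> 'b::euclidean_space"
  assumes "g \<in> borel_measurable lebesgue"
  shows "(\<lambda>y. ennreal (norm (g y - a))) \<in> borel_measurable lebesgue"
  using assms by (intro measurable_compose[OF _ measurable_ennreal] borel_measurable_norm borel_measurable_diff) auto

lemma closed_flat_piece:
  fixes g :: "real^'N \<Rightarrow> 'b::euclidean_space"
  assumes g: "g \<in> borel_measurable lebesgue"
  shows "closed (flat_piece g \<tau> a b \<nu> \<rho> \<eta>)"
  unfolding closed_sequential_limits
proof (intro allI impI, elim conjE)
  fix X x assume X: "\<forall>n. X n \<in> flat_piece g \<tau> a b \<nu> \<rho> \<eta>" "X \<longlonglongrightarrow> x"
  then show "x \<in> flat_piece g \<tau> a b \<nu> \<rho> \<eta>"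
    unfolding flat_piece_def
    by (auto intro!: nn_integral_cap_lsc[OF measurable_norm_diff[OF g] X(2)])
qed

text \<open>The triangle inequality for \<open>a\<close>, \<open>g y\<close>, \<open>b\<close>, integrated over the common ball. It is used to show
that caps on which \<open>g\<close> is near different values cannot overlap much.\<close>

lemma overlap_bound:
  fixes g :: "real^'N \<Rightarrow> 'b::euclidean_space"
  assumes g: "g \<in> borel_measurable lebesgue" and s: "0 \<le> s" and sub: "ball q s \<subseteq> A" "ball q s \<subseteq> B"
    and A: "deviation g a A \<le> ennreal \<alpha>"
    and B: "deviation g b B \<le> ennreal \<beta>" and "0 \<le> \<alpha>" "0 \<le> \<beta>"
  shows "norm (a - b) * (unit_ball_vol (real CARD('N)) * s ^ CARD('N)) \<le> \<alpha> + \<beta>"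
proof -
  let ?B = "ball q s"
  have m: "(\<lambda>y. ennreal (norm (g y - c)) * indicator ?B y) \<in> borel_measurable lebesgue" for c
    by (intro borel_measurable_times_ennreal measurable_norm_diff[OF g] borel_measurable_indicator) simp
  have "ennreal (norm (a - b) * (unit_ball_vol (real CARD('N)) * s ^ CARD('N))) = ennreal (norm (a - b)) * emeasure lebesgue ?B"
    using s by (simp add: emeasure_ball ennreal_mult)
  also have "\<dots> = (\<integral>\<^sup>+y. ennreal (norm (a - b)) * indicator ?B y \<partial>lebesgue)"
    by (rule nn_integral_cmult_indicator[symmetric]) simp
  also have "\<dots> \<le> (\<integral>\<^sup>+y. ennreal (norm (g y - a)) * indicator ?B y + ennreal (norm (g y - b)) * indicator ?B y \<partial>lebesgue)"
  proof (rule nn_integral_mono)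
    fix y
    have "norm (a - b) \<le> norm (g y - a) + norm (g y - b)"
      using norm_triangle_ineq4[of "g y - b" "g y - a"] by simp
    then show "ennreal (norm (a - b)) * indicator ?B y \<le> ennreal (norm (g y - a)) * indicator ?B y + ennreal (norm (g y - b)) * indicator ?B y"
      by (auto simp: indicator_def ennreal_plus[symmetric] simp del: ennreal_plus)
  qed
  also have "\<dots> = deviation g a ?B + deviation g b ?B"
    by (rule nn_integral_add[OF m m])
  also have "\<dots> \<le> ennreal \<alpha> + ennreal \<beta>"
    using sub by (intro add_mono order_trans[OF nn_integral_mono A] order_trans[OF nn_integral_mono B]) (auto simp: indicator_def)
  also have "\<dots> = ennreal (\<alpha> + \<beta>)" using assms by simp
  finally show ?thesis using assms by (simp add: ennreal_le_iff del: ennreal_plus)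
qed

text \<open>Let \<open>D = dist x z\<close>. If \<open>z\<close> were higher above \<open>x\<close> than \<open>\<delta> D\<close>, the ball of radius \<open>\<delta> D / 4\<close> about
the midpoint would lie in the upper cap of \<open>x\<close> and in the lower cap of \<open>z\<close> at scale \<open>2 D\<close>, where
\<open>g\<close> is near \<open>a\<close> and near \<open>b\<close>, respectively. The threshold for \<open>\<eta>\<close> is the one at which
\<open>overlap_bound\<close> yields a contradiction.\<close>

lemma flat_piece_cone_aux:
  fixes g :: "real^'N \<Rightarrow> 'b::euclidean_space"
  assumes g: "g \<in> borel_measurable lebesgue" and \<delta>: "0 < \<delta>" "\<delta> \<le> 1" and \<nu>: "norm \<nu> = 1" and \<eta>: "0 \<le> \<eta>"
    and \<eta>2: "2 * \<eta> < norm (a - b) * (unit_ball_vol (real CARD('N)) * (\<delta> / 8) ^ CARD('N))"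
    and x: "x \<in> flat_piece g (\<delta> / 8) a b \<nu> \<rho> \<eta>" and z: "z \<in> flat_piece g (\<delta> / 8) a b \<nu> \<rho> \<eta>"
    and d: "dist x z \<le> \<rho> / 2"
  shows "(z - x) \<bullet> \<nu> \<le> \<delta> * dist x z"
proof (rule ccontr)
  let ?N = "CARD('N)" and ?V = "unit_ball_vol (real CARD('N))"
  define D where "D = dist x z"
  assume "\<not> ?thesis"
  then have gt: "\<delta> * D < (z - x) \<bullet> \<nu>" by (simp add: D_def)
  have D: "0 < D" using gt by (cases "x = z") (auto simp: D_def)
  define q where "q = (1/2) *\<^sub>R (x + z)"
  have qx: "q - x = (1/2) *\<^sub>R (z - x)" and qz: "q - z = - ((1/2) *\<^sub>R (z - x))"
    unfolding q_def by (simp_all add: vec_eq_iff field_simps)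
  have u\<nu>: "\<bar>(y - q) \<bullet> \<nu>\<bar> < \<delta> * D / 4" "norm (y - q) < \<delta> * D / 4" if "y \<in> ball q (\<delta> * D / 4)" for y
  proof -
    show n: "norm (y - q) < \<delta> * D / 4" using that by (simp add: dist_norm norm_minus_commute)
    show "\<bar>(y - q) \<bullet> \<nu>\<bar> < \<delta> * D / 4" using Cauchy_Schwarz_ineq2[of "y - q" \<nu>] n \<nu> by simp
  qed
  have \<delta>D: "\<delta> * D \<le> D" using \<delta> D by simp
  have b1: "ball q (\<delta> * D / 4) \<subseteq> cap x \<nu> (\<delta> / 8) (2 * D)"
  proof
    fix y assume y: "y \<in> ball q (\<delta> * D / 4)"
    have "(y - x) \<bullet> \<nu> = (y - q) \<bullet> \<nu> + (q - x) \<bullet> \<nu>" by (simp add: inner_diff_left)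
    also have "(q - x) \<bullet> \<nu> = (z - x) \<bullet> \<nu> / 2" by (simp add: qx)
    finally have 1: "\<delta> / 8 * (2 * D) < (y - x) \<bullet> \<nu>" using u\<nu>(1)[OF y] gt by linarith
    have "norm (y - x) \<le> norm (y - q) + norm (q - x)" using norm_triangle_ineq[of "y - q" "q - x"] by simp
    also have "norm (q - x) = D / 2" by (simp add: qx D_def dist_norm norm_minus_commute)
    finally have "norm (y - x) < 2 * D" using u\<nu>(2)[OF y] \<delta>D D by linarith
    then show "y \<in> cap x \<nu> (\<delta> / 8) (2 * D)" using 1 by (simp add: cap_def dist_norm norm_minus_commute)
  qed
  have b2: "ball q (\<delta> * D / 4) \<subseteq> cap z (- \<nu>) (\<delta> / 8) (2 * D)"
  proof
    fix y assume y: "y \<in> ball q (\<delta> * D / 4)"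
    have "(y - z) \<bullet> (- \<nu>) = - ((y - q) \<bullet> \<nu>) - (q - z) \<bullet> \<nu>" by (simp add: inner_diff_left)
    also have "(q - z) \<bullet> \<nu> = - ((z - x) \<bullet> \<nu> / 2)" by (simp add: qz)
    finally have 1: "\<delta> / 8 * (2 * D) < (y - z) \<bullet> (- \<nu>)" using u\<nu>(1)[OF y] gt by linarith
    have "norm (y - z) \<le> norm (y - q) + norm (q - z)" using norm_triangle_ineq[of "y - q" "q - z"] by simp
    also have "norm (q - z) = D / 2" by (simp add: qz D_def dist_norm norm_minus_commute)
    finally have "norm (y - z) < 2 * D" using u\<nu>(2)[OF y] \<delta>D D by linarith
    then show "y \<in> cap z (- \<nu>) (\<delta> / 8) (2 * D)" using 1 by (simp add: cap_def dist_norm norm_minus_commute)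
  qed
  have r: "0 < 2 * D" "2 * D \<le> \<rho>" using D d by (auto simp: D_def)
  have "norm (a - b) * (?V * (\<delta> * D / 4) ^ ?N) \<le> \<eta> * (2 * D) ^ ?N + \<eta> * (2 * D) ^ ?N"
  proof (rule overlap_bound[OF g _ b1 b2])
    show "deviation g a (cap x \<nu> (\<delta> / 8) (2 * D)) \<le> ennreal (\<eta> * (2 * D) ^ ?N)"
      using x r unfolding flat_piece_def by blast
    show "deviation g b (cap z (- \<nu>) (\<delta> / 8) (2 * D)) \<le> ennreal (\<eta> * (2 * D) ^ ?N)"
      using z r unfolding flat_piece_def by blast
  qed (use D \<delta> \<eta> in auto)
  also have "\<delta> * D / 4 = \<delta> / 8 * (2 * D)" by simp
  also have "(\<delta> / 8 * (2 * D)) ^ ?N = (\<delta> / 8) ^ ?N * (2 * D) ^ ?N" by (rule power_mult_distrib)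
  finally have "(norm (a - b) * (?V * (\<delta> / 8) ^ ?N)) * (2 * D) ^ ?N \<le> (2 * \<eta>) * (2 * D) ^ ?N"
    by (simp only: mult.assoc distrib_right[symmetric] mult_2)
  then have "norm (a - b) * (?V * (\<delta> / 8) ^ ?N) \<le> 2 * \<eta>" using r(1) by (simp only: mult_le_cancel_right_pos zero_less_power)
  then show False using \<eta>2 by simp
qed

lemma flat_piece_cone:
  fixes g :: "real^'N \<Rightarrow> 'b::euclidean_space"
  assumes "g \<in> borel_measurable lebesgue" and "0 < \<delta>" "\<delta> \<le> 1" and "norm \<nu> = 1" and "0 \<le> \<eta>"
    and "2 * \<eta> < norm (a - b) * (unit_ball_vol (real CARD('N)) * (\<delta> / 8) ^ CARD('N))"
    and x: "x \<in> flat_piece g (\<delta> / 8) a b \<nu> \<rho> \<eta>" and z: "z \<in> flat_piece g (\<delta> / 8) a b \<nu> \<rho> \<eta>"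
    and d: "dist x z \<le> \<rho> / 2"
  shows "\<bar>(z - x) \<bullet> \<nu>\<bar> \<le> \<delta> * dist x z"
proof -
  have "(z - x) \<bullet> \<nu> \<le> \<delta> * dist x z" by (rule flat_piece_cone_aux[OF assms])
  moreover have "(x - z) \<bullet> \<nu> \<le> \<delta> * dist z x"
    by (rule flat_piece_cone_aux[OF assms(1-6) z x]) (use d in \<open>simp add: dist_commute\<close>)
  ultimately show ?thesis by (simp add: inner_diff_left dist_commute abs_le_iff)
qed

text \<open>If the half-ball with normal \<open>\<mu>\<close> were tilted by more than \<open>\<delta>\<close> against \<open>\<nu>\<close>, it would contain balls
of radius \<open>\<delta> r / 8\<close> of the upper and of the lower cap. But \<open>g\<close> has the single limit \<open>c\<close> in the
half-ball, and \<open>c\<close> cannot be near both \<open>a\<close> and \<open>b\<close>.\<close>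

lemma flat_piece_normal:
  fixes g :: "real^'N \<Rightarrow> 'b::euclidean_space"
  assumes g: "g \<in> borel_measurable lebesgue" and \<delta>: "0 < \<delta>" "\<delta> \<le> 1" and \<nu>: "norm \<nu> = 1" and \<mu>: "norm \<mu> = 1" and \<eta>: "0 \<le> \<eta>"
    and \<eta>2: "2 * \<eta> < norm (a - b) * (unit_ball_vol (real CARD('N)) * (\<delta> / 8) ^ CARD('N))" and \<rho>: "0 < \<rho>"
    and x: "x \<in> flat_piece g (\<delta> / 8) a b \<nu> \<rho> \<eta>"
    and lim: "\<And>e. 0 < e \<Longrightarrow> eventually (\<lambda>r. deviation g c (half_ball x \<mu> r) \<le> ennreal (e * r ^ CARD('N))) (at_right 0)"
  shows "1 - (\<mu> \<bullet> \<nu>)\<^sup>2 \<le> \<delta>\<^sup>2"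
proof (rule ccontr)
  let ?N = "CARD('N)" and ?V = "unit_ball_vol (real CARD('N))"
  assume "\<not> ?thesis"
  then have gt: "\<delta>\<^sup>2 < 1 - (\<mu> \<bullet> \<nu>)\<^sup>2" by simp
  have \<nu>\<nu>: "\<nu> \<bullet> \<nu> = 1" and \<mu>\<mu>: "\<mu> \<bullet> \<mu> = 1" using \<nu> \<mu> by (auto simp: norm_eq_1)
  \<comment> \<open>the part of \<open>\<mu>\<close> orthogonal to \<open>\<nu>\<close>; moving in its direction one stays on the level of \<open>x\<close> with
    respect to \<open>\<nu>\<close> and gets inside the half-ball of \<open>\<mu>\<close>\<close>
  define p where "p = \<mu> - (\<mu> \<bullet> \<nu>) *\<^sub>R \<nu>"
  have p2: "p \<bullet> p = 1 - (\<mu> \<bullet> \<nu>)\<^sup>2" unfolding p_def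
    by (simp add: inner_diff_left inner_diff_right \<nu>\<nu> \<mu>\<mu> inner_commute[of \<nu> \<mu>] power2_eq_square)
  have p\<nu>: "p \<bullet> \<nu> = 0" by (simp add: p_def inner_diff_left \<nu>\<nu>)
  have p\<mu>: "p \<bullet> \<mu> = 1 - (\<mu> \<bullet> \<nu>)\<^sup>2" by (simp add: p_def inner_diff_left \<mu>\<mu> inner_commute[of \<nu> \<mu>] power2_eq_square)
  have np: "\<delta> < norm p"
  proof (rule power2_less_imp_less)
    show "\<delta>\<^sup>2 < (norm p)\<^sup>2" using gt by (simp add: power2_norm_eq_inner p2)
  qed simp
  have p0: "0 < norm p" using np \<delta> by linarith
  define w where "w = (1 / norm p) *\<^sub>R p"
  have nw: "norm w = 1" using p0 by (simp add: w_def)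
  have w\<nu>: "w \<bullet> \<nu> = 0" by (simp add: w_def p\<nu>)
  have w\<mu>: "w \<bullet> \<mu> = norm p"
  proof -
    have "p \<bullet> \<mu> = norm p * norm p" using p2 p\<mu> by (metis power2_eq_square power2_norm_eq_inner)
    then show ?thesis using p0 by (simp add: w_def)
  qed
  have \<nu>\<mu>: "\<bar>\<nu> \<bullet> \<mu>\<bar> \<le> 1" using Cauchy_Schwarz_ineq2[of \<nu> \<mu>] \<nu> \<mu> by simp
  have sub: "ball (x + r *\<^sub>R ((1/2) *\<^sub>R w + (\<delta> / 4) *\<^sub>R \<kappa>)) (\<delta> / 8 * r) \<subseteq> cap x \<kappa> (\<delta> / 8) r"
       "ball (x + r *\<^sub>R ((1/2) *\<^sub>R w + (\<delta> / 4) *\<^sub>R \<kappa>)) (\<delta> / 8 * r) \<subseteq> half_ball x \<mu> r"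
    if r: "0 < r" and \<kappa>: "\<kappa> = \<nu> \<or> \<kappa> = - \<nu>" for r \<kappa>
  proof -
    let ?q = "(1/2) *\<^sub>R w + (\<delta> / 4) *\<^sub>R \<kappa>"
    have \<kappa>1: "\<kappa> \<bullet> \<kappa> = 1" "w \<bullet> \<kappa> = 0" "\<bar>\<kappa> \<bullet> \<mu>\<bar> \<le> 1" "norm \<kappa> = 1" using \<kappa> \<nu>\<nu> w\<nu> \<nu>\<mu> \<nu> by auto
    have "y \<in> cap x \<kappa> (\<delta> / 8) r \<and> y \<in> half_ball x \<mu> r" if y: "y \<in> ball (x + r *\<^sub>R ?q) (\<delta> / 8 * r)" for y
    proof -
      define u where "u = y - (x + r *\<^sub>R ?q)"
      have yu: "y - x = r *\<^sub>R ?q + u" by (simp add: u_def)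
      have un: "norm u < \<delta> / 8 * r" using y by (simp add: u_def dist_norm norm_minus_commute)
      have u1: "\<bar>u \<bullet> \<kappa>\<bar> < \<delta> / 8 * r" using Cauchy_Schwarz_ineq2[of u \<kappa>] un \<kappa>1 by simp
      have u2: "\<bar>u \<bullet> \<mu>\<bar> < \<delta> / 8 * r" using Cauchy_Schwarz_ineq2[of u \<mu>] un \<mu> by simp
      have "(y - x) \<bullet> \<kappa> = r * (\<delta> / 4) + u \<bullet> \<kappa>" by (simp add: yu inner_add_left \<kappa>1)
      then have 1: "\<delta> / 8 * r < (y - x) \<bullet> \<kappa>" using u1 by (simp add: field_simps)
      have m: "- (r * (\<delta> / 4)) \<le> r * (\<delta> / 4 * (\<kappa> \<bullet> \<mu>))"
      proof -
        have "r * (\<delta> / 4) * (- 1) \<le> r * (\<delta> / 4) * (\<kappa> \<bullet> \<mu>)" using r \<delta> \<kappa>1(3) by (intro mult_left_mono) auto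
        then show ?thesis by (simp add: mult.assoc)
      qed
      have "r * (\<delta> / 2) \<le> r * (norm p / 2)" using np r by (intro mult_left_mono) auto
      moreover have "(y - x) \<bullet> \<mu> = r * (norm p / 2) + r * (\<delta> / 4 * (\<kappa> \<bullet> \<mu>)) + u \<bullet> \<mu>"
        by (simp add: yu inner_add_left w\<mu> distrib_left)
      moreover have "0 < r * \<delta>" using r \<delta> by simp
      ultimately have 2: "0 < (y - x) \<bullet> \<mu>" using u2 m by (simp add: field_simps)
      have "norm ?q \<le> 1/2 + \<delta> / 4" using norm_triangle_ineq[of "(1/2) *\<^sub>R w" "(\<delta> / 4) *\<^sub>R \<kappa>"] nw \<kappa>1(4) \<delta> by simp
      then have "r * norm ?q \<le> r * (1/2 + \<delta> / 4)" using r by (intro mult_left_mono) auto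
      moreover have lin: "r * (1/2 + \<delta> / 4) = r / 2 + (r * \<delta>) / 4" "\<delta> / 8 * r = (r * \<delta>) / 8" by (simp_all add: algebra_simps)
      moreover have "norm (y - x) \<le> r * norm ?q + norm u" using norm_triangle_ineq[of "r *\<^sub>R ?q" u] r by (simp add: yu)
      moreover have "r * \<delta> \<le> r" using \<delta> r by simp
      ultimately have "norm (y - x) < r" using un r lin by linarith
      then show ?thesis using 1 2 by (simp add: cap_def half_ball_def dist_norm norm_minus_commute)
    qed
    then show "ball (x + r *\<^sub>R ?q) (\<delta> / 8 * r) \<subseteq> cap x \<kappa> (\<delta> / 8) r" "ball (x + r *\<^sub>R ?q) (\<delta> / 8 * r) \<subseteq> half_ball x \<mu> r"
      by blast+
  qed
  define G where "G = norm (a - b) * (?V * (\<delta> / 8) ^ ?N) - 2 * \<eta>"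
  have G: "0 < G" using \<eta>2 by (simp add: G_def)
  have "eventually (\<lambda>r. deviation g c (half_ball x \<mu> r) \<le> ennreal (G / 4 * r ^ ?N)) (at_right 0)"
    using G by (intro lim) simp
  moreover have "eventually (\<lambda>r. r < \<rho>) (at_right 0)" using \<rho> by (intro order_tendstoD(2)[OF tendsto_ident_at]) auto
  moreover have "eventually (\<lambda>r::real. 0 < r) (at_right 0)" by (rule eventually_at_right_less)
  ultimately have "eventually (\<lambda>r. 0 < r \<and> r < \<rho> \<and> deviation g c (half_ball x \<mu> r) \<le> ennreal (G / 4 * r ^ ?N)) (at_right 0)"
    by eventually_elim auto
  then obtain r where r: "0 < r" "r < \<rho>" "deviation g c (half_ball x \<mu> r) \<le> ennreal (G / 4 * r ^ ?N)"
    using eventually_happens'[OF trivial_limit_at_right_real] by blast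
  have two: "u * X \<le> T \<Longrightarrow> v * X \<le> T \<Longrightarrow> W \<le> (u + v) * X \<Longrightarrow> W \<le> 2 * T" for u v X T W :: real
    by (simp add: distrib_right)
  have xr: "deviation g a (cap x \<nu> (\<delta> / 8) r) \<le> ennreal (\<eta> * r ^ ?N)"
      "deviation g b (cap x (- \<nu>) (\<delta> / 8) r) \<le> ennreal (\<eta> * r ^ ?N)"
    using x r unfolding flat_piece_def by auto
  have "norm (a - c) * (?V * (\<delta> / 8 * r) ^ ?N) \<le> \<eta> * r ^ ?N + G / 4 * r ^ ?N"
    using r \<delta> \<eta> G by (intro overlap_bound[OF g _ sub[of r \<nu>] xr(1) r(3)]) auto
  moreover have "norm (b - c) * (?V * (\<delta> / 8 * r) ^ ?N) \<le> \<eta> * r ^ ?N + G / 4 * r ^ ?N"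
    using r \<delta> \<eta> G by (intro overlap_bound[OF g _ sub[of r "- \<nu>"] xr(2) r(3)]) auto
  moreover have "norm (a - b) * (?V * (\<delta> / 8 * r) ^ ?N) \<le> (norm (a - c) + norm (b - c)) * (?V * (\<delta> / 8 * r) ^ ?N)"
    using norm_triangle_ineq4[of "a - c" "b - c"] r \<delta> by (intro mult_right_mono) auto
  ultimately have "norm (a - b) * (?V * (\<delta> / 8 * r) ^ ?N) \<le> 2 * (\<eta> * r ^ ?N + G / 4 * r ^ ?N)"
    by (rule two)
  then have "(norm (a - b) * (?V * (\<delta> / 8) ^ ?N)) * r ^ ?N \<le> (2 * \<eta> + G / 2) * r ^ ?N"
    by (simp only: power_mult_distrib) (simp add: algebra_simps)
  then have "norm (a - b) * (?V * (\<delta> / 8) ^ ?N) \<le> 2 * \<eta> + G / 2" using r(1) by (simp only: mult_le_cancel_right_pos zero_less_power)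
  moreover have "norm (a - b) * (?V * (\<delta> / 8) ^ ?N) = G + 2 * \<eta>" by (simp add: G_def)
  ultimately show False using G by linarith
qed

text \<open>The values \<open>a\<close>, \<open>b\<close> and the normal \<open>\<nu>\<close> may be replaced by elements of dense sets: a change of the
values by \<open>s\<close> costs \<open>s\<close> times the volume of the ball, and the caps have room for a change of the
normal by \<open>\<delta> / 8\<close>.\<close>

lemma jump_point_in_flat_piece:
  fixes g :: "real^'N \<Rightarrow> 'b::euclidean_space"
  assumes g: "g \<in> borel_measurable lebesgue" and \<delta>: "0 < \<delta>" "\<delta> \<le> 1" and \<nu>: "norm \<nu> = 1" and ab: "a \<noteq> b"
    and lima: "\<And>e. 0 < e \<Longrightarrow> eventually (\<lambda>r. deviation g a (half_ball x \<nu> r) \<le> ennreal (e * r ^ CARD('N))) (at_right 0)"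
    and limb: "\<And>e. 0 < e \<Longrightarrow> eventually (\<lambda>r. deviation g b (half_ball x (- \<nu>) r) \<le> ennreal (e * r ^ CARD('N))) (at_right 0)"
    and D: "closure D = (UNIV :: 'b set)" and E: "sphere 0 1 \<subseteq> closure E"
  obtains a0 b0 \<nu>0 k where "a0 \<in> D" "b0 \<in> D" "a0 \<noteq> b0" "\<nu>0 \<in> E"
    "x \<in> flat_piece g (\<delta> / 8) a0 b0 \<nu>0 (1 / real (Suc k)) (norm (a0 - b0) * (unit_ball_vol (real CARD('N)) * (\<delta> / 8) ^ CARD('N)) / 4)"
proof -
  let ?N = "CARD('N)" and ?V = "unit_ball_vol (real CARD('N))"
  have V: "0 < ?V" by (rule unit_ball_vol_pos) simp
  define c where "c = (\<delta> / 8) ^ ?N / 8"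
  have c: "0 < c" "c \<le> 1/8"
  proof -
    show "0 < c" using \<delta> by (simp add: c_def)
    have "(\<delta> / 8) ^ ?N \<le> 1" using \<delta> by (intro power_le_one) auto
    then show "c \<le> 1/8" by (simp add: c_def)
  qed
  define s where "s = c * norm (a - b) / 2"
  have s: "0 < s" using c ab by (simp add: s_def)
  obtain a0 where a0: "a0 \<in> D" "dist a0 a < s" using D s closure_approachable[of a D] by auto
  obtain b0 where b0: "b0 \<in> D" "dist b0 b < s" using D s closure_approachable[of b D] by auto
  have "\<nu> \<in> closure E" using E \<nu> by auto
  then have "\<exists>\<nu>0\<in>E. dist \<nu>0 \<nu> < \<delta> / 8" using \<delta>(1) by (metis closure_approachable divide_pos_pos zero_less_numeral)
  then obtain \<nu>0 where \<nu>0: "\<nu>0 \<in> E" "dist \<nu>0 \<nu> < \<delta> / 8" by blast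
  have n0: "norm (a - b) / 2 \<le> norm (a0 - b0)"
  proof -
    have "dist a b \<le> dist a0 a + dist a0 b0 + dist b0 b" by (metis dist_commute dist_triangle3 dist_triangle_le add_right_mono order_trans)
    moreover have "s \<le> norm (a - b) / 16" using c(2) mult_right_mono[OF c(2), of "norm (a - b)"] by (simp add: s_def)
    ultimately show ?thesis using a0(2) b0(2) norm_ge_zero[of "a - b"] unfolding dist_norm by linarith
  qed
  have ab0: "a0 \<noteq> b0" using n0 ab by auto
  define \<eta> where "\<eta> = norm (a0 - b0) * (?V * (\<delta> / 8) ^ ?N) / 4"
  have \<eta>: "0 < \<eta>" using ab0 V \<delta> by (simp add: \<eta>_def)
  have s\<eta>: "s * ?V \<le> \<eta> / 2"
  proof -
    have "c * (norm (a - b) / 2) \<le> c * norm (a0 - b0)" using n0 c(1) by (intro mult_left_mono) auto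
    then have "s \<le> c * norm (a0 - b0)" by (simp add: s_def)
    then have "s * ?V \<le> c * norm (a0 - b0) * ?V" using V by (intro mult_right_mono) auto
    then show ?thesis by (simp add: c_def \<eta>_def mult_ac)
  qed
  have one: "deviation g e0 (cap x \<kappa>0 (\<delta> / 8) r) \<le> ennreal (\<eta> * r ^ ?N)"
    if r: "0 < r" and I: "deviation g e (half_ball x \<kappa> r) \<le> ennreal (\<eta> / 2 * r ^ ?N)"
      and \<kappa>: "norm (\<kappa>0 - \<kappa>) < \<delta> / 8" and e: "dist e0 e < s" for r \<kappa> \<kappa>0 e e0
  proof -
    have sub: "cap x \<kappa>0 (\<delta> / 8) r \<subseteq> half_ball x \<kappa> r"
    proof
      fix y assume y: "y \<in> cap x \<kappa>0 (\<delta> / 8) r"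
      have "\<bar>(y - x) \<bullet> (\<kappa>0 - \<kappa>)\<bar> \<le> norm (y - x) * norm (\<kappa>0 - \<kappa>)" by (rule Cauchy_Schwarz_ineq2)
      also have "\<dots> \<le> r * (\<delta> / 8)" using y \<kappa> r by (intro mult_mono) (auto simp: cap_def dist_norm norm_minus_commute)
      finally have "\<bar>(y - x) \<bullet> \<kappa>0 - (y - x) \<bullet> \<kappa>\<bar> \<le> \<delta> / 8 * r" by (simp add: inner_diff_right mult.commute)
      moreover have "\<delta> / 8 * r < (y - x) \<bullet> \<kappa>0" using y by (simp add: cap_def)
      ultimately have "0 < (y - x) \<bullet> \<kappa>" by linarith
      then show "y \<in> half_ball x \<kappa> r" using y by (simp add: cap_def half_ball_def)
    qed
    have hb: "half_ball x \<kappa> r \<in> sets lebesgue" by (simp add: open_half_ball)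
    have "deviation g e0 (cap x \<kappa>0 (\<delta> / 8) r) \<le>
      (\<integral>\<^sup>+y. ennreal (norm (g y - e)) * indicator (half_ball x \<kappa> r) y + ennreal s * indicator (half_ball x \<kappa> r) y \<partial>lebesgue)"
    proof (rule nn_integral_mono)
      fix y
      have "norm (g y - e0) \<le> norm (g y - e) + s" using norm_triangle_ineq[of "g y - e" "e - e0"] e by (simp add: dist_norm norm_minus_commute)
      then have "ennreal (norm (g y - e0)) \<le> ennreal (norm (g y - e)) + ennreal s"
        using s by (simp add: ennreal_plus[symmetric] del: ennreal_plus)
      then show "ennreal (norm (g y - e0)) * indicator (cap x \<kappa>0 (\<delta> / 8) r) y \<le> ennreal (norm (g y - e)) * indicator (half_ball x \<kappa> r) y + ennreal s * indicator (half_ball x \<kappa> r) y"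
        using sub by (auto simp: indicator_def)
    qed
    also have "\<dots> = deviation g e (half_ball x \<kappa> r) + ennreal s * emeasure lebesgue (half_ball x \<kappa> r)"
      using hb by (subst nn_integral_add) (auto simp: nn_integral_cmult_indicator intro!: borel_measurable_times_ennreal measurable_norm_diff[OF g] borel_measurable_indicator)
    also have "\<dots> \<le> ennreal (\<eta> / 2 * r ^ ?N) + ennreal s * ennreal (?V * r ^ ?N)"
    proof -
      have "emeasure lebesgue (half_ball x \<kappa> r) \<le> emeasure lebesgue (ball x r)" by (intro emeasure_mono) (auto simp: half_ball_def)
      also have "\<dots> = ennreal (?V * r ^ ?N)" using r by (simp add: emeasure_ball)
      finally show ?thesis using I by (intro add_mono mult_left_mono) auto
    qed
    also have "\<dots> = ennreal (\<eta> / 2 * r ^ ?N + s * ?V * r ^ ?N)"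
      using s V \<eta> r by (simp add: ennreal_mult[symmetric] ennreal_plus[symmetric] mult_ac del: ennreal_plus)
    also have "\<dots> \<le> ennreal (\<eta> * r ^ ?N)"
    proof (rule ennreal_leI)
      have "s * ?V * r ^ ?N \<le> \<eta> / 2 * r ^ ?N" using s\<eta> r by (intro mult_right_mono) auto
      then show "\<eta> / 2 * r ^ ?N + s * ?V * r ^ ?N \<le> \<eta> * r ^ ?N" by (simp add: field_simps)
    qed
    finally show ?thesis .
  qed
  have "eventually (\<lambda>r. deviation g a (half_ball x \<nu> r) \<le> ennreal (\<eta> / 2 * r ^ ?N)) (at_right 0)"
    "eventually (\<lambda>r. deviation g b (half_ball x (- \<nu>) r) \<le> ennreal (\<eta> / 2 * r ^ ?N)) (at_right 0)"
    by (rule lima limb, use \<eta> in simp)+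
  then have "eventually (\<lambda>r. deviation g a (half_ball x \<nu> r) \<le> ennreal (\<eta> / 2 * r ^ ?N) \<and>
     deviation g b (half_ball x (- \<nu>) r) \<le> ennreal (\<eta> / 2 * r ^ ?N)) (at_right 0)"
    by eventually_elim auto
  then obtain \<rho> where \<rho>: "0 < \<rho>" "\<And>r. 0 < r \<Longrightarrow> r < \<rho> \<Longrightarrow> deviation g a (half_ball x \<nu> r) \<le> ennreal (\<eta> / 2 * r ^ ?N)"
     "\<And>r. 0 < r \<Longrightarrow> r < \<rho> \<Longrightarrow> deviation g b (half_ball x (- \<nu>) r) \<le> ennreal (\<eta> / 2 * r ^ ?N)"
    unfolding eventually_at_right_field by blast
  obtain k where k: "1 / real (Suc k) < \<rho>" using \<rho>(1) reals_Archimedean inverse_eq_divide by metis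
  have "x \<in> flat_piece g (\<delta> / 8) a0 b0 \<nu>0 (1 / real (Suc k)) \<eta>"
    unfolding flat_piece_def
  proof (intro CollectI allI impI)
    fix r assume r: "0 < r \<and> r \<le> 1 / real (Suc k)"
    then have r2: "0 < r" "r < \<rho>" using k by auto
    have n1: "norm (\<nu>0 - \<nu>) < \<delta> / 8" "norm (- \<nu>0 - - \<nu>) < \<delta> / 8" using \<nu>0(2) by (simp_all add: dist_norm norm_minus_commute)
    show "deviation g a0 (cap x \<nu>0 (\<delta> / 8) r) \<le> ennreal (\<eta> * r ^ ?N) \<and>
      deviation g b0 (cap x (- \<nu>0) (\<delta> / 8) r) \<le> ennreal (\<eta> * r ^ ?N)"
      using one[OF r2(1) \<rho>(2)[OF r2] n1(1) a0(2)] one[OF r2(1) \<rho>(3)[OF r2] n1(2) b0(2)] by simp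
  qed
  then show ?thesis using that[OF a0(1) b0(1) ab0 \<nu>0(1)] unfolding \<eta>_def by blast
qed

text \<open>The pieces are indexed by values and directions from countable dense sets, by the scale
\<open>1 / (k + 1)\<close>, and by the centre of a ball whose radius is a quarter of this scale; intersecting
with this ball makes the piece compact and so small that \<open>flat_piece_cone\<close> applies to any two of
its points.\<close>

lemma jump_set_covered_by_flat_compacts:
  fixes v :: "real^'N \<Rightarrow> 'b::euclidean_space"
  assumes \<Omega>: "open \<Omega>" and v: "set_integrable lebesgue \<Omega> v" and \<delta>: "0 < \<delta>" "\<delta> \<le> 1"
  obtains P :: "nat \<Rightarrow> (real^'N) set" and \<theta> where
    "\<And>n. compact (P n)" "\<And>n. norm (\<theta> n) = 1"
    "\<And>n x y. x \<in> P n \<Longrightarrow> y \<in> P n \<Longrightarrow> \<bar>(y - x) \<bullet> \<theta> n\<bar> \<le> \<delta> * dist x y"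
    "\<And>x a b \<nu>. x \<in> \<Omega> \<Longrightarrow> jump_triple v x a b \<nu> \<Longrightarrow> \<exists>n. x \<in> P n"
    "\<And>x a b \<nu> n. x \<in> \<Omega> \<Longrightarrow> jump_triple v x a b \<nu> \<Longrightarrow> x \<in> P n \<Longrightarrow> 1 - (\<nu> \<bullet> \<theta> n)\<^sup>2 \<le> \<delta>\<^sup>2"
proof -
  let ?N = "CARD('N)" and ?V = "unit_ball_vol (real CARD('N))"
  have V: "0 < ?V" by (rule unit_ball_vol_pos) simp
  define g where "g = (\<lambda>x. indicat_real \<Omega> x *\<^sub>R v x)"
  have g: "g \<in> borel_measurable lebesgue" using v by (simp add: g_def set_integrable_def borel_measurable_integrable)
  have lim: "eventually (\<lambda>r. deviation g a (half_ball x \<nu> r) \<le> ennreal (e * r ^ ?N)) (at_right 0)"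
    if x: "x \<in> \<Omega>" and l: "one_sided_approx_limit v x \<nu> a" and e: "0 < e" for x \<nu> a e
  proof -
    obtain R where R: "R > 0" "ball x R \<subseteq> \<Omega>" using \<Omega> x openE by blast
    have "eventually (\<lambda>r. r < R) (at_right 0)" using R(1) by (intro order_tendstoD(2)[OF tendsto_ident_at]) auto
    with one_sided_approx_limitD[OF l e] show ?thesis
    proof eventually_elim
      case (elim r)
      have "half_ball x \<nu> r \<subseteq> \<Omega>" using R(2) elim(2) by (auto simp: half_ball_def)
      then have "ennreal (norm (g y - a)) * indicator (half_ball x \<nu> r) y = ennreal (norm (v y - a)) * indicator (half_ball x \<nu> r) y" for y
        by (auto simp: g_def indicator_def)
      then show ?case using elim(1) by simp
    qed
  qed
  obtain D where D: "countable D" "closure D = (UNIV :: 'b set)"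
    using separable[of "UNIV :: 'b set"] by (metis top.extremum_uniqueI)
  obtain E :: "(real^'N) set" where E: "countable E" "E \<subseteq> sphere 0 1" "sphere 0 1 \<subseteq> closure E"
    by (rule separable)
  obtain Z where Z: "countable Z" "closure Z = (UNIV :: (real^'N) set)"
    using separable[of "UNIV :: (real^'N) set"] by (metis top.extremum_uniqueI)
  define I where "I = D \<times> D \<times> E \<times> (UNIV :: nat set) \<times> Z"
  have cI: "countable I" unfolding I_def using D(1) E(1) Z(1) by (intro countable_SIGMA) auto
  obtain u :: "real^'N" where u: "u \<in> sphere 0 1" using vector_choose_size[of 1] by auto
  have "D \<noteq> {}" "E \<noteq> {}" "Z \<noteq> {}" using D(2) E(3) u Z(2) by auto
  then have nI: "I \<noteq> {}" by (simp add: I_def)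
  define \<eta> where "\<eta> a b = norm (a - b) * (?V * (\<delta> / 8) ^ ?N) / 4" for a b :: 'b
  define Q where "Q i = (case i of (a, b, \<nu>, k, z) \<Rightarrow> if a = b then {} else
      flat_piece g (\<delta> / 8) a b \<nu> (1 / real (Suc k)) (\<eta> a b) \<inter> cball z (1 / real (Suc k) / 4))" for i
  define ax where "ax i = (case i of (a, b, \<nu>, k, z) \<Rightarrow> \<nu>)" for i :: "'b \<times> 'b \<times> (real^'N) \<times> nat \<times> (real^'N)"
  have \<eta>: "0 \<le> \<eta> a b" "2 * \<eta> a b < norm (a - b) * (?V * (\<delta> / 8) ^ ?N)" if "a \<noteq> b" for a b
  proof -
    have "0 < norm (a - b) * (?V * (\<delta> / 8) ^ ?N)" using that V \<delta> by (intro mult_pos_pos zero_less_power) auto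
    then show "0 \<le> \<eta> a b" "2 * \<eta> a b < norm (a - b) * (?V * (\<delta> / 8) ^ ?N)" unfolding \<eta>_def by linarith+
  qed
  have ax1: "norm (ax i) = 1" if "i \<in> I" for i using that E(2) by (auto simp: I_def ax_def)
  have Qc: "compact (Q i)" for i
    by (auto simp: Q_def split: prod.split intro!: closed_Int_compact closed_flat_piece[OF g])
  have Qcone: "\<bar>(y - x) \<bullet> ax i\<bar> \<le> \<delta> * dist x y" if i: "i \<in> I" and x: "x \<in> Q i" and y: "y \<in> Q i" for i x y
  proof -
    obtain a b \<nu> k z where i': "i = (a, b, \<nu>, k, z)" by (cases i) auto
    have ab: "a \<noteq> b" using x by (auto simp: Q_def i')
    define \<rho> where "\<rho> = 1 / real (Suc k)"
    have xy: "x \<in> flat_piece g (\<delta> / 8) a b \<nu> \<rho> (\<eta> a b)" "y \<in> flat_piece g (\<delta> / 8) a b \<nu> \<rho> (\<eta> a b)"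
        "dist z x \<le> \<rho> / 4" "dist z y \<le> \<rho> / 4"
      using x y ab unfolding Q_def i' \<rho>_def by simp_all
    have "dist x y \<le> \<rho> / 2"
      using xy(3,4) dist_triangle3[of x y z] by linarith
    moreover have "norm \<nu> = 1" using ax1[OF i] by (simp add: ax_def i')
    ultimately have "\<bar>(y - x) \<bullet> \<nu>\<bar> \<le> \<delta> * dist x y"
      by (intro flat_piece_cone[OF g \<delta> _ \<eta>[OF ab] xy(1,2)])
    then show ?thesis by (simp add: ax_def i')
  qed
  have Qcov: "\<exists>i\<in>I. x \<in> Q i" if x: "x \<in> \<Omega>" and J: "jump_triple v x a b \<nu>" for x a b \<nu>
  proof -
    have J': "norm \<nu> = 1" "a \<noteq> b" "one_sided_approx_limit v x \<nu> a" "one_sided_approx_limit v x (- \<nu>) b"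
      using J by (auto simp: jump_triple_def)
    obtain a0 b0 \<nu>0 k where *: "a0 \<in> D" "b0 \<in> D" "a0 \<noteq> b0" "\<nu>0 \<in> E"
      "x \<in> flat_piece g (\<delta> / 8) a0 b0 \<nu>0 (1 / real (Suc k)) (\<eta> a0 b0)"
      unfolding \<eta>_def
      by (rule jump_point_in_flat_piece[OF g \<delta> J'(1,2) lim[OF x J'(3)] lim[OF x J'(4)] D(2) E(3)])
    obtain z where z: "z \<in> Z" "dist z x < 1 / real (Suc k) / 4"
      using Z(2) closure_approachable[of x Z] by (metis UNIV_I divide_pos_pos of_nat_0_less_iff zero_less_Suc zero_less_numeral zero_less_one)
    have "(a0, b0, \<nu>0, k, z) \<in> I" using * z by (simp add: I_def)
    moreover have "x \<in> Q (a0, b0, \<nu>0, k, z)" using * z by (simp add: Q_def)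
    ultimately show ?thesis by blast
  qed
  have Qn: "1 - (\<nu> \<bullet> ax i)\<^sup>2 \<le> \<delta>\<^sup>2" if x: "x \<in> \<Omega>" and J: "jump_triple v x a b \<nu>" and i: "i \<in> I" "x \<in> Q i" for x a b \<nu> i
  proof -
    have J': "norm \<nu> = 1" "one_sided_approx_limit v x \<nu> a" using J by (auto simp: jump_triple_def)
    obtain a0 b0 \<nu>0 k z where i': "i = (a0, b0, \<nu>0, k, z)" by (cases i) auto
    have ab: "a0 \<noteq> b0" "x \<in> flat_piece g (\<delta> / 8) a0 b0 \<nu>0 (1 / real (Suc k)) (\<eta> a0 b0)"
      using i(2) by (auto simp: Q_def i' split: if_splits)
    have n: "norm \<nu>0 = 1" using ax1[OF i(1)] by (simp add: ax_def i')
    have "1 - (\<nu> \<bullet> \<nu>0)\<^sup>2 \<le> \<delta>\<^sup>2"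
      by (rule flat_piece_normal[OF g \<delta> n J'(1) \<eta>[OF ab(1)] _ ab(2) lim[OF x J'(2)]]) simp
    then show ?thesis by (simp add: ax_def i')
  qed
  show ?thesis
  proof (rule that[of "\<lambda>n. Q (from_nat_into I n)" "\<lambda>n. ax (from_nat_into I n)"])
    note fI = from_nat_into[OF nI]
    show "compact (Q (from_nat_into I n))" for n by (rule Qc)
    show "norm (ax (from_nat_into I n)) = 1" for n by (rule ax1[OF fI])
    show "\<bar>(y - x) \<bullet> ax (from_nat_into I n)\<bar> \<le> \<delta> * dist x y" if "x \<in> Q (from_nat_into I n)" "y \<in> Q (from_nat_into I n)" for n x y
      by (rule Qcone[OF fI that])
    show "\<exists>n. x \<in> Q (from_nat_into I n)" if xJ: "x \<in> \<Omega>" "jump_triple v x a b \<nu>" for x a b \<nu>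
      using Qcov[OF xJ] from_nat_into_surj[OF cI] by metis
    show "1 - (\<nu> \<bullet> ax (from_nat_into I n))\<^sup>2 \<le> \<delta>\<^sup>2" if "x \<in> \<Omega>" "jump_triple v x a b \<nu>" "x \<in> Q (from_nat_into I n)" for x a b \<nu> n
      by (rule Qn[OF that(1,2) fI that(3)])
  qed
qed


section \<open>Summing up the local estimates\<close>

text \<open>Lower integrals of arbitrary functions over arbitrary disjoint sets are superadditive, since
simple functions below the two integrands add up to one below the third.\<close>

lemma nn_integral_disjoint_Un_le:
  fixes f :: "'a \<Rightarrow> ennreal"
  assumes "A \<inter> B = {}"
  shows "(\<integral>\<^sup>+x\<in>A. f x \<partial>M) + (\<integral>\<^sup>+x\<in>B. f x \<partial>M) \<le> (\<integral>\<^sup>+x\<in>A \<union> B. f x \<partial>M)"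
  unfolding nn_integral_def[of _ "\<lambda>x. f x * indicator A x"] nn_integral_def[of _ "\<lambda>x. f x * indicator B x"]
proof (rule ennreal_SUP_add_le)
  fix s1 s2
  assume s1: "s1 \<in> {g. simple_function M g \<and> g \<le> (\<lambda>x. f x * indicator A x)}"
    and s2: "s2 \<in> {g. simple_function M g \<and> g \<le> (\<lambda>x. f x * indicator B x)}"
  have "integral\<^sup>S M s1 + integral\<^sup>S M s2 = integral\<^sup>S M (\<lambda>x. s1 x + s2 x)"
    using s1 s2 by (intro simple_integral_add[symmetric]) auto
  also have "\<dots> = integral\<^sup>N M (\<lambda>x. s1 x + s2 x)"
    using s1 s2 by (intro nn_integral_eq_simple_integral[symmetric] simple_function_add) auto
  also have "\<dots> \<le> (\<integral>\<^sup>+x\<in>A \<union> B. f x \<partial>M)"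
  proof (rule nn_integral_mono)
    fix x
    have "s1 x \<le> f x * indicator A x" "s2 x \<le> f x * indicator B x" using s1 s2 by (auto simp: le_fun_def)
    then have "s1 x + s2 x \<le> f x * indicator A x + f x * indicator B x" by (rule add_mono)
    also have "\<dots> = f x * indicator (A \<union> B) x" using assms by (auto simp: indicator_def)
    finally show "s1 x + s2 x \<le> f x * indicator (A \<union> B) x" .
  qed
  finally show "integral\<^sup>S M s1 + integral\<^sup>S M s2 \<le> (\<integral>\<^sup>+x\<in>A \<union> B. f x \<partial>M)" .
next
  have "(\<lambda>_. 0) \<in> {g. simple_function M g \<and> g \<le> (\<lambda>x. f x * indicator S x)}" for S
    by (auto simp: le_fun_def)
  then show "{g. simple_function M g \<and> g \<le> (\<lambda>x. f x * indicator A x)} \<noteq> {}"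
    "{g. simple_function M g \<and> g \<le> (\<lambda>x. f x * indicator B x)} \<noteq> {}" by blast+
qed

lemma nn_integral_disjoint_family_le:
  fixes f :: "'a \<Rightarrow> ennreal"
  assumes "finite I" "pairwise (\<lambda>i j. disjnt (V i) (V j)) I" "\<And>i. i \<in> I \<Longrightarrow> V i \<subseteq> W"
  shows "(\<Sum>i\<in>I. \<integral>\<^sup>+x\<in>V i. f x \<partial>M) \<le> (\<integral>\<^sup>+x\<in>W. f x \<partial>M)"
proof -
  have "(\<Sum>i\<in>I. \<integral>\<^sup>+x\<in>V i. f x \<partial>M) \<le> (\<integral>\<^sup>+x\<in>(\<Union>i\<in>I. V i). f x \<partial>M)"
    using assms(1,2)
  proof (induction I rule: finite_induct)
    case (insert j I)
    have d: "V j \<inter> (\<Union>i\<in>I. V i) = {}" using insert by (auto simp: pairwise_insert disjnt_def)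
    have "(\<Sum>i\<in>insert j I. \<integral>\<^sup>+x\<in>V i. f x \<partial>M) \<le> (\<integral>\<^sup>+x\<in>V j. f x \<partial>M) + (\<integral>\<^sup>+x\<in>(\<Union>i\<in>I. V i). f x \<partial>M)"
      using insert by (simp add: pairwise_insert add_left_mono)
    also have "\<dots> \<le> (\<integral>\<^sup>+x\<in>V j \<union> (\<Union>i\<in>I. V i). f x \<partial>M)" by (rule nn_integral_disjoint_Un_le[OF d])
    finally show ?case by simp
  qed simp
  also have "\<dots> \<le> (\<integral>\<^sup>+x\<in>W. f x \<partial>M)"
    using assms(3) by (intro nn_integral_mono) (auto simp: indicator_def)
  finally show ?thesis .
qed

lemma disjoint_compacts_separated:
  fixes K :: "'i \<Rightarrow> 'a::heine_borel set"
  assumes fin: "finite Q" and K: "\<And>q. q \<in> Q \<Longrightarrow> compact (K q)" and disj: "\<And>p q. p \<in> Q \<Longrightarrow> q \<in> Q \<Longrightarrow> p \<noteq> q \<Longrightarrow> K p \<inter> K q = {}"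
  shows "\<exists>d>0. \<forall>p\<in>Q. \<forall>q\<in>Q. p \<noteq> q \<longrightarrow> (\<forall>x\<in>K p. \<forall>y\<in>K q. d \<le> dist x y)"
proof -
  have "\<exists>d>0. \<forall>x\<in>K p. \<forall>y\<in>K q. d \<le> dist x y" if "p \<in> Q" "q \<in> Q" "p \<noteq> q" for p q
    using separate_compact_closed[OF K[OF that(1)] compact_imp_closed[OF K[OF that(2)]] disj[OF that]] by blast
  then obtain e where e: "\<And>p q. p \<in> Q \<Longrightarrow> q \<in> Q \<Longrightarrow> p \<noteq> q \<Longrightarrow> 0 < e p q \<and> (\<forall>x\<in>K p. \<forall>y\<in>K q. e p q \<le> dist x y)"
    by metis
  define S where "S = insert 1 ((\<lambda>(p, q). e p q) ` {(p, q). p \<in> Q \<and> q \<in> Q \<and> p \<noteq> q})"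
  have "finite {(p, q). p \<in> Q \<and> q \<in> Q \<and> p \<noteq> q}" by (rule finite_subset[of _ "Q \<times> Q"]) (use fin in auto)
  then have S: "finite S" by (simp add: S_def)
  show ?thesis
  proof (intro exI[of _ "Min S"] conjI ballI impI)
    show "0 < Min S" using S e by (subst Min_gr_iff) (auto simp: S_def)
    fix p q x y assume *: "p \<in> Q" "q \<in> Q" "p \<noteq> q" "x \<in> K p" "y \<in> K q"
    then have "e p q \<in> S" by (auto simp: S_def intro!: image_eqI[of _ _ "(p, q)"])
    then have "Min S \<le> e p q" using S by simp
    then show "Min S \<le> dist x y" using e[OF *(1-3)] *(4,5) by fastforce
  qed
qed

text \<open>On the flat compact set \<open>K q\<close> every small cube about a point carries at least \<open>c q\<close> times the area
of its face of the integral of \<open>f \<epsilon>\<close>. The cubes are chosen before \<open>\<epsilon>\<close>, and there are finitely many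
of them, so the local estimates hold simultaneously for all small \<open>\<epsilon>\<close>. Cubes of different sets
\<open>K q\<close> are disjoint because they lie in balls of radius at most half the distance of these sets.
The value \<open>t q = 0\<close> is allowed to cover null sets.\<close>

lemma energy_ge_finite_sum:
  fixes K :: "'i \<Rightarrow> (real^'N) set" and f :: "real \<Rightarrow> real^'N \<Rightarrow> ennreal" and c :: "'i \<Rightarrow> ennreal"
  assumes fin: "finite Q" and K: "\<And>q. q \<in> Q \<Longrightarrow> compact (K q)" and disj: "\<And>p q. p \<in> Q \<Longrightarrow> q \<in> Q \<Longrightarrow> p \<noteq> q \<Longrightarrow> K p \<inter> K q = {}"
    and \<theta>: "\<And>q. q \<in> Q \<Longrightarrow> norm (\<theta> q) = 1" and \<delta>: "0 \<le> \<delta>" "\<delta> \<le> 1/4"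
    and cone: "\<And>q x y. q \<in> Q \<Longrightarrow> x \<in> K q \<Longrightarrow> y \<in> K q \<Longrightarrow> \<bar>(y - x) \<bullet> \<theta> q\<bar> \<le> \<delta> * dist x y"
    and frm: "\<And>q x. q \<in> Q \<Longrightarrow> x \<in> K q \<Longrightarrow> orthonormal_basis_through (\<nu> x) (frm x)"
    and near: "\<And>q x. q \<in> Q \<Longrightarrow> x \<in> K q \<Longrightarrow> 1 - (\<nu> x \<bullet> \<theta> q)\<^sup>2 \<le> \<delta>\<^sup>2"
    and t: "\<And>q. q \<in> Q \<Longrightarrow> 0 \<le> t q" "\<And>q. q \<in> Q \<Longrightarrow> 0 < t q \<Longrightarrow> ennreal (t q * ((1 + \<delta>) * (1 + 2 * \<delta>)) ^ (CARD('N) - 1)) < hausdorff_outer (CARD('N) - 1) (K q)"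
    and loc: "\<And>q x. q \<in> Q \<Longrightarrow> x \<in> K q \<Longrightarrow> \<exists>R>0. \<forall>r. 0 < r \<and> r < R \<longrightarrow> cube_at (frm x) x r \<subseteq> \<Omega> \<and>
        eventually (\<lambda>\<epsilon>. c q * ennreal (r ^ (CARD('N) - 1)) \<le> (\<integral>\<^sup>+z\<in>cube_at (frm x) x r. f \<epsilon> z \<partial>lebesgue)) G"
  shows "eventually (\<lambda>\<epsilon>. (\<Sum>q\<in>Q. c q * ennreal (t q)) \<le> (\<integral>\<^sup>+z\<in>\<Omega>. f \<epsilon> z \<partial>lebesgue)) G"
proof -
  let ?N = "CARD('N)"
  let ?cube = "\<lambda>i. cube_at (frm (fst i)) (fst i) (snd i)"
  have "\<exists>d>0. \<forall>p\<in>Q. \<forall>q\<in>Q. p \<noteq> q \<longrightarrow> (\<forall>x\<in>K p. \<forall>y\<in>K q. d \<le> dist x y)"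
    by (rule disjoint_compacts_separated[OF fin K disj])
  then obtain d where d: "0 < d" "\<And>p q x y. p \<in> Q \<Longrightarrow> q \<in> Q \<Longrightarrow> p \<noteq> q \<Longrightarrow> x \<in> K p \<Longrightarrow> y \<in> K q \<Longrightarrow> d \<le> dist x y"
    by blast
  define good where "good q x R \<longleftrightarrow> R > 0 \<and> (\<forall>r. 0 < r \<and> r < R \<longrightarrow> cube_at (frm x) x r \<subseteq> \<Omega> \<and>
      eventually (\<lambda>\<epsilon>. c q * ennreal (r ^ (?N - 1)) \<le> (\<integral>\<^sup>+z\<in>cube_at (frm x) x r. f \<epsilon> z \<partial>lebesgue)) G)" for q x R
  define R0 where "R0 q x = (SOME R. good q x R)" for q x
  have "good q x (R0 q x)" if "q \<in> Q" "x \<in> K q" for q x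
    unfolding R0_def by (rule someI_ex) (use loc[OF that] in \<open>simp add: good_def\<close>)
  then have R0: "\<And>q x. q \<in> Q \<Longrightarrow> x \<in> K q \<Longrightarrow> 0 < R0 q x" "\<And>q x r. q \<in> Q \<Longrightarrow> x \<in> K q \<Longrightarrow> 0 < r \<Longrightarrow> r < R0 q x \<Longrightarrow>
      cube_at (frm x) x r \<subseteq> \<Omega> \<and> eventually (\<lambda>\<epsilon>. c q * ennreal (r ^ (?N - 1)) \<le> (\<integral>\<^sup>+z\<in>cube_at (frm x) x r. f \<epsilon> z \<partial>lebesgue)) G"
    unfolding good_def by blast+
  define R where "R q x = min (R0 q x) (d / (2 * real ?N))" for q x
  have R: "0 < R q x" if "q \<in> Q" "x \<in> K q" for q x using R0(1)[OF that] d(1) by (simp add: R_def)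
  have ex: "\<exists>C. finite C \<and> C \<subseteq> K q \<times> {0<..} \<and> (\<forall>(x, r)\<in>C. r < R q x) \<and> pairwise (\<lambda>i j. disjnt (?cube i) (?cube j)) C \<and>
      t q \<le> (\<Sum>i\<in>C. snd i ^ (?N - 1))" if q: "q \<in> Q" for q
  proof (cases "t q = 0")
    case True
    then show ?thesis by (intro exI[of _ "{}"]) simp
  next
    case False
    then have tq: "0 < t q" using t(1)[OF q] by simp
    have "\<exists>C. finite C \<and> C \<subseteq> K q \<times> {0<..} \<and> (\<forall>(x, r)\<in>C. r < R q x) \<and> pairwise (\<lambda>i j. disjnt (?cube i) (?cube j)) C \<and>
      t q < (\<Sum>i\<in>C. snd i ^ (?N - 1))"
      by (rule cubes_fill_flat_compact[OF \<theta>[OF q] K[OF q] \<delta> cone[OF q] frm[OF q] near[OF q] R[OF q] t(1)[OF q] t(2)[OF q tq]])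
    then show ?thesis by (meson less_imp_le)
  qed
  define C where "C q = (SOME C. finite C \<and> C \<subseteq> K q \<times> {0<..} \<and> (\<forall>(x, r)\<in>C. r < R q x) \<and> pairwise (\<lambda>i j. disjnt (?cube i) (?cube j)) C \<and>
      t q \<le> (\<Sum>i\<in>C. snd i ^ (?N - 1)))" for q
  have C: "finite (C q)" "C q \<subseteq> K q \<times> {0<..}" "\<forall>(x, r)\<in>C q. r < R q x" "pairwise (\<lambda>i j. disjnt (?cube i) (?cube j)) (C q)"
      "t q \<le> (\<Sum>i\<in>C q. snd i ^ (?N - 1))" if "q \<in> Q" for q
    using someI_ex[OF ex[OF that]] unfolding C_def[symmetric] by blast+
  have Ci: "fst i \<in> K q" "0 < snd i" "snd i < R q (fst i)" if "q \<in> Q" "i \<in> C q" for q i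
    using C(2,3)[OF that(1)] that(2) by (cases i; force)+
  define I where "I = Sigma Q C"
  have finI: "finite I" unfolding I_def using fin C(1) by (rule finite_SigmaI)
  have cross: "disjnt (?cube i) (?cube j)" if "p \<in> Q" "q \<in> Q" "p \<noteq> q" "i \<in> C p" "j \<in> C q" for p q i j
  proof -
    have sub: "?cube i \<subseteq> ball (fst i) (d / 2)" if "p \<in> Q" "i \<in> C p" for i p
    proof -
      have "?cube i \<subseteq> ball (fst i) (real ?N * snd i)"
        using cube_at_subset_ball[OF frm[OF that(1) Ci(1)[OF that]] Ci(2)[OF that]] by simp
      also have "\<dots> \<subseteq> ball (fst i) (d / 2)"
        using Ci(3)[OF that] by (intro subset_ball) (simp add: R_def field_simps)
      finally show ?thesis .
    qed
    have "d \<le> dist (fst i) (fst j)" using d(2)[OF that(1-3) Ci(1)[OF that(1,4)] Ci(1)[OF that(2,5)]] .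
    then have "disjnt (ball (fst i) (d / 2)) (ball (fst j) (d / 2))"
      unfolding disjnt_def by (intro disjoint_ballI) simp
    then show ?thesis using sub[OF that(1,4)] sub[OF that(2,5)] by (meson disjnt_subset1 disjnt_subset2)
  qed
  have pw: "pairwise (\<lambda>i j. disjnt (?cube (snd i)) (?cube (snd j))) I"
    unfolding pairwise_def
  proof (intro ballI impI)
    fix i j assume ij: "i \<in> I" "j \<in> I" "i \<noteq> j"
    show "disjnt (?cube (snd i)) (?cube (snd j))"
    proof (cases "fst i = fst j")
      case True
      then have ne: "snd i \<noteq> snd j" using ij(3) by (simp add: prod_eq_iff)
      have "fst i \<in> Q" "snd i \<in> C (fst i)" "snd j \<in> C (fst i)" using ij True by (auto simp: I_def)
      then show ?thesis using pairwiseD[OF C(4)[of "fst i"] _ _ ne] by blast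
    next
      case False
      then show ?thesis using cross[of "fst i" "fst j" "snd i" "snd j"] ij by (auto simp: I_def)
    qed
  qed
  have locI: "?cube (snd i) \<subseteq> \<Omega>" "eventually (\<lambda>\<epsilon>. c (fst i) * ennreal (snd (snd i) ^ (?N - 1)) \<le> (\<integral>\<^sup>+z\<in>?cube (snd i). f \<epsilon> z \<partial>lebesgue)) G"
    if "i \<in> I" for i
  proof -
    have i: "fst i \<in> Q" "snd i \<in> C (fst i)" using that by (auto simp: I_def)
    have "snd (snd i) < R0 (fst i) (fst (snd i))" using Ci(3)[OF i] by (simp add: R_def)
    from R0(2)[OF i(1) Ci(1)[OF i] Ci(2)[OF i] this]
    show "?cube (snd i) \<subseteq> \<Omega>" "eventually (\<lambda>\<epsilon>. c (fst i) * ennreal (snd (snd i) ^ (?N - 1)) \<le> (\<integral>\<^sup>+z\<in>?cube (snd i). f \<epsilon> z \<partial>lebesgue)) G"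
      by auto
  qed
  have lower: "(\<Sum>q\<in>Q. c q * ennreal (t q)) \<le> (\<Sum>i\<in>I. c (fst i) * ennreal (snd (snd i) ^ (?N - 1)))"
  proof -
    have "(\<Sum>q\<in>Q. c q * ennreal (t q)) \<le> (\<Sum>q\<in>Q. \<Sum>i\<in>C q. c q * ennreal (snd i ^ (?N - 1)))"
    proof (rule sum_mono)
      fix q assume q: "q \<in> Q"
      have "c q * ennreal (t q) \<le> c q * ennreal (\<Sum>i\<in>C q. snd i ^ (?N - 1))"
        using C(5)[OF q] by (intro mult_left_mono ennreal_leI) auto
      also have "ennreal (\<Sum>i\<in>C q. snd i ^ (?N - 1)) = (\<Sum>i\<in>C q. ennreal (snd i ^ (?N - 1)))"
        using Ci(2)[OF q] by (intro sum_ennreal[symmetric]) (auto intro: less_imp_le)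
      finally show "c q * ennreal (t q) \<le> (\<Sum>i\<in>C q. c q * ennreal (snd i ^ (?N - 1)))" by (simp add: sum_distrib_left)
    qed
    also have "\<dots> = (\<Sum>i\<in>I. c (fst i) * ennreal (snd (snd i) ^ (?N - 1)))"
      unfolding I_def using fin C(1) by (subst sum.Sigma) (auto simp: split_beta)
    finally show ?thesis .
  qed
  have "eventually (\<lambda>\<epsilon>. \<forall>i\<in>I. c (fst i) * ennreal (snd (snd i) ^ (?N - 1)) \<le> (\<integral>\<^sup>+z\<in>?cube (snd i). f \<epsilon> z \<partial>lebesgue)) G"
    using finI locI(2) by (intro eventually_ball_finite) auto
  then show ?thesis
  proof eventually_elim
    case (elim \<epsilon>)
    have "(\<Sum>i\<in>I. c (fst i) * ennreal (snd (snd i) ^ (?N - 1))) \<le> (\<Sum>i\<in>I. \<integral>\<^sup>+z\<in>?cube (snd i). f \<epsilon> z \<partial>lebesgue)"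
      using elim by (intro sum_mono) auto
    also have "\<dots> \<le> (\<integral>\<^sup>+z\<in>\<Omega>. f \<epsilon> z \<partial>lebesgue)"
      using finI pw locI(1) by (intro nn_integral_disjoint_family_le) auto
    finally show ?case using lower by (rule order_trans[rotated])
  qed
qed

lemma ennreal_le_if_scaled_le:
  fixes A B :: ennreal
  assumes "\<And>l. 0 < l \<Longrightarrow> l < 1 \<Longrightarrow> ennreal l * A \<le> B"
  shows "A \<le> B"
proof (cases A)
  case top
  then show ?thesis using assms[of "1/2"] by (simp add: ennreal_mult_top)
next
  case (real a)
  show ?thesis
  proof (cases B)
    case b: (real b)
    have "a \<le> b"
    proof (rule field_le_mult_one_interval)
      fix l :: real assume "0 < l" "l < 1"
      then show "l * a \<le> b" using assms[of l] real b by (simp add: ennreal_mult[symmetric])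
    qed
    then show ?thesis using real b by (simp add: ennreal_leI)
  qed simp
qed

text \<open>The loss in \<open>cubes_fill_flat_compact\<close> can be made smaller than any given factor.\<close>

lemma flat_factor_close_to_one:
  assumes "0 < l" "l < (1::real)"
  obtains \<delta> where "0 < \<delta>" "\<delta> \<le> 1/4" "l * ((1 + \<delta>) * (1 + 2 * \<delta>)) ^ n \<le> 1"
proof -
  have "((\<lambda>\<delta>::real. l * ((1 + \<delta>) * (1 + 2 * \<delta>)) ^ n) \<longlongrightarrow> l * ((1 + 0) * (1 + 2 * 0)) ^ n) (at_right 0)"
    by (intro tendsto_intros)
  then have "eventually (\<lambda>\<delta>::real. l * ((1 + \<delta>) * (1 + 2 * \<delta>)) ^ n < 1) (at_right 0)"
    using assms by (intro order_tendstoD(2)) auto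
  then obtain b where b: "0 < b" "\<And>\<delta>. 0 < \<delta> \<Longrightarrow> \<delta> < b \<Longrightarrow> l * ((1 + \<delta>) * (1 + 2 * \<delta>)) ^ n < 1"
    unfolding eventually_at_right_field by blast
  define \<delta> where "\<delta> = min (b/2) (1/4)"
  have "0 < \<delta>" "\<delta> < b" "\<delta> \<le> 1/4" using b(1) by (auto simp: \<delta>_def)
  then show ?thesis using b(2)[of \<delta>] that[of \<delta>] by simp
qed

theorem theorem1p2:
  fixes \<Omega> :: "(real^'N) set"
    and F :: "('N list \<Rightarrow> ('N::finite, 'k::finite, 'd::finite, 'm::finite) state) \<Rightarrow> real"
    and v vp vm :: "real^'N \<Rightarrow> ('N, 'k, 'd, 'm) state"
    and nu :: "real^'N \<Rightarrow> real^'N"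
    and frame :: "real^'N \<Rightarrow> (real^'N) set"
    and w :: "real \<Rightarrow> real^'N \<Rightarrow> ('N, 'k, 'd, 'm) state"
    and n :: nat and p :: real
  assumes "1 \<le> n" and "1 \<le> p" and "open \<Omega>"
    and "continuous_on (jets n) F" and "\<And>z. z \<in> jets n \<Longrightarrow> 0 \<le> F z"
    and "\<And>\<nu>. norm \<nu> = 1 \<Longrightarrow> orthonormal_basis_through \<nu> (frame \<nu>)"
    and "class_B \<Omega> v" and "BV \<Omega> v" and "Linfty \<Omega> v"
    and "AE x in lebesgue_on \<Omega>. F (constant_jet (v x)) = 0"
    and "\<And>x. x \<in> jump_set \<Omega> v \<Longrightarrow> jump_triple v x (vp x) (vm x) (nu x)"
    and "\<And>\<epsilon>. \<epsilon> > 0 \<Longrightarrow> class_B \<Omega> (w \<epsilon>) \<and> W1loc n \<Omega> (w \<epsilon>)"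
    and "Lp_tendsto p \<Omega> w v"
  shows "Liminf (at_right 0) (\<lambda>\<epsilon>. energy n F \<Omega> \<epsilon> (w \<epsilon>)) \<ge> K_star n F p frame \<Omega> v vp vm nu"
proof -
  let ?N = "CARD('N)"
  obtain N1 where N1: "N1 = ?N - 1" by simp
  let ?H = "hausdorff_measure N1 :: (real^'N) measure"
  let ?h = "hausdorff_outer N1 :: (real^'N) set \<Rightarrow> ennreal"
  let ?J = "jump_set \<Omega> v"
  let ?L = "Liminf (at_right 0) (\<lambda>\<epsilon>. energy n F \<Omega> \<epsilon> (w \<epsilon>))"
  define g where "g x = E_abst n F p (frame (nu x)) (vp x) (vm x) (nu x)" for x
  have v: "set_integrable lebesgue \<Omega> v" using assms(8) by (simp add: BV_def)
  obtain B where B: "AE x in lebesgue_on \<Omega>. norm (v x) \<le> B" using assms(9) by (auto simp: Linfty_def)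
  have J: "x \<in> \<Omega>" "jump_triple v x (vp x) (vm x) (nu x)" "orthonormal_basis_through (nu x) (frame (nu x))" if "x \<in> ?J" for x
    using that assms(11)[OF that] assms(6)[of "nu x"] by (auto simp: jump_set_def jump_triple_def)
  have loc: "\<exists>R>0. \<forall>r. 0 < r \<and> r < R \<longrightarrow> cube_at (frame (nu x)) x r \<subseteq> \<Omega> \<and>
      eventually (\<lambda>\<epsilon>. c * ennreal (r ^ N1) \<le> local_energy n F \<Omega> \<epsilon> (w \<epsilon>) (cube_at (frame (nu x)) x r)) (at_right 0)"
    if "x \<in> ?J" "c < g x" for x c
    using that unfolding g_def N1
    by (intro eventually_energy_ge_E_abst[OF assms(3) J(1)[OF that(1)] v B J(2)[OF that(1)] J(3)[OF that(1)] assms(2) assms(12,13)])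
  have em: "emeasure ?H A = ?h A" if "A \<in> sets ?H" for A using that by (rule emeasure_hausdorff_measure)
  have spH: "space ?H = UNIV" unfolding hausdorff_measure_def by (rule space_measure_of) simp
  have bH: "A \<in> sets ?H" if "A \<in> sets borel" for A using borel_subset_sets_hausdorff that by blast
  \<comment> \<open>One factor \<open>l\<close> is spent on passing to compact subsets, one on the flatness parameter \<open>\<delta>\<close>, and one on
    making the inequality between the simple function and \<open>E_abst\<close> strict. As the last is possible for finite values only,
    \<open>s\<close> is finite.\<close>
  have simple: "ennreal (l ^ 3) * integral\<^sup>N ?H s \<le> ?L"
    if l: "0 < l" "l < 1" and s: "simple_function ?H s" "\<And>x. s x \<le> g x * indicator ?J x" "\<And>x. s x < top" for l s
  proof -
    obtain \<delta> where \<delta>: "0 < \<delta>" "\<delta> \<le> 1/4" "l * ((1 + \<delta>) * (1 + 2 * \<delta>)) ^ N1 \<le> 1"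
      using flat_factor_close_to_one[OF l] by blast
    have \<delta>1: "\<delta> \<le> 1" using \<delta>(2) by simp
    obtain P \<theta> where P: "\<And>i::nat. compact (P i)" "\<And>i::nat. norm (\<theta> i) = 1"
      "\<And>i x y. x \<in> P i \<Longrightarrow> y \<in> P i \<Longrightarrow> \<bar>(y - x) \<bullet> \<theta> i\<bar> \<le> \<delta> * dist x y"
      "\<And>x a b \<nu>. x \<in> \<Omega> \<Longrightarrow> jump_triple v x a b \<nu> \<Longrightarrow> \<exists>i. x \<in> P i"
      "\<And>x a b \<nu> i. x \<in> \<Omega> \<Longrightarrow> jump_triple v x a b \<nu> \<Longrightarrow> x \<in> P i \<Longrightarrow> 1 - (\<nu> \<bullet> \<theta> i)\<^sup>2 \<le> \<delta>\<^sup>2"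
      using jump_set_covered_by_flat_compacts[OF assms(3) v \<delta>(1) \<delta>1] by blast
    \<comment> \<open>a Borel partition of a superset of the jump set\<close>
    define D where "D = disjointed P"
    have DP: "D i \<subseteq> P i" for i unfolding D_def by (rule disjointed_subset)
    have Dd: "disjoint_family D" unfolding D_def by (rule disjoint_family_disjointed)
    have Db: "D i \<in> sets borel" for i
      unfolding D_def disjointed_def using P(1) by (intro sets.Diff sets.finite_UN) (auto simp: borel_compact)
    have JD: "?J \<subseteq> (\<Union>i. D i)" unfolding D_def UN_disjointed_eq
    proof
      fix x assume "x \<in> ?J"
      from P(4)[OF J(1,2)[OF this]] show "x \<in> (\<Union>i. P i)" by blast
    qed
    define V where "V = s ` UNIV - {0}"
    have finV: "finite V" using simple_functionD(1)[OF s(1)] by (simp add: V_def spH)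
    \<comment> \<open>one value of the simple function and one flat piece of the jump set for each index\<close>
    define E where "E q = s -` {snd q} \<inter> D (fst q)" for q :: "nat \<times> ennreal"
    have sm: "s -` {c} \<in> sets ?H" for c using simple_functionD(2)[OF s(1), of "{c}"] by (simp add: spH)
    have EH: "E q \<in> sets ?H" for q unfolding E_def using sm bH[OF Db] by blast
    have VJ: "x \<in> ?J" "c \<le> g x" if "c \<in> V" "x \<in> s -` {c}" for c x
    proof -
      have "0 < s x" "s x = c" using that by (auto simp: V_def zero_less_iff_neq_zero)
      then show "x \<in> ?J" using s(2)[of x] by (cases "x \<in> ?J") auto
      then show "c \<le> g x" using s(2)[of x] \<open>s x = c\<close> by simp
    qed
    have Pfin: "?h (P i) < top" for i
      unfolding N1 by (rule hausdorff_outer_flat_compact_finite[OF P(2,1) less_imp_le[OF \<delta>(1)] \<delta>(2) P(3)])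
    have Efin: "?h (E q) < top" for q
    proof -
      have "E q \<subseteq> P (fst q)" using DP by (auto simp: E_def)
      then show ?thesis using Pfin by (meson hausdorff_outer_mono le_less_trans)
    qed
    have fin: "ennreal (l ^ 3) * (\<Sum>q\<in>Q. snd q * ?h (E q)) \<le> ?L" if Q: "finite Q" "Q \<subseteq> UNIV \<times> V" for Q
    proof -
      define e where "e q = enn2real (?h (E q))" for q
      have e: "?h (E q) = ennreal (e q)" "0 \<le> e q" for q using Efin[of q] by (simp_all add: e_def)
      have "\<exists>K. compact K \<and> K \<subseteq> E q \<and> (0 < e q \<longrightarrow> ennreal (l * e q) < ?h K)" for q
      proof (cases "0 < e q")
        case True
        have "l * e q < e q" using True l by simp
        then have "ennreal (l * e q) < ?h (E q)" using l True by (simp add: e(1) ennreal_less_iff)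
        then show ?thesis using hausdorff_inner_compact[OF EH Efin] by metis
      qed (auto intro: exI[of _ "{}"])
      then obtain K where K: "\<And>q. compact (K q)" "\<And>q. K q \<subseteq> E q" "\<And>q. 0 < e q \<Longrightarrow> ennreal (l * e q) < ?h (K q)" by metis
      have KJ: "x \<in> ?J" "x \<in> P (fst q)" "snd q \<le> g x" "0 < snd q" if "q \<in> Q" "x \<in> K q" for q x
      proof -
        have q: "snd q \<in> V" using Q(2) that(1) by auto
        have x: "x \<in> s -` {snd q}" "x \<in> D (fst q)" using K(2)[of q] that(2) by (auto simp: E_def)
        show "x \<in> ?J" "snd q \<le> g x" using VJ[OF q x(1)] .
        show "x \<in> P (fst q)" using x(2) DP by blast
        show "0 < snd q" using q by (simp add: V_def zero_less_iff_neq_zero)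
      qed
      have cfin: "snd q < top" if "q \<in> Q" for q using that Q(2) s(3) by (auto simp: V_def)
      have "eventually (\<lambda>\<epsilon>. (\<Sum>q\<in>Q. (ennreal l * snd q) * ennreal (l ^ 2 * e q)) \<le>
         local_energy n F \<Omega> \<epsilon> (w \<epsilon>) (\<Omega>)) (at_right 0)"
      proof (rule energy_ge_finite_sum[where K=K and \<theta>="\<lambda>q. \<theta> (fst q)" and \<delta>=\<delta> and \<nu>=nu and frm="\<lambda>x. frame (nu x)"])
        show "K p \<inter> K q = {}" if "p \<in> Q" "q \<in> Q" "p \<noteq> q" for p q
        proof -
          have "E p \<inter> E q = {}"
          proof (cases "fst p = fst q")
            case True
            then have "snd p \<noteq> snd q" using that(3) by (simp add: prod_eq_iff)
            then show ?thesis by (auto simp: E_def)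
          next
            case False
            then have "D (fst p) \<inter> D (fst q) = {}" using Dd by (auto simp: disjoint_family_on_def)
            then show ?thesis by (auto simp: E_def)
          qed
          then show ?thesis using K(2)[of p] K(2)[of q] by blast
        qed
        show "\<bar>(y - x) \<bullet> \<theta> (fst q)\<bar> \<le> \<delta> * dist x y" if "q \<in> Q" "x \<in> K q" "y \<in> K q" for q x y
          using P(3) KJ(2) that by blast
        show "orthonormal_basis_through (nu x) (frame (nu x))" if "q \<in> Q" "x \<in> K q" for q x
          by (rule J(3)[OF KJ(1)[OF that]])
        show "1 - (nu x \<bullet> \<theta> (fst q))\<^sup>2 \<le> \<delta>\<^sup>2" if "q \<in> Q" "x \<in> K q" for q x
          by (rule P(5)[OF J(1,2)[OF KJ(1)[OF that]] KJ(2)[OF that]])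
        show "0 \<le> l ^ 2 * e q" for q using e(2) by simp
        show "ennreal (l ^ 2 * e q * ((1 + \<delta>) * (1 + 2 * \<delta>)) ^ (?N - 1)) < hausdorff_outer (?N - 1) (K q)" if "q \<in> Q" "0 < l ^ 2 * e q" for q
        proof -
          have eq: "0 < e q" using that(2) l by (simp add: zero_less_mult_iff)
          have "l ^ 2 * e q * ((1 + \<delta>) * (1 + 2 * \<delta>)) ^ N1 = (l * e q) * (l * ((1 + \<delta>) * (1 + 2 * \<delta>)) ^ N1)"
            by (simp add: power2_eq_square)
          also have "\<dots> \<le> (l * e q) * 1" using \<delta>(3) l eq by (intro mult_left_mono) auto
          finally have "ennreal (l ^ 2 * e q * ((1 + \<delta>) * (1 + 2 * \<delta>)) ^ N1) < ?h (K q)"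
            using K(3)[OF eq] by (auto intro: le_less_trans ennreal_leI)
          then show ?thesis unfolding N1 .
        qed
        show "\<exists>R>0. \<forall>r. 0 < r \<and> r < R \<longrightarrow> cube_at (frame (nu x)) x r \<subseteq> \<Omega> \<and>
          eventually (\<lambda>\<epsilon>. ennreal l * snd q * ennreal (r ^ (?N - 1)) \<le> local_energy n F \<Omega> \<epsilon> (w \<epsilon>) (cube_at (frame (nu x)) x r)) (at_right 0)"
          if q: "q \<in> Q" "x \<in> K q" for q x
          unfolding N1[symmetric]
        proof (rule loc[OF KJ(1)[OF q]])
          have "ennreal l * snd q < 1 * snd q"
            using l KJ(4)[OF q] cfin[OF q(1)] by (cases "snd q") (auto simp: ennreal_mult[symmetric] ennreal_less_iff)
          then show "ennreal l * snd q < g x" using KJ(3)[OF q] by simp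
        qed
      qed (use Q P K \<delta> in auto)
      then have "(\<Sum>q\<in>Q. (ennreal l * snd q) * ennreal (l ^ 2 * e q)) \<le> ?L"
        unfolding energy_def by (rule Liminf_bounded)
      moreover have "(\<Sum>q\<in>Q. (ennreal l * snd q) * ennreal (l ^ 2 * e q)) = ennreal (l ^ 3) * (\<Sum>q\<in>Q. snd q * ?h (E q))"
        unfolding sum_distrib_left
      proof (rule sum.cong[OF refl])
        fix q
        have "ennreal (l ^ 3) = ennreal l * ennreal (l ^ 2)" using l by (simp add: ennreal_mult[symmetric] power3_eq_cube power2_eq_square)
        moreover have "ennreal (l ^ 2 * e q) = ennreal (l ^ 2) * ennreal (e q)" using e(2) by (simp add: ennreal_mult)
        ultimately show "ennreal l * snd q * ennreal (l ^ 2 * e q) = ennreal (l ^ 3) * (snd q * ?h (E q))"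
          by (simp add: e(1) mult_ac)
      qed
      ultimately show ?thesis by simp
    qed
    have "integral\<^sup>N ?H s = (\<Sum>c\<in>V. c * emeasure ?H (s -` {c}))"
    proof -
      have "integral\<^sup>N ?H s = (\<Sum>c\<in>s ` UNIV. c * emeasure ?H (s -` {c}))"
        using s(1) by (simp add: nn_integral_eq_simple_integral simple_integral_def spH)
      also have "\<dots> = (\<Sum>c\<in>V. c * emeasure ?H (s -` {c}))"
        unfolding V_def using s(1) by (intro sum.mono_neutral_right) (auto simp: simple_function_def spH)
      finally show ?thesis .
    qed
    also have "\<dots> = (\<Sum>c\<in>V. \<Sum>i. c * ?h (E (i, c)))"
    proof (rule sum.cong[OF refl])
      fix c assume c: "c \<in> V"
      have "s -` {c} = (\<Union>i. E (i, c))" using VJ(1)[OF c] JD by (auto simp: E_def)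
      moreover have "disjoint_family (\<lambda>i. E (i, c))" using Dd by (auto simp: disjoint_family_on_def E_def)
      ultimately have "emeasure ?H (s -` {c}) = (\<Sum>i. ?h (E (i, c)))"
        using EH suminf_emeasure[of "\<lambda>i. E (i, c)" ?H] by (simp add: em image_subset_iff)
      then show "c * emeasure ?H (s -` {c}) = (\<Sum>i. c * ?h (E (i, c)))" by simp
    qed
    also have "\<dots> = (\<Sum>i. \<Sum>c\<in>V. c * ?h (E (i, c)))"
      by (rule suminf_sum[symmetric]) auto
    also have "\<dots> = (SUP m. \<Sum>i<m. \<Sum>c\<in>V. c * ?h (E (i, c)))"
      by (rule suminf_eq_SUP)
    finally have "ennreal (l ^ 3) * integral\<^sup>N ?H s = (SUP m. ennreal (l ^ 3) * (\<Sum>i<m. \<Sum>c\<in>V. c * ?h (E (i, c))))"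
      by (simp add: SUP_mult_left_ennreal)
    also have "\<dots> \<le> ?L"
    proof (rule SUP_least)
      fix m
      have "(\<Sum>i<m. \<Sum>c\<in>V. c * ?h (E (i, c))) = (\<Sum>q\<in>{..<m} \<times> V. snd q * ?h (E q))"
        by (simp add: sum.cartesian_product split_beta)
      then show "ennreal (l ^ 3) * (\<Sum>i<m. \<Sum>c\<in>V. c * ?h (E (i, c))) \<le> ?L"
        using fin[of "{..<m} \<times> V"] finV by auto
    qed
    finally show ?thesis .
  qed
  have "integral\<^sup>N ?H s \<le> ?L"
    if s: "simple_function ?H s" "\<And>x. s x \<le> g x * indicator ?J x" "\<And>x. s x < top" for s
  proof (rule ennreal_le_if_scaled_le)
    fix l :: real assume l: "0 < l" "l < 1"
    have "root 3 l ^ 3 = l" using l by simp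
    moreover have "0 < root 3 l" "root 3 l < 1" using l by auto
    ultimately show "ennreal l * integral\<^sup>N ?H s \<le> ?L" using simple[OF _ _ s, of "root 3 l"] by simp
  qed
  then have "(\<integral>\<^sup>+x\<in>?J. g x \<partial>?H) \<le> ?L"
    unfolding nn_integral_def_finite[of _ "\<lambda>x. g x * indicator ?J x"]
  proof (intro SUP_least)
    fix s assume all: "\<And>s. simple_function ?H s \<Longrightarrow> (\<And>x. s x \<le> g x * indicator ?J x) \<Longrightarrow> (\<And>x. s x < top) \<Longrightarrow> integral\<^sup>N ?H s \<le> ?L"
      and s: "s \<in> {f. simple_function ?H f \<and> f \<le> (\<lambda>x. g x * indicator ?J x) \<and> (\<forall>x. f x < top)}"
    have "integral\<^sup>N ?H s \<le> ?L" using s by (intro all) (auto simp: le_fun_def)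
    then show "integral\<^sup>S ?H s \<le> ?L" using s nn_integral_eq_simple_integral[of ?H s] by simp
  qed
  then show ?thesis by (simp add: K_star_def g_def N1)
qed

end
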